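(* Let $P_{\min}$, $f_{\min}$, $d_{\min}$ be the minimum isoperimetric function, the minimum filling length function, and the minimum isodiametric function, respectively, of a finite presentation $\langle A;R\rangle$, and let $p_{\min}$ be its minimum folded isoperimetric function. These functions are related as follows, where $c>1$ is a constant that depends on the presentation (the constant may be different in different parts): (1) $d_{\min}(n)\le\frac12\,f_{\min}(n)\le c\cdot(P_{\min}(n)+n)$, and $p_{\min}(n)\le P_{\min}(n)$. (2) $P_{\min}(n)\le n\,c^{c^{d_{\min}(n)}}$ (Cohen's double exponential inequality). (3) $P_{\min}(n)\le c^{f_{\min}(n)}$ (Gromov, Gersten). (4) $f_{\min}(n)\le c^{d_{\min}(n)+n}$ (Gersten, Riley). (5) $p_{\min}(n)\le c^{d_{\min}(n)}$.
   Context: Notation. $A$ is a finite alphabet, $A^{-1}$ a disjoint copy, $A^{\pm1}=A\cup A^{-1}$, $(A^{\pm1})^*$ the set of words over $A^{\pm1}$, $|w|$ the length of $w$, and $1$ the empty word. $R\subset(A^{\pm1})^*$ is a finite set of relators not containing the empty word; $R^{\pm1}=R\cup\{r^{-1}:r\in R\}$; $x^y=y^{-1}xy$. $=_{\mathrm{FG}}$ is equality in the free group on $A$ and $=_{\langle A;R\rangle}$ equality in the presented group. "Minimum" means pointwise smallest. An isoperimetric function is any $P:\mathbb N\to\mathbb N$ such that every word $w$ with $w=_{\langle A;R\rangle}1$ satisfies $w=_{\mathrm{FG}}\prod_{i\in I}r_i^{x_i}$ for some finite sequence of $r_i\in R^{\pm1}$ and words $x_i\in(A^{\pm1})^*$ with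 $|I|\le P(|w|)$ (equivalently, $w$ has a van Kampen diagram of area $\le P(|w|)$). An isodiametric function is any $D:\mathbb N\to\mathbb N$ such that every word $w$ with $w=_{\langle A;R\rangle}1$ satisfies $w=_{\mathrm{FG}}\prod_{i\in I}r_i^{x_i}$ for some finite sequence of $r_i\in R^{\pm1}$ and words $x_i\in(A^{\pm1})^*$ with $|x_i|\le D(|w|)$ for all $i\in I$. A filling length function is any $F:\mathbb N\to\mathbb N$ such that every word $w$ with $w=_{\langle A;R\rangle}1$ can be rewritten to $1$, using the rewrite rules $\{u\to v: u,v\in(A^{\pm1})^*,\ uv^{-1}\in R^{\pm1}\}\cup\{aa^{-1}\to1,\ 1\to aa^{-1}: a\in A^{\pm1}\}$, in such a way that all intermediate words in the rewrite sequence have length $\le F(|w|)$. Folding a van Kampen diagram: repeatedly, as long as possible, whenever there are edges $v_1\stackrel{a}{\leftarrow}v_2\stackrel{a}{\to}v_3$ or $v_1\stackrel{a}{\to}v_2\stackrel{a}{\leftarrow}v_3$ with the same label $a\in A$, identify $v_1$ with $v_3$ and the two edges with each other. The folded area of a van Kampen diagram is the number of faces of the 2-complex so obtained, where faces that have the same boundary loop are viewed as the same face. A folded isoperimetric function is any $p:\mathbb N\to\mathbb N$ such that every word $w$ with $w=_{\langle A;R\rangle}1$ has a van Kampen diagram whose folded area is $\le p(|w|)$.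
   Formalization: Part (5) is proved as p_min(n) ≤ c^{max(1, d_min(n))}: when d_min(n)=0 the printed bound p_min(n) ≤ 1 can fail (A=R={a,b} has d_min=0 but p_min(2) ≥ 2); for d_min(n) ≥ 1 it is the printed inequality. *)

theory Defs
  imports Complex_Main "HOL-Combinatorics.Combinatorics"
begin

section \<open>Words and group presentations\<close>

text \<open>The letter \<open>(a, True)\<close> stands for \<open>a\<close> and \<open>(a, False)\<close> for its formal inverse. The same
  encoding is used further down for oriented edges (darts) of a 2-complex, so that edge paths are
  words over the edges.\<close>

type_synonym 'a letter = "'a \<times> bool"
type_synonym 'a word = "'a letter list"

definition inv_letter :: "'a letter \<Rightarrow> 'a letter" where
  "inv_letter x = (fst x, \<not> snd x)"

definition inv_word :: "'a word \<Rightarrow> 'a word" where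
  "inv_word w = rev (map inv_letter w)"

definition letters :: "'a set \<Rightarrow> 'a letter set" where
  "letters A = A \<times> UNIV"

definition words :: "'a set \<Rightarrow> 'a word set" where
  "words A = lists (letters A)"

definition sym_rel :: "'a word set \<Rightarrow> 'a word set" where
  "sym_rel R = R \<union> inv_word ` R"

inductive pres_eq :: "'a set \<Rightarrow> 'a word set \<Rightarrow> 'a word \<Rightarrow> 'a word \<Rightarrow> bool"
  for A :: "'a set" and R :: "'a word set" where
  refl: "w \<in> words A \<Longrightarrow> pres_eq A R w w"
| sym: "pres_eq A R v w \<Longrightarrow> pres_eq A R w v"
| trans: "pres_eq A R u v \<Longrightarrow> pres_eq A R v w \<Longrightarrow> pres_eq A R u w"
| cancel: "u \<in> words A \<Longrightarrow> v \<in> words A \<Longrightarrow> x \<in> letters A \<Longrightarrow>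
    pres_eq A R (u @ [x, inv_letter x] @ v) (u @ v)"
| relator: "u \<in> words A \<Longrightarrow> v \<in> words A \<Longrightarrow> r \<in> R \<Longrightarrow> pres_eq A R (u @ r @ v) (u @ v)"

abbreviation free_eq :: "'a set \<Rightarrow> 'a word \<Rightarrow> 'a word \<Rightarrow> bool" where
  "free_eq A \<equiv> pres_eq A {}"


section \<open>Isoperimetric, isodiametric and filling length functions\<close>

definition conj_prod :: "('a word \<times> 'a word) list \<Rightarrow> 'a word" where
  "conj_prod ps = concat (map (\<lambda>(r, x). inv_word x @ r @ x) ps)"

definition isoperimetric :: "'a set \<Rightarrow> 'a word set \<Rightarrow> (nat \<Rightarrow> nat) \<Rightarrow> bool" where
  "isoperimetric A R P \<longleftrightarrow>
    (\<forall>w \<in> words A. pres_eq A R w [] \<longrightarrow>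
      (\<exists>ps. set ps \<subseteq> sym_rel R \<times> words A \<and> free_eq A w (conj_prod ps) \<and>
        length ps \<le> P (length w)))"

definition isodiametric :: "'a set \<Rightarrow> 'a word set \<Rightarrow> (nat \<Rightarrow> nat) \<Rightarrow> bool" where
  "isodiametric A R D \<longleftrightarrow>
    (\<forall>w \<in> words A. pres_eq A R w [] \<longrightarrow>
      (\<exists>ps. set ps \<subseteq> sym_rel R \<times> words A \<and> free_eq A w (conj_prod ps) \<and>
        (\<forall>(r, x) \<in> set ps. length x \<le> D (length w))))"

inductive rewrite_step :: "'a set \<Rightarrow> 'a word set \<Rightarrow> 'a word \<Rightarrow> 'a word \<Rightarrow> bool"
  for A :: "'a set" and R :: "'a word set" where
  apply_relator: "u \<in> words A \<Longrightarrow> v \<in> words A \<Longrightarrow> u @ inv_word v \<in> sym_rel R \<Longrightarrow>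
    rewrite_step A R (p @ u @ q) (p @ v @ q)"
| free_reduction: "x \<in> letters A \<Longrightarrow> rewrite_step A R (p @ [x, inv_letter x] @ q) (p @ q)"
| free_expansion: "x \<in> letters A \<Longrightarrow> rewrite_step A R (p @ q) (p @ [x, inv_letter x] @ q)"

text \<open>All words of the rewrite sequence count towards its filling length, including the first
  word \<open>w\<close>.\<close>

definition filling_length :: "'a set \<Rightarrow> 'a word set \<Rightarrow> (nat \<Rightarrow> nat) \<Rightarrow> bool" where
  "filling_length A R F \<longleftrightarrow>
    (\<forall>w \<in> words A. pres_eq A R w [] \<longrightarrow>
      (\<lambda>u v. rewrite_step A R u v \<and> length u \<le> F (length w) \<and> length v \<le> F (length w))\<^sup>*\<^sup>* w [])"


section \<open>Labelled 2-complexes and folding\<close>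

text \<open>Every edge has one orientation in which it reads a letter of the alphabet; the dart
  \<open>(e, True)\<close> runs along it and \<open>(e, False)\<close> against it. A face is given by boundary loops; two
  loops that differ by the choice of starting point or by the direction describe the same face.\<close>

record ('v, 'e, 'a) two_complex =
  verts :: "'v set"
  edges :: "'e set"
  src :: "'e \<Rightarrow> 'v"
  tgt :: "'e \<Rightarrow> 'v"
  lab :: "'e \<Rightarrow> 'a"
  loops :: "'e word set"

definition darts :: "('v, 'e, 'a) two_complex \<Rightarrow> 'e letter set" where
  "darts X = letters (edges X)"

definition origin :: "('v, 'e, 'a) two_complex \<Rightarrow> 'e letter \<Rightarrow> 'v" where
  "origin X d = (if snd d then src X (fst d) else tgt X (fst d))"

definition path_label :: "('v, 'e, 'a) two_complex \<Rightarrow> 'e word \<Rightarrow> 'a word" where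
  "path_label X p = map (map_prod (lab X) id) p"

definition loop_class :: "'e word \<Rightarrow> 'e word set" where
  "loop_class l = (\<Union>k. {rotate k l, rotate k (inv_word l)})"

definition face_count :: "('v, 'e, 'a) two_complex \<Rightarrow> nat" where
  "face_count X = card (loop_class ` loops X)"

text \<open>Identify the vertex \<open>v'\<close> with \<open>v\<close> and the edge \<open>e'\<close> with \<open>e\<close>.\<close>

definition identify ::
  "'v \<Rightarrow> 'v \<Rightarrow> 'e \<Rightarrow> 'e \<Rightarrow> ('v, 'e, 'a) two_complex \<Rightarrow> ('v, 'e, 'a) two_complex" where
  "identify v v' e e' X =
    \<lparr>verts = (id(v' := v)) ` verts X,
     edges = (id(e' := e)) ` edges X,
     src = id(v' := v) \<circ> src X,
     tgt = id(v' := v) \<circ> tgt X,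
     lab = lab X,
     loops = map (map_prod (id(e' := e)) id) ` loops X\<rparr>"

inductive fold_step :: "('v, 'e, 'a) two_complex \<Rightarrow> ('v, 'e, 'a) two_complex \<Rightarrow> bool" where
  fold_out: "e \<in> edges X \<Longrightarrow> e' \<in> edges X \<Longrightarrow> e \<noteq> e' \<Longrightarrow> lab X e = lab X e' \<Longrightarrow>
    src X e = src X e' \<Longrightarrow> fold_step X (identify (tgt X e) (tgt X e') e e' X)"
| fold_in: "e \<in> edges X \<Longrightarrow> e' \<in> edges X \<Longrightarrow> e \<noteq> e' \<Longrightarrow> lab X e = lab X e' \<Longrightarrow>
    tgt X e = tgt X e' \<Longrightarrow> fold_step X (identify (src X e) (src X e') e e' X)"

definition folds_to :: "('v, 'e, 'a) two_complex \<Rightarrow> ('v, 'e, 'a) two_complex \<Rightarrow> bool" where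
  "folds_to X Y \<longleftrightarrow> fold_step\<^sup>*\<^sup>* X Y \<and> (\<nexists>Z. fold_step Y Z)"

text \<open>Up to isomorphism the completely folded complex does not depend on the order of the folds.\<close>

definition folded_area :: "('v, 'e, 'a) two_complex \<Rightarrow> nat" where
  "folded_area X = face_count (SOME Y. folds_to X Y)"


section \<open>Van Kampen diagrams\<close>

text \<open>A van Kampen diagram is a finite connected and simply connected 2-complex in the plane. The
  plane embedding is given by a rotation system \<open>\<sigma>\<close>, which permutes the darts at each vertex
  cyclically. The orbits of \<open>\<sigma> \<circ> inv_letter\<close> are then the boundary walks of the complementary
  regions of the 1-skeleton. The outer region has boundary walk \<open>bs\<close>, read from the base vertex;
  all other regions are faces. Planarity is expressed by Euler's formula, not counting
  the outer region. A complex with a single vertex and no edges has the empty boundary walk.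

  For a permutation \<open>p\<close>, \<open>support p d\<close> is the list \<open>d, p d, p (p d), \<dots>\<close> running once through the
  orbit of \<open>d\<close>.\<close>

definition disc_complex ::
  "('v, 'e, 'a) two_complex \<Rightarrow> ('e letter \<Rightarrow> 'e letter) \<Rightarrow> 'e word \<Rightarrow> bool" where
  "disc_complex X \<sigma> bs \<longleftrightarrow>
    finite (verts X) \<and> finite (edges X) \<and> verts X \<noteq> {} \<and>
    src X ` edges X \<subseteq> verts X \<and> tgt X ` edges X \<subseteq> verts X \<and>
    (\<forall>u \<in> verts X. \<forall>v \<in> verts X.
      (u, v) \<in> {(origin X d, origin X (inv_letter d)) |d. d \<in> darts X}\<^sup>*) \<and>
    \<sigma> permutes darts X \<and>
    (\<forall>d \<in> darts X. orbit \<sigma> d = {d' \<in> darts X. origin X d' = origin X d}) \<and>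
    (if darts X = {} then bs = [] else \<exists>d \<in> darts X. bs = support (\<sigma> \<circ> inv_letter) d) \<and>
    loops X = {support (\<sigma> \<circ> inv_letter) d |d. d \<in> darts X - set bs} \<and>
    card (verts X) + card (orbit (\<sigma> \<circ> inv_letter) ` (darts X - set bs)) = card (edges X) + 1"

definition van_kampen ::
  "'a set \<Rightarrow> 'a word set \<Rightarrow> 'a word \<Rightarrow> ('v, 'e, 'a) two_complex \<Rightarrow> bool" where
  "van_kampen A R w X \<longleftrightarrow>
    lab X ` edges X \<subseteq> A \<and>
    (\<exists>\<sigma> bs. disc_complex X \<sigma> bs \<and> path_label X bs = w) \<and>
    (\<forall>l \<in> loops X. \<exists>k. path_label X (rotate k l) \<in> sym_rel R)"

definition folded_isoperimetric :: "'a set \<Rightarrow> 'a word set \<Rightarrow> (nat \<Rightarrow> nat) \<Rightarrow> bool" where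
  "folded_isoperimetric A R p \<longleftrightarrow>
    (\<forall>w \<in> words A. pres_eq A R w [] \<longrightarrow>
      (\<exists>X :: (nat, nat, 'a) two_complex. van_kampen A R w X \<and> folded_area X \<le> p (length w)))"


section \<open>The minimum functions\<close>

text \<open>Functions are ordered pointwise, so these are pointwise smallest functions.\<close>

definition P_min :: "'a set \<Rightarrow> 'a word set \<Rightarrow> nat \<Rightarrow> nat" where
  "P_min A R = (LEAST P. isoperimetric A R P)"

definition d_min :: "'a set \<Rightarrow> 'a word set \<Rightarrow> nat \<Rightarrow> nat" where
  "d_min A R = (LEAST D. isodiametric A R D)"

definition f_min :: "'a set \<Rightarrow> 'a word set \<Rightarrow> nat \<Rightarrow> nat" where
  "f_min A R = (LEAST F. filling_length A R F)"

definition p_min :: "'a set \<Rightarrow> 'a word set \<Rightarrow> nat \<Rightarrow> nat" where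
  "p_min A R = (LEAST p. folded_isoperimetric A R p)"

end

theory Submission
  imports Defs
begin

text \<open>The inequalities that bound areas and lengths by the isodiametric function come from folding the
  ball of radius \<open>2 d + K\<close> in the Cayley tree, \<open>K\<close> being the maximal length of a relator, until every
  relator conjugated by a word of length at most \<open>d\<close> is closed. At most exponentially many (in \<open>d\<close>)
  pairs of vertices get identified. One identification multiplies the number of conjugates needed to
  pass between identified vertices by a constant, but adds only a constant to the length of the
  intermediate words; reading a word letter by letter in the folded ball gives Cohen's inequality and
  the one of Gersten and Riley.

  Diagrams are described by their boundary walks: the first edge of the walk is a bridge, or its
  removal opens a face. This description is preserved by cancelling two inverse letters of the walk,
  where a sphere that closes up is dropped without changing distances from the base point outside it.
  So a product of \<open>k\<close> conjugates, with conjugators of length at most \<open>d\<close>, yields a diagram of the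
  represented word with at most \<open>k\<close> faces, all within distance \<open>d + K\<close> of a base point. Removing its
  edges one by one bounds the filling length linearly. In the folded diagram a face is determined by
  the labels of its boundary and of a path of length at most \<open>d + K\<close> to it.\<close>

text \<open>Bounding area by filling length does not use the ball: a rewriting sequence yields a
  product of conjugates with at most one factor for each step, and among the finitely many words of
  bounded length a sequence with a bounded number of steps suffices. The obstacle in building
  diagrams is planarity. A product of conjugates equals the given word only in the free group, and
  the cancellations glue boundary edges, which is awkward for a rotation system. The predicate
  \<open>disc\<close> therefore carries no embedding. A rotation system is rebuilt at the end by
  replaying the construction of \<open>disc\<close> inside the outer region, one leaf or one chord
  at a time, with Euler's formula as the invariant. Cancellation leads from the product to the
  normal form \<open>nf w\<close>; the cancelling pairs that distinguish \<open>w\<close> from it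
  are put back as hairs of the embedded diagram. Hairs may lead far away from the base point, so the
  bound on distances is imposed only on the vertices of faces.\<close>

section \<open>Formal inverses and equality in presented groups\<close>

lemma inv_letter_inv_letter [simp]: "inv_letter (inv_letter x) = x"
  by (simp add: inv_letter_def)

lemma fst_inv_letter [simp]: "fst (inv_letter x) = fst x"
  and snd_inv_letter [simp]: "snd (inv_letter x) = (\<not> snd x)"
  by (simp_all add: inv_letter_def)

lemma inv_letter_eq_iff [simp]: "inv_letter x = inv_letter y \<longleftrightarrow> x = y"
  by (metis inv_letter_inv_letter)

lemma inv_letter_neq [simp]: "inv_letter x \<noteq> x" "x \<noteq> inv_letter x"
  by (auto simp: inv_letter_def prod_eq_iff)

lemma inv_letter_in_letters [simp]: "inv_letter x \<in> letters A \<longleftrightarrow> x \<in> letters A"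
  by (cases x) (auto simp: letters_def inv_letter_def)

lemma inv_word_simps [simp]:
  "inv_word [] = []"
  "inv_word (x # w) = inv_word w @ [inv_letter x]"
  "inv_word (u @ v) = inv_word v @ inv_word u"
  by (simp_all add: inv_word_def)

lemma inv_word_inv_word [simp]: "inv_word (inv_word w) = w"
  by (induction w) auto

lemma length_inv_word [simp]: "length (inv_word w) = length w"
  by (simp add: inv_word_def)

lemma inv_word_eq_Nil [simp]: "inv_word w = [] \<longleftrightarrow> w = []"
  by (simp add: inv_word_def)

lemma words_simps [simp]:
  "[] \<in> words A"
  "x # w \<in> words A \<longleftrightarrow> x \<in> letters A \<and> w \<in> words A"
  "u @ v \<in> words A \<longleftrightarrow> u \<in> words A \<and> v \<in> words A"
  by (auto simp: words_def)

lemma inv_word_in_words [simp]: "inv_word w \<in> words A \<longleftrightarrow> w \<in> words A"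
  by (induction w) auto

lemma finite_letters: "finite A \<Longrightarrow> finite (letters A)"
  by (simp add: letters_def)

lemma inv_word_in_sym_rel [simp]: "inv_word r \<in> sym_rel R \<longleftrightarrow> r \<in> sym_rel R"
  unfolding sym_rel_def by (metis (no_types, lifting) Un_iff image_iff inv_word_inv_word)

lemma sym_rel_subset_words: "R \<subseteq> words A \<Longrightarrow> sym_rel R \<subseteq> words A"
  by (auto simp: sym_rel_def)

lemma pres_eq_in_words:
  assumes "R \<subseteq> words A" "pres_eq A R u v"
  shows "u \<in> words A" "v \<in> words A"
proof -
  from assms(2) have "u \<in> words A \<and> v \<in> words A"
    by induction (use assms(1) in auto)
  then show "u \<in> words A" "v \<in> words A" by auto
qed

lemmas free_eq_in_words = pres_eq_in_words[OF empty_subsetI]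

lemma pres_eq_context:
  assumes "pres_eq A R u v" "p \<in> words A" "q \<in> words A"
  shows "pres_eq A R (p @ u @ q) (p @ v @ q)"
  using assms(1)
proof induction
  case (refl w)
  then show ?case using assms by (auto intro: pres_eq.refl)
next
  case (sym v w)
  then show ?case by (auto intro: pres_eq.sym)
next
  case (trans u v w)
  then show ?case by (auto intro: pres_eq.trans)
next
  case (cancel u v x)
  then show ?case using pres_eq.cancel[of "p @ u" A "v @ q" x R] assms by auto
next
  case (relator u v r)
  then show ?case using pres_eq.relator[of "p @ u" A "v @ q" r R] assms by auto
qed

lemma pres_eq_append:
  assumes "R \<subseteq> words A" "pres_eq A R u u'" "pres_eq A R v v'"
  shows "pres_eq A R (u @ v) (u' @ v')"
proof -
  have "pres_eq A R ([] @ u @ v) ([] @ u' @ v)"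
    by (rule pres_eq_context) (use assms pres_eq_in_words in auto)
  moreover have "pres_eq A R (u' @ v @ []) (u' @ v' @ [])"
    by (rule pres_eq_context) (use assms pres_eq_in_words in auto)
  ultimately show ?thesis by (auto intro: pres_eq.trans)
qed

lemmas free_eq_append = pres_eq_append[OF empty_subsetI]

lemma free_eq_inverse_left: "w \<in> words A \<Longrightarrow> free_eq A (inv_word w @ w) []"
proof (induction w)
  case Nil
  then show ?case by (auto intro: pres_eq.refl)
next
  case (Cons x w)
  have "free_eq A (inv_word w @ [inv_letter x, inv_letter (inv_letter x)] @ w) (inv_word w @ w)"
    by (rule pres_eq.cancel) (use Cons in auto)
  then show ?case using Cons by (auto intro: pres_eq.trans)
qed

lemma free_eq_inverse_right: "w \<in> words A \<Longrightarrow> free_eq A (w @ inv_word w) []"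
  using free_eq_inverse_left[of "inv_word w" A] by simp

lemma free_eq_cancel_word:
  assumes "p \<in> words A" "q \<in> words A" "w \<in> words A"
  shows "free_eq A (p @ w @ inv_word w @ q) (p @ q)" "free_eq A (p @ inv_word w @ w @ q) (p @ q)"
  using pres_eq_context[OF free_eq_inverse_right[OF assms(3)] assms(1,2)]
    pres_eq_context[OF free_eq_inverse_left[OF assms(3)] assms(1,2)] by auto

lemma free_eq_inv_word: "free_eq A u v \<Longrightarrow> free_eq A (inv_word u) (inv_word v)"
proof -
  assume uv: "free_eq A u v"
  have w: "u \<in> words A" "v \<in> words A" using free_eq_in_words[OF uv] by auto
  have "free_eq A (inv_word u @ u @ inv_word v) (inv_word u @ v @ inv_word v)"
    by (rule pres_eq_context) (use w uv in auto)
  moreover have "free_eq A (inv_word u @ v @ inv_word v) (inv_word u)"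
    using free_eq_cancel_word(1)[of "inv_word u" A "[]" v] w by auto
  moreover have "free_eq A (inv_word u @ u @ inv_word v) (inv_word v)"
    using free_eq_cancel_word(2)[of "[]" A "inv_word v" u] w by auto
  ultimately show ?thesis by (meson pres_eq.sym pres_eq.trans)
qed

section \<open>Normal forms in the free group\<close>

text \<open>Oriented, and without reference to an alphabet: readings in the folded ball and
  unembedded diagrams are carried along such steps, embedded diagrams against them.\<close>

definition cancel1 :: "'a word \<Rightarrow> 'a word \<Rightarrow> bool" where
  "cancel1 u v \<longleftrightarrow> (\<exists>p x q. u = p @ x # inv_letter x # q \<and> v = p @ q)"

fun push :: "'a letter \<Rightarrow> 'a word \<Rightarrow> 'a word" where
  "push x [] = [x]"
| "push x (y # w) = (if y = inv_letter x then w else x # y # w)"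

definition nf :: "'a word \<Rightarrow> 'a word" where
  "nf w = foldr push w []"

fun reduced :: "'a word \<Rightarrow> bool" where
  "reduced [] = True"
| "reduced (x # w) = (reduced w \<and> (w = [] \<or> hd w \<noteq> inv_letter x))"

lemma nf_simps [simp]: "nf [] = []" "nf (x # w) = push x (nf w)"
  by (simp_all add: nf_def)

lemma reduced_push: "reduced w \<Longrightarrow> reduced (push x w)"
  by (cases w) auto

lemma reduced_nf [simp]: "reduced (nf w)"
  by (induction w) (auto simp: reduced_push)

text \<open>On reduced words \<open>push x\<close> and \<open>push (inv_letter x)\<close> are
  mutually inverse, so the free group acts on reduced words (van der Waerden's trick). Invariance of
  \<open>nf\<close> under cancellation follows from this without a confluence argument.\<close>

lemma push_push_inv: "reduced w \<Longrightarrow> push x (push (inv_letter x) w) = w"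
  by (cases w; cases "tl w") auto

lemma nf_cancel: "nf (p @ x # inv_letter x # q) = nf (p @ q)"
  by (induction p) (auto simp: push_push_inv)

lemma cancel1_nf: "cancel1 u v \<Longrightarrow> nf u = nf v"
  by (auto simp: cancel1_def nf_cancel)

lemma cancels_nf_eq: "cancel1\<^sup>*\<^sup>* u v \<Longrightarrow> nf u = nf v"
  by (induction rule: rtranclp_induct) (auto simp: cancel1_nf)

lemma cancel1_append: "cancel1 u v \<Longrightarrow> cancel1 (p @ u @ q) (p @ v @ q)"
  unfolding cancel1_def by (metis append.assoc append_Cons)

lemma cancels_append: "cancel1\<^sup>*\<^sup>* u v \<Longrightarrow> cancel1\<^sup>*\<^sup>* (p @ u @ q) (p @ v @ q)"
  by (induction rule: rtranclp_induct) (auto intro: rtranclp.rtrancl_into_rtrancl cancel1_append)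

lemma cancels_push: "cancel1\<^sup>*\<^sup>* (x # w) (push x w)"
proof (cases w)
  case (Cons y v)
  have "cancel1 (x # inv_letter x # v) v"
    unfolding cancel1_def by (intro exI[of _ "[]"] exI[of _ x] exI[of _ v]) simp
  then show ?thesis using Cons by auto
qed auto

lemma cancels_nf: "cancel1\<^sup>*\<^sup>* w (nf w)"
proof (induction w)
  case (Cons x w)
  have "cancel1\<^sup>*\<^sup>* (x # w) (x # nf w)" using cancels_append[OF Cons, of "[x]" "[]"] by simp
  then show ?case using cancels_push[of x "nf w"] by simp
qed simp

lemma nf_append_nf [simp]: "nf (nf u @ v) = nf (u @ v)" "nf (u @ nf v) = nf (u @ v)"
  using cancels_nf_eq[OF cancels_append[OF cancels_nf[of u], of "[]" v]]
    cancels_nf_eq[OF cancels_append[OF cancels_nf[of v], of u "[]"]] by auto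

lemma nf_nf [simp]: "nf (nf w) = nf w"
  using nf_append_nf(1)[of w "[]"] by simp

lemma cancels_in_words: "cancel1\<^sup>*\<^sup>* u v \<Longrightarrow> u \<in> words A \<Longrightarrow> v \<in> words A"
  by (induction rule: rtranclp_induct) (auto simp: cancel1_def)

lemma cancels_length: "cancel1\<^sup>*\<^sup>* u v \<Longrightarrow> length v \<le> length u"
  by (induction rule: rtranclp_induct) (auto simp: cancel1_def)

lemma nf_in_words [simp]: "w \<in> words A \<Longrightarrow> nf w \<in> words A"
  using cancels_in_words cancels_nf by blast

lemma length_nf_le: "length (nf w) \<le> length w"
  using cancels_length cancels_nf by blast

lemma free_eq_imp_nf_eq: "free_eq A u v \<Longrightarrow> nf u = nf v"
  by (induction rule: pres_eq.induct) (auto simp: nf_cancel)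

lemma cancels_imp_free_eq: "cancel1\<^sup>*\<^sup>* u v \<Longrightarrow> u \<in> words A \<Longrightarrow> free_eq A u v"
proof (induction rule: rtranclp_induct)
  case base
  then show ?case by (rule pres_eq.refl)
next
  case (step v w)
  then obtain p x q where *: "v = p @ [x, inv_letter x] @ q" "w = p @ q" by (auto simp: cancel1_def)
  have "v \<in> words A" using step cancels_in_words by blast
  then have "free_eq A v w" unfolding * by (intro pres_eq.cancel) auto
  then show ?case using step by (auto intro: pres_eq.trans)
qed

lemma free_eq_nf: "w \<in> words A \<Longrightarrow> free_eq A w (nf w)"
  by (simp add: cancels_imp_free_eq cancels_nf)

section \<open>Counting words\<close>

lemma finite_words_length_le: "finite A \<Longrightarrow> finite {w \<in> words A. length w \<le> n}"
  using finite_lists_length_le[OF finite_letters, of A n]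
  by (rule finite_subset[rotated]) (auto simp: words_def lists_eq_set)

lemma sum_power_le: "(\<Sum>i\<le>n. a ^ i) \<le> (a + 1 :: nat) ^ n"
proof (induction n)
  case (Suc n)
  have "a ^ Suc n \<le> a * (a + 1) ^ n"
    unfolding power_Suc by (intro mult_left_mono power_mono) auto
  from add_mono[OF Suc this] show ?case by simp
qed simp

lemma card_words_length_le:
  assumes "finite A"
  shows "card {w \<in> words A. length w \<le> n} \<le> (2 * card A + 1) ^ n"
proof -
  let ?a = "2 * card A"
  have "{w \<in> words A. length w \<le> n} = {w. set w \<subseteq> letters A \<and> length w \<le> n}"
    by (auto simp: words_def lists_eq_set)
  then have "card {w \<in> words A. length w \<le> n} = (\<Sum>i\<le>n. ?a ^ i)"
    using card_lists_length_le[OF finite_letters[OF assms]]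
    by (simp add: letters_def card_cartesian_product mult.commute)
  also have "\<dots> \<le> (?a + 1) ^ n"
    by (rule sum_power_le)
  finally show ?thesis .
qed

section \<open>Pointwise minimal functions\<close>

text \<open>The pointwise order on functions is not total, but \<open>LEAST\<close> still picks a
  minimum, because the constraints for different sizes are independent: at \<open>n\<close> it takes
  the least bound common to the finitely many elements of size \<open>n\<close>. Finiteness makes
  such a common bound exist.\<close>

lemma pointwise_Least:
  fixes Q :: "'w \<Rightarrow> nat \<Rightarrow> bool" and size :: "'w \<Rightarrow> nat"
  assumes fin: "\<And>n. finite {w \<in> W. size w = n}"
    and ex: "\<And>w. w \<in> W \<Longrightarrow> \<exists>k. Q w k"
    and mono: "\<And>w k l. Q w k \<Longrightarrow> k \<le> l \<Longrightarrow> Q w l"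
  defines "m \<equiv> (LEAST F. \<forall>w \<in> W. Q w (F (size w)))"
  shows "w \<in> W \<Longrightarrow> Q w (m (size w))"
    and "(\<And>w. w \<in> W \<Longrightarrow> size w = n \<Longrightarrow> Q w k) \<Longrightarrow> m n \<le> k"
proof -
  define bd where "bd n k \<longleftrightarrow> (\<forall>w \<in> W. size w = n \<longrightarrow> Q w k)" for n k
  have "\<exists>k. bd n k" for n
  proof -
    obtain g where g: "\<And>w. w \<in> W \<Longrightarrow> Q w (g w)" using ex by metis
    have "bd n (Max (g ` {w \<in> W. size w = n}))"
      unfolding bd_def by (auto intro: mono[OF g] simp: fin)
    then show ?thesis ..
  qed
  then have bd: "bd n (LEAST k. bd n k)" for n by (rule LeastI_ex)
  have "m = (\<lambda>n. LEAST k. bd n k)"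
    unfolding m_def
  proof (rule Least_equality)
    show "\<forall>w \<in> W. Q w (LEAST k. bd (size w) k)" using bd by (auto simp: bd_def)
    show "(\<lambda>n. LEAST k. bd n k) \<le> F" if "\<forall>w \<in> W. Q w (F (size w))" for F
      using that by (auto simp: le_fun_def bd_def intro!: Least_le)
  qed
  then show "w \<in> W \<Longrightarrow> Q w (m (size w))" "(\<And>w. w \<in> W \<Longrightarrow> size w = n \<Longrightarrow> Q w k) \<Longrightarrow> m n \<le> k"
    using bd by (auto simp: bd_def intro!: Least_le)
qed

section \<open>Products of conjugates of relators\<close>

text \<open>One predicate for both resources: \<open>k\<close> bounds the area and \<open>X\<close>
  confines the conjugators. \<open>X\<close> is \<open>UNIV\<close> for the isoperimetric function
  and a ball for the isodiametric one; some arguments need both bounds for the same product.\<close>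

definition fills :: "'a set \<Rightarrow> 'a word set \<Rightarrow> 'a word set \<Rightarrow> nat \<Rightarrow> 'a word \<Rightarrow> bool" where
  "fills A R X k w \<longleftrightarrow> (\<exists>ps. set ps \<subseteq> sym_rel R \<times> (words A \<inter> X) \<and> free_eq A w (conj_prod ps) \<and>
     length ps \<le> k)"

lemma conj_prod_simps [simp]:
  "conj_prod [] = []"
  "conj_prod ((r, x) # ps) = inv_word x @ r @ x @ conj_prod ps"
  "conj_prod (ps @ qs) = conj_prod ps @ conj_prod qs"
  by (auto simp: conj_prod_def)

lemma inv_word_conj_prod:
  "inv_word (conj_prod ps) = conj_prod (rev (map (\<lambda>(r, x). (inv_word r, x)) ps))"
  by (induction ps) auto

lemma fills_mono: "fills A R X k w \<Longrightarrow> k \<le> l \<Longrightarrow> X \<subseteq> Y \<Longrightarrow> fills A R Y l w"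
  unfolding fills_def by (meson Int_mono Sigma_mono order.refl order.trans)

lemma fills_free_eq: "fills A R X k v \<Longrightarrow> free_eq A u v \<Longrightarrow> fills A R X k u"
  unfolding fills_def by (meson pres_eq.trans)

lemma fills_Nil: "fills A R X k []"
  unfolding fills_def by (intro exI[of _ "[]"]) (auto intro: pres_eq.refl)

lemma fills_append:
  assumes "fills A R X k u" "fills A R X l v"
  shows "fills A R X (k + l) (u @ v)"
proof -
  obtain ps qs where "set ps \<subseteq> sym_rel R \<times> (words A \<inter> X)" "free_eq A u (conj_prod ps)" "length ps \<le> k"
    "set qs \<subseteq> sym_rel R \<times> (words A \<inter> X)" "free_eq A v (conj_prod qs)" "length qs \<le> l"
    using assms unfolding fills_def by auto
  then show ?thesis unfolding fills_def
    by (intro exI[of _ "ps @ qs"]) (auto intro: free_eq_append)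
qed

lemma fills_inv_word: "fills A R X k w \<Longrightarrow> fills A R X k (inv_word w)"
  unfolding fills_def
proof (elim exE conjE)
  fix ps assume *: "set ps \<subseteq> sym_rel R \<times> (words A \<inter> X)" "free_eq A w (conj_prod ps)" "length ps \<le> k"
  show "\<exists>qs. set qs \<subseteq> sym_rel R \<times> (words A \<inter> X) \<and> free_eq A (inv_word w) (conj_prod qs) \<and> length qs \<le> k"
    using * free_eq_inv_word[OF *(2)]
    by (intro exI[of _ "rev (map (\<lambda>(r, x). (inv_word r, x)) ps)"]) (auto simp: inv_word_conj_prod)
qed

lemma fills_conjugate:
  "R \<subseteq> words A \<Longrightarrow> r \<in> sym_rel R \<Longrightarrow> x \<in> words A \<Longrightarrow> x \<in> X \<Longrightarrow> fills A R X 1 (inv_word x @ r @ x)"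
  unfolding fills_def using sym_rel_subset_words[of R A]
  by (intro exI[of _ "[(r, x)]"]) (auto intro!: pres_eq.refl)

lemma free_eq_cancel_words:
  assumes "p \<in> words A" "q \<in> words A" "w \<in> words A"
  shows "free_eq A (p @ q) (p @ w @ inv_word w @ q)" "free_eq A (p @ q) (p @ inv_word w @ w @ q)"
  using free_eq_cancel_word[OF assms] by (auto intro: pres_eq.sym)

text \<open>Stated for \<open>u @ inv_word v\<close> so that the induction passes through: symmetry
  becomes inversion of the product, and transitivity concatenation followed by cancelling
  \<open>inv_word v @ v\<close>.\<close>

lemma pres_eq_imp_fills:
  assumes R: "R \<subseteq> words A" and "pres_eq A R u v"
  shows "\<exists>k. fills A R UNIV k (u @ inv_word v)"
  using assms(2)
proof induction
  case (refl w)
  then show ?case using fills_free_eq[OF fills_Nil free_eq_inverse_right] by blast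
next
  case (sym v w)
  then show ?case using fills_inv_word by fastforce
next
  case (trans u v w)
  then obtain k l where "fills A R UNIV k (u @ inv_word v)" "fills A R UNIV l (v @ inv_word w)" by auto
  from fills_append[OF this] have "fills A R UNIV (k + l) (u @ inv_word v @ v @ inv_word w)" by simp
  moreover have "u \<in> words A" "v \<in> words A" "w \<in> words A" using trans pres_eq_in_words[OF R] by auto
  ultimately show ?case using fills_free_eq free_eq_cancel_words(2)[of u A "inv_word w" v] by fastforce
next
  case (cancel u v x)
  have "free_eq A ((u @ [x, inv_letter x] @ v) @ inv_word (u @ v)) ((u @ v) @ inv_word (u @ v))"
    by (rule free_eq_append[OF pres_eq.cancel pres_eq.refl]) (use cancel in auto)
  moreover have "free_eq A ((u @ v) @ inv_word (u @ v)) []"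
    by (rule free_eq_inverse_right) (use cancel in auto)
  ultimately show ?case using fills_free_eq[OF fills_Nil] pres_eq.trans by metis
next
  case (relator u v r)
  then have r: "r \<in> sym_rel R" "r \<in> words A" using R by (auto simp: sym_rel_def)
  have "free_eq A ((u @ r) @ v @ inv_word v @ inv_word u) ((u @ r) @ inv_word u)"
    by (rule free_eq_cancel_word(1)) (use relator r in auto)
  then show ?case using fills_free_eq[OF fills_conjugate[OF R r(1), of "inv_word u" UNIV]] relator
    by fastforce
qed

lemma fills_of_trivial:
  assumes "R \<subseteq> words A" "pres_eq A R w []"
  shows "\<exists>k. fills A R UNIV k w"
  using pres_eq_imp_fills[OF assms] by simp

section \<open>Rewriting\<close>

definition rewritable :: "'a set \<Rightarrow> 'a word set \<Rightarrow> nat \<Rightarrow> 'a word \<Rightarrow> 'a word \<Rightarrow> bool" where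
  "rewritable A R F =
    (\<lambda>u v. rewrite_step A R u v \<and> length u \<le> F \<and> length v \<le> F)\<^sup>*\<^sup>*"

lemma rewritable_refl: "rewritable A R F u u"
  by (simp add: rewritable_def)

lemma rewritable_trans: "rewritable A R F u v \<Longrightarrow> rewritable A R F v w \<Longrightarrow> rewritable A R F u w"
  by (auto simp: rewritable_def)

lemma rewritable_step: "rewrite_step A R u v \<Longrightarrow> length u \<le> F \<Longrightarrow> length v \<le> F \<Longrightarrow> rewritable A R F u v"
  by (auto simp: rewritable_def)

lemma rewritable_mono: "rewritable A R F u v \<Longrightarrow> F \<le> G \<Longrightarrow> rewritable A R G u v"
  unfolding rewritable_def by (erule rtranclp_mono[THEN predicate2D, rotated]) auto

lemma rewrite_step_sym: "rewrite_step A R u v \<Longrightarrow> rewrite_step A R v u"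
proof (induction rule: rewrite_step.induct)
  case (apply_relator u v p q)
  then show ?case
    using rewrite_step.apply_relator[of v A u R p q] inv_word_in_sym_rel[of "u @ inv_word v" R] by simp
next
  case (free_reduction x p q)
  then show ?case by (rule rewrite_step.free_expansion)
next
  case (free_expansion x p q)
  then show ?case by (rule rewrite_step.free_reduction)
qed

lemma rewrite_step_context: "rewrite_step A R u v \<Longrightarrow> rewrite_step A R (p @ u @ q) (p @ v @ q)"
proof (induction rule: rewrite_step.induct)
  case (apply_relator u v p' q')
  then show ?case using rewrite_step.apply_relator[of u A v R "p @ p'" "q' @ q"] by simp
next
  case (free_reduction x p' q')
  then show ?case using rewrite_step.free_reduction[of x A R "p @ p'" "q' @ q"] by simp
next
  case (free_expansion x p' q')
  then show ?case using rewrite_step.free_expansion[of x A R "p @ p'" "q' @ q"] by simp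
qed

lemma rewritable_sym: "rewritable A R F u v \<Longrightarrow> rewritable A R F v u"
  unfolding rewritable_def
  by (rule sympD[OF sympI[THEN symp_rtranclp]]) (auto intro: rewrite_step_sym)

lemma rewritable_context:
  assumes "rewritable A R F u v" "length p + F + length q \<le> G"
  shows "rewritable A R G (p @ u @ q) (p @ v @ q)"
  using assms(1) unfolding rewritable_def
proof (induction rule: rtranclp_induct)
  case (step v w)
  then have "rewrite_step A R (p @ v @ q) (p @ w @ q)" using rewrite_step_context by blast
  then show ?case using step assms(2) by (auto intro: rtranclp.rtrancl_into_rtrancl)
qed simp

lemma rewrite_step_in_words: "rewrite_step A R u v \<Longrightarrow> u \<in> words A \<Longrightarrow> v \<in> words A"
  by (induction rule: rewrite_step.induct) auto

lemma cancels_imp_rewritable: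
  assumes "cancel1\<^sup>*\<^sup>* u v" "u \<in> words A" "length u \<le> F"
  shows "rewritable A R F u v"
  using assms(1)
proof (induction rule: rtranclp_induct)
  case base
  then show ?case by (rule rewritable_refl)
next
  case (step v w)
  then obtain p x q where *: "v = p @ [x, inv_letter x] @ q" "w = p @ q" by (auto simp: cancel1_def)
  have "v \<in> words A" "length v \<le> length u" using step cancels_in_words cancels_length assms by blast+
  then have "rewritable A R F v w" unfolding *
    using assms(3) by (intro rewritable_step rewrite_step.free_reduction) auto
  then show ?case using step rewritable_trans by blast
qed

lemma rewritable_nf: "u \<in> words A \<Longrightarrow> length u \<le> F \<Longrightarrow> rewritable A R F u (nf u)"
  by (simp add: cancels_imp_rewritable cancels_nf)

text \<open>A step in the left half of the word is undone by a conjugate multiplied from the left, a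
  step in the right half by one multiplied from the right, so the conjugator needs at most half
  of the available length.\<close>

lemma fills_rewrite_step:
  assumes R: "R \<subseteq> words A" and step: "rewrite_step A R w w'"
    and len: "length w \<le> F" "length w' \<le> F" and words: "w \<in> words A"
    and fills: "fills A R {x. length x \<le> F div 2} k w'"
  shows "fills A R {x. length x \<le> F div 2} (Suc k) w"
  using step
proof cases
  case (apply_relator u v p q)
  have pq: "p \<in> words A" "q \<in> words A" using words apply_relator by auto
  let ?X = "{x. length x \<le> F div 2}" and ?r = "u @ inv_word v"
  show ?thesis
  proof (cases "length p \<le> F div 2")
    case True
    have "free_eq A ((p @ u) @ inv_word v @ v @ q) ((p @ u) @ q)"
      "free_eq A ((p @ u @ inv_word v) @ inv_word p @ p @ v @ q) ((p @ u @ inv_word v) @ v @ q)"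
      by (rule free_eq_cancel_word(2); use pq apply_relator in auto)+
    then have "free_eq A w ((p @ ?r @ inv_word p) @ w')"
      unfolding apply_relator by (simp, meson pres_eq.sym pres_eq.trans)
    moreover have "fills A R ?X 1 (p @ ?r @ inv_word p)"
      using fills_conjugate[OF R apply_relator(5), of "inv_word p" ?X] pq True by simp
    ultimately show ?thesis using fills_append[OF _ fills] fills_free_eq by fastforce
  next
    case False
    \<comment> \<open>The product of \<open>p @ v @ q\<close> with
      \<open>inv_word (v @ q) @ u @ inv_word v @ (v @ q)\<close> is freely \<open>p @ u @ q\<close>.
      The conjugator contains the new subword \<open>v\<close>, so it is the length of
      \<open>w'\<close> that bounds it.\<close>
    then have l: "length (v @ q) \<le> F div 2" using len apply_relator by simp
    have "free_eq A ((p @ u) @ inv_word v @ v @ q) ((p @ u) @ q)"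
      "free_eq A (p @ (v @ q) @ inv_word (v @ q) @ u @ inv_word v @ v @ q) (p @ u @ inv_word v @ v @ q)"
      by (rule free_eq_cancel_word; use pq apply_relator in auto)+
    then have "free_eq A w (w' @ inv_word (v @ q) @ ?r @ (v @ q))"
      unfolding apply_relator by (simp, meson pres_eq.sym pres_eq.trans)
    moreover have "fills A R ?X 1 (inv_word (v @ q) @ ?r @ (v @ q))"
      using fills_conjugate[OF R apply_relator(5), of "v @ q" ?X] pq apply_relator l by simp
    ultimately show ?thesis using fills_append[OF fills] fills_free_eq by fastforce
  qed
next
  case (free_reduction x p q)
  then have "free_eq A w w'" using words pres_eq.cancel[of p A q x] by auto
  then show ?thesis using fills_mono[OF fills_free_eq[OF fills]] by simp
next
  case (free_expansion x p q)
  then have "free_eq A w w'" using words pres_eq.sym[OF pres_eq.cancel[of p A q x]] by auto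
  then show ?thesis using fills_mono[OF fills_free_eq[OF fills]] by simp
qed

lemma fills_relpow:
  assumes "R \<subseteq> words A" and "w \<in> words A"
    and "((\<lambda>u v. rewrite_step A R u v \<and> length u \<le> F \<and> length v \<le> F) ^^ k) w []"
  shows "fills A R {x. length x \<le> F div 2} k w"
  using assms(2,3)
proof (induction k arbitrary: w)
  case 0
  then show ?case by (auto simp: fills_Nil)
next
  case (Suc k)
  from Suc.prems(2) obtain w' where "rewrite_step A R w w'" "length w \<le> F" "length w' \<le> F"
    "((\<lambda>u v. rewrite_step A R u v \<and> length u \<le> F \<and> length v \<le> F) ^^ k) w' []"
    by (elim relpowp_Suc_E2) blast
  moreover from this have "fills A R {x. length x \<le> F div 2} k w'"
    using Suc.IH rewrite_step_in_words Suc.prems(1) by blast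
  ultimately show ?case using fills_rewrite_step[OF assms(1)] Suc.prems(1) by blast
qed

text \<open>A point reachable by a finite relation is reachable in at most as many steps as the
  relation has pairs. Here these are pairs of words of length at most \<open>F\<close>, whence the
  square in the base.\<close>

lemma fills_if_rewritable:
  assumes A: "finite A" and R: "R \<subseteq> words A" and w: "w \<in> words A" and rw: "rewritable A R F w []"
  shows "\<exists>k \<le> ((2 * card A + 1) ^ 2) ^ F. fills A R {x. length x \<le> F div 2} k w"
proof -
  define W where "W = {w \<in> words A. length w \<le> F}"
  define S where "S = {(u, v) \<in> W \<times> W. rewrite_step A R u v}"
  have fin: "finite W" unfolding W_def using A by (rule finite_words_length_le)
  have "S \<subseteq> W \<times> W" by (auto simp: S_def)
  then have finS: "finite S" and cS: "card S \<le> card W * card W"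
    using fin finite_subset card_mono[of "W \<times> W" S] by (auto simp: card_cartesian_product)
  let ?r = "\<lambda>u v. rewrite_step A R u v \<and> length u \<le> F \<and> length v \<le> F"
  have "(w, []) \<in> S\<^sup>*"
  proof -
    have "?r\<^sup>*\<^sup>* w v \<Longrightarrow> (w, v) \<in> S\<^sup>* \<and> v \<in> words A" for v
    proof (induction rule: rtranclp_induct)
      case (step y z)
      then have "(y, z) \<in> S" using rewrite_step_in_words by (auto simp: S_def W_def)
      then show ?case using step rewrite_step_in_words by (auto intro: rtrancl.rtrancl_into_rtrancl)
    qed (use w in auto)
    then show ?thesis using rw by (auto simp: rewritable_def)
  qed
  then obtain k where k: "k \<le> card S" "(w, []) \<in> S ^^ k"
    using rtrancl_finite_eq_relpow[OF finS] by auto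
  have "(u, v) \<in> S ^^ k \<Longrightarrow> (?r ^^ k) u v" for u v k
    by (induction k arbitrary: v) (auto simp: S_def W_def)
  then have "fills A R {x. length x \<le> F div 2} k w" using fills_relpow[OF R w] k by blast
  moreover have "card S \<le> ((2 * card A + 1) ^ 2) ^ F"
  proof -
    have "card W * card W \<le> (2 * card A + 1) ^ F * (2 * card A + 1) ^ F"
      unfolding W_def by (intro mult_mono card_words_length_le A) auto
    also have "\<dots> = ((2 * card A + 1) ^ 2) ^ F"
      by (simp only: power2_eq_square power_mult_distrib)
    finally show ?thesis using cS by linarith
  qed
  ultimately show ?thesis using k by (meson order.trans)
qed

section \<open>Folding a ball of the Cayley tree\<close>

text \<open>\<open>N k\<close> is the relation of being connected at cost \<open>k\<close>, and
  \<open>h\<close> describes how the cost grows when two classes are merged. Each merge adds at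
  least one pair to the equivalence, which bounds the number of merges by the square of
  \<open>card V\<close>. It is applied with \<open>h k = 3 * k + 1\<close> for the number of
  conjugates and with \<open>Suc\<close> for the length of words.\<close>

lemma merge_closure:
  fixes V :: "'b set" and N :: "nat \<Rightarrow> 'b \<Rightarrow> 'b \<Rightarrow> bool"
  assumes fin: "finite V" and Phi: "\<And>Q. \<Phi> Q \<subseteq> V \<times> V"
    and refl: "\<And>u. u \<in> V \<Longrightarrow> N k0 u u"
    and sym: "\<And>k u v. N k u v \<Longrightarrow> N k v u"
    and mono: "\<And>k u v. N k u v \<Longrightarrow> N (h k) u v"
    and step: "\<And>k Q p q u v. Q \<subseteq> V \<times> V \<Longrightarrow> \<forall>(u, v) \<in> Q. N k u v \<Longrightarrow> (p, q) \<in> \<Phi> Q \<Longrightarrow>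
      (u, p) \<in> Q \<Longrightarrow> (q, v) \<in> Q \<Longrightarrow> N (h k) u v"
  shows "\<exists>Q m. m \<le> (card V)\<^sup>2 \<and> Q \<subseteq> V \<times> V \<and> equiv V Q \<and> \<Phi> Q \<subseteq> Q \<and> (\<forall>(u, v) \<in> Q. N ((h ^^ m) k0) u v)"
proof -
  have *: "\<exists>Q' m. m \<le> card (V \<times> V - Q) \<and> Q' \<subseteq> V \<times> V \<and> equiv V Q' \<and> \<Phi> Q' \<subseteq> Q' \<and>
      (\<forall>(u, v) \<in> Q'. N ((h ^^ m) k) u v)"
    if "equiv V Q" "Q \<subseteq> V \<times> V" "\<forall>(u, v) \<in> Q. N k u v" for Q k
    using that
  proof (induction "card (V \<times> V - Q)" arbitrary: Q k rule: less_induct)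
    case less
    show ?case
    proof (cases "\<Phi> Q \<subseteq> Q")
      case True
      then show ?thesis using less.prems by (intro exI[of _ Q] exI[of _ 0]) auto
    next
      case False
      then obtain p q where pq: "(p, q) \<in> \<Phi> Q" "(p, q) \<notin> Q" by auto
      then have V: "p \<in> V" "q \<in> V" using Phi by auto
      \<comment> \<open>The least equivalence that contains \<open>Q\<close> and
        \<open>(p, q)\<close>: new pairs pass from the class of \<open>p\<close> to that of
        \<open>q\<close> through this one pair, or back.\<close>
      define Q' where "Q' = Q \<union> {(u, v). (u, p) \<in> Q \<and> (q, v) \<in> Q} \<union> {(u, v). (u, q) \<in> Q \<and> (p, v) \<in> Q}"
      have symQ: "sym Q" and trQ: "trans Q" and refQ: "refl_on V Q"
        using less.prems(1) by (auto simp: equiv_def)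
      have sy: "\<And>x y. (x, y) \<in> Q \<Longrightarrow> (y, x) \<in> Q" using symQ by (auto dest: symD)
      have tr: "\<And>x y z. (x, y) \<in> Q \<Longrightarrow> (y, z) \<in> Q \<Longrightarrow> (x, z) \<in> Q" using trQ by (auto dest: transD)
      have re: "\<And>x. x \<in> V \<Longrightarrow> (x, x) \<in> Q" using refQ by (auto dest: refl_onD)
      have Q'V: "Q' \<subseteq> V \<times> V" using less.prems(2) by (auto simp: Q'_def)
      have "equiv V Q'"
      proof (rule equivI)
        show "Q' \<subseteq> V \<times> V" by (rule Q'V)
        show "refl_on V Q'" unfolding refl_on_def Q'_def using re by auto
        show "sym Q'" unfolding sym_def Q'_def using sy by blast
        show "trans Q'"
        proof (rule transI)
          fix x y z assume "(x, y) \<in> Q'" "(y, z) \<in> Q'"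
          then show "(x, z) \<in> Q'" unfolding Q'_def
            by (elim UnE; simp; meson tr sy)
        qed
      qed
      moreover have "\<forall>(u, v) \<in> Q'. N (h k) u v"
        using less.prems(3) step[OF less.prems(2,3) pq(1)] mono sy sym by (fastforce simp: Q'_def)
      moreover have lt: "card (V \<times> V - Q') < card (V \<times> V - Q)"
      proof (rule psubset_card_mono)
        show "finite (V \<times> V - Q)" using fin by auto
        have "(p, q) \<in> Q'" using re V by (auto simp: Q'_def)
        then show "V \<times> V - Q' \<subset> V \<times> V - Q" using V pq by (auto simp: Q'_def)
      qed
      ultimately obtain Q'' m where "m \<le> card (V \<times> V - Q')" "Q'' \<subseteq> V \<times> V" "equiv V Q''" "\<Phi> Q'' \<subseteq> Q''"
        "\<forall>(u, v) \<in> Q''. N ((h ^^ m) (h k)) u v"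
        using less.hyps[of Q' "h k"] Q'V by blast
      then show ?thesis using lt
        by (intro exI[of _ Q''] exI[of _ "Suc m"]) (auto simp: funpow_swap1)
    qed
  qed
  have "equiv V (Id_on V)" "Id_on V \<subseteq> V \<times> V" "\<forall>(u, v) \<in> Id_on V. N k0 u v"
    using refl by (auto intro!: equivI simp: refl_on_def sym_def trans_def)
  from *[OF this] obtain Q m where
    "m \<le> card (V \<times> V - Id_on V)" "Q \<subseteq> V \<times> V" "equiv V Q" "\<Phi> Q \<subseteq> Q" "\<forall>(u, v) \<in> Q. N ((h ^^ m) k0) u v"
    by blast
  moreover have "card (V \<times> V - Id_on V) \<le> (card V)\<^sup>2"
    using card_mono[of "V \<times> V" "V \<times> V - Id_on V"] fin
    by (auto simp: card_cartesian_product power2_eq_square)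
  ultimately show ?thesis by (meson order.trans)
qed

text \<open>Reduced words serve as the vertices of the Cayley tree around the root
  \<open>[]\<close>. Edges stay implicit: the letter \<open>a\<close> leads from \<open>p\<close> to
  \<open>nf (p @ [a])\<close>.\<close>

definition tree_ball :: "'a set \<Rightarrow> nat \<Rightarrow> 'a word set" where
  "tree_ball A M = {w \<in> words A. nf w = w \<and> length w \<le> M}"

text \<open>A path in the quotient of the ball by \<open>Q\<close>, kept on representatives: the
  current vertex may be exchanged for an equivalent one before each letter and at the end.\<close>

fun reads :: "'a word set \<Rightarrow> ('a word \<times> 'a word) set \<Rightarrow> 'a word \<Rightarrow> 'a word \<Rightarrow> 'a word \<Rightarrow> bool" where
  "reads B Q u [] v = ((u, v) \<in> Q)"
| "reads B Q u (a # w) v = (\<exists>p. (u, p) \<in> Q \<and> nf (p @ [a]) \<in> B \<and> reads B Q (nf (p @ [a])) w v)"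

text \<open>The first kind of pair closes a relator at a vertex within distance \<open>d\<close> of
  the root. The second kind is a Stallings fold of two equally labelled edges at equivalent
  vertices; letters and their inverses are both allowed, so edges are folded at either end.\<close>

definition fold_pairs ::
  "'a set \<Rightarrow> 'a word set \<Rightarrow> nat \<Rightarrow> nat \<Rightarrow> ('a word \<times> 'a word) set \<Rightarrow> ('a word \<times> 'a word) set" where
  "fold_pairs A R d M Q =
    ({(g, nf (g @ r)) |g r. length g \<le> d \<and> r \<in> sym_rel R} \<union>
     {(nf (p @ [a]), nf (q @ [a])) |p q a. (p, q) \<in> Q \<and> a \<in> letters A})
    \<inter> tree_ball A M \<times> tree_ball A M"

locale folded_ball =
  fixes A :: "'a set" and R d M Q
  assumes R: "R \<subseteq> words A" and QB: "Q \<subseteq> tree_ball A M \<times> tree_ball A M"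
    and eq: "equiv (tree_ball A M) Q" and closed: "fold_pairs A R d M Q \<subseteq> Q"
begin

abbreviation "rd \<equiv> reads (tree_ball A M) Q"

lemma Q_refl: "u \<in> tree_ball A M \<Longrightarrow> (u, u) \<in> Q"
  and Q_sym: "(u, v) \<in> Q \<Longrightarrow> (v, u) \<in> Q"
  and Q_trans: "(u, v) \<in> Q \<Longrightarrow> (v, w) \<in> Q \<Longrightarrow> (u, w) \<in> Q"
  using eq by (auto simp: equiv_def refl_on_def sym_def dest: transD)

lemma reads_start: "rd u w v \<Longrightarrow> (u', u) \<in> Q \<Longrightarrow> rd u' w v"
  by (cases w) (auto intro: Q_trans)

lemma reads_end: "rd u w v \<Longrightarrow> (v, v') \<in> Q \<Longrightarrow> rd u w v'"
  by (induction w arbitrary: u) (auto intro: Q_trans)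

lemma reads_append: "rd u w v \<Longrightarrow> rd v w' t \<Longrightarrow> rd u (w @ w') t"
  by (induction w arbitrary: u) (auto intro: reads_start)

text \<open>Here the folds are used: after \<open>x\<close> and a change of representative,
  \<open>inv_letter x\<close> leads back to a vertex that a fold has made equivalent to the one
  before \<open>x\<close>.\<close>

lemma reads_cancel1:
  assumes "rd u (x # inv_letter x # w) v" "x \<in> letters A"
  shows "rd u w v"
proof -
  obtain p p' where *: "(u, p) \<in> Q" "nf (p @ [x]) \<in> tree_ball A M" "(nf (p @ [x]), p') \<in> Q"
    "nf (p' @ [inv_letter x]) \<in> tree_ball A M" "rd (nf (p' @ [inv_letter x])) w v"
    using assms(1) by auto
  have p: "p \<in> tree_ball A M" using * QB by auto
  have "nf (nf (p @ [x]) @ [inv_letter x]) = p"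
    using nf_cancel[of p x "[]"] p by (simp add: tree_ball_def)
  then have "(p, nf (p' @ [inv_letter x])) \<in> fold_pairs A R d M Q"
    unfolding fold_pairs_def using * p assms(2)
    by (intro IntI UnI2 CollectI exI[of _ "nf (p @ [x])"] exI[of _ p'] exI[of _ "inv_letter x"]) auto
  then show ?thesis using * closed reads_start Q_trans by blast
qed

lemma reads_cancel: "cancel1 w w' \<Longrightarrow> w \<in> words A \<Longrightarrow> rd u w v \<Longrightarrow> rd u w' v"
proof -
  have "rd u (p @ x # inv_letter x # q) v \<Longrightarrow> x \<in> letters A \<Longrightarrow> rd u (p @ q) v" for p x q
    by (induction p arbitrary: u) (auto dest: reads_cancel1[of _ _ q v] simp del: reads.simps(2), auto)
  then show "cancel1 w w' \<Longrightarrow> w \<in> words A \<Longrightarrow> rd u w v \<Longrightarrow> rd u w' v" by (auto simp: cancel1_def)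
qed

lemma reads_cancels: "cancel1\<^sup>*\<^sup>* w w' \<Longrightarrow> w \<in> words A \<Longrightarrow> rd u w v \<Longrightarrow> rd u w' v"
  by (induction rule: rtranclp_induct) (auto intro: reads_cancel cancels_in_words)

lemma reads_word:
  "u \<in> tree_ball A M \<Longrightarrow> w \<in> words A \<Longrightarrow> length u + length w \<le> M \<Longrightarrow> rd u w (nf (u @ w))"
proof (induction w arbitrary: u)
  case Nil
  then show ?case by (auto intro: Q_refl simp: tree_ball_def)
next
  case (Cons a w)
  have l: "length (nf (u @ [a])) \<le> length u + 1" using length_nf_le[of "u @ [a]"] by simp
  have "nf (u @ [a]) \<in> tree_ball A M" using Cons.prems l by (auto simp: tree_ball_def)
  moreover have "rd (nf (u @ [a])) w (nf (nf (u @ [a]) @ w))"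
    by (rule Cons.IH) (use calculation Cons.prems l in auto)
  ultimately show ?case using Q_refl[OF Cons.prems(1)] by auto
qed

text \<open>The vertex \<open>nf (inv_word x)\<close> lies within distance \<open>d\<close> of the
  root, so the relator was closed up there. The radius leaves room for all three segments:
  \<open>inv_word x\<close>, then \<open>r\<close> from a vertex at distance at most
  \<open>d\<close>, then \<open>x\<close> from that same vertex.\<close>

lemma reads_conjugate:
  assumes r: "r \<in> sym_rel R" and x: "x \<in> words A" "length x \<le> d" and M: "2 * d + length r \<le> M"
  shows "rd [] (inv_word x @ r @ x) []"
proof -
  let ?g = "nf (inv_word x)"
  have rA: "r \<in> words A" using r sym_rel_subset_words[OF R] by auto
  have g: "?g \<in> tree_ball A M" "length ?g \<le> d"
    using x M length_nf_le[of "inv_word x"] by (auto simp: tree_ball_def)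
  have gr: "nf (?g @ r) \<in> tree_ball A M"
    using x M length_nf_le[of "?g @ r"] g rA by (auto simp: tree_ball_def)
  have "rd [] (inv_word x) ?g" using reads_word[of "[]" "inv_word x"] x M by (simp add: tree_ball_def)
  moreover have "rd ?g r ?g"
  proof (rule reads_end)
    show "rd ?g r (nf (?g @ r))" by (rule reads_word) (use g rA M in auto)
    have "(?g, nf (?g @ r)) \<in> fold_pairs A R d M Q"
      unfolding fold_pairs_def using g gr r by blast
    then show "(nf (?g @ r), ?g) \<in> Q" using closed Q_sym by blast
  qed
  moreover have "rd ?g x []"
    using reads_word[of ?g x] g x M free_eq_imp_nf_eq[OF free_eq_inverse_left[OF x(1)]] by auto
  ultimately show ?thesis by (meson reads_append)
qed

lemma reads_conj_prod:
  assumes "set ps \<subseteq> sym_rel R \<times> {x \<in> words A. length x \<le> d}" "\<And>r. r \<in> sym_rel R \<Longrightarrow> 2 * d + length r \<le> M"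
  shows "rd [] (conj_prod ps) []"
  using assms(1)
proof (induction ps)
  case Nil
  then show ?case by (auto intro: Q_refl simp: tree_ball_def)
next
  case (Cons a ps)
  obtain r x where a: "a = (r, x)" by (cases a)
  have "rd [] (inv_word x @ r @ x) []" by (rule reads_conjugate) (use Cons.prems assms(2) a in auto)
  from reads_append[OF this Cons.IH] show ?case using Cons.prems by (simp add: a)
qed

end

lemma fold_pairs_step:
  assumes "Q \<subseteq> tree_ball A M \<times> tree_ball A M" "(p, q) \<in> fold_pairs A R d M Q"
  obtains r where "r \<in> sym_rel R" "q = nf (p @ r)" "length p \<le> d" "p \<in> words A" "length p \<le> M" "length q \<le> M"
  | p' q' a where "(p', q') \<in> Q" "a \<in> letters A" "p = nf (p' @ [a])" "q = nf (q' @ [a])"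
      "p' \<in> words A" "q' \<in> words A" "length p' \<le> M" "length q' \<le> M"
  using assms unfolding fold_pairs_def tree_ball_def by blast

lemma finite_tree_ball: "finite A \<Longrightarrow> finite (tree_ball A M)"
  unfolding tree_ball_def by (rule finite_subset[OF _ finite_words_length_le[of A M]]) auto

lemma card_tree_ball:
  assumes "finite A" shows "card (tree_ball A M) \<le> (2 * card A + 1) ^ M"
proof -
  have "card (tree_ball A M) \<le> card {w \<in> words A. length w \<le> M}"
    unfolding tree_ball_def by (rule card_mono[OF finite_words_length_le[OF assms]]) auto
  then show ?thesis using card_words_length_le[OF assms] order.trans by blast
qed

text \<open>The product of conjugates is a loop at the root of the folded ball, and cancellation
  keeps this down to the normal form. The word \<open>w\<close> itself may fail to be readable,
  since its cancelling pairs can leave the ball.\<close>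

lemma nf_in_reads:
  assumes "folded_ball A R d M Q" and "\<And>r. r \<in> sym_rel R \<Longrightarrow> 2 * d + length r \<le> M"
    and "fills A R {x. length x \<le> d} k w"
  shows "reads (tree_ball A M) Q [] (nf w) []"
proof -
  interpret folded_ball A R d M Q by fact
  obtain ps where ps: "set ps \<subseteq> sym_rel R \<times> (words A \<inter> {x. length x \<le> d})" "free_eq A w (conj_prod ps)"
    using assms(3) by (auto simp: fills_def)
  have "rd [] (conj_prod ps) []" by (rule reads_conj_prod) (use ps assms(2) in auto)
  moreover have "cancel1\<^sup>*\<^sup>* (conj_prod ps) (nf w)"
    using cancels_nf[of "conj_prod ps"] free_eq_imp_nf_eq[OF ps(2)] by simp
  ultimately show ?thesis using reads_cancels free_eq_in_words[OF ps(2)] by blast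
qed

text \<open>Merging two classes of vertices triples the number of conjugates needed to pass between
  equivalent vertices.\<close>

lemma fills_double_exponential:
  assumes A: "finite A" and R: "R \<subseteq> words A" and M: "\<And>r. r \<in> sym_rel R \<Longrightarrow> 2 * d + length r \<le> M"
    and w: "fills A R {x. length x \<le> d} k w"
  shows "fills A R UNIV ((length w + 1) * 4 ^ (((2 * card A + 1) ^ M)\<^sup>2)) w"
proof -
  let ?B = "tree_ball A M"
  define N where "N k u v \<longleftrightarrow> u \<in> words A \<and> v \<in> words A \<and> fills A R UNIV k (u @ inv_word v)" for k u v
  have N_trans: "N (k + l) u w" if "N k u v" "N l v w" for k l u v w
  proof -
    have "fills A R UNIV (k + l) (u @ inv_word v @ v @ inv_word w)"
      using that fills_append[of A R UNIV k _ l] by (fastforce simp: N_def)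
    moreover have "free_eq A (u @ inv_word w) (u @ inv_word v @ v @ inv_word w)"
      using free_eq_cancel_words(2)[of u A "inv_word w" v] that by (auto simp: N_def)
    ultimately show ?thesis using that fills_free_eq by (auto simp: N_def)
  qed
  have N_mono: "N k u v \<Longrightarrow> k \<le> l \<Longrightarrow> N l u v" for k l u v by (auto simp: N_def intro: fills_mono)
  have N_free: "N k u v" if "free_eq A u v" for k u v
  proof -
    note uv = free_eq_in_words[OF that]
    have "free_eq A (u @ inv_word v) (v @ inv_word v)" "free_eq A (v @ inv_word v) []"
      using free_eq_append[OF that pres_eq.refl[of "inv_word v"]] free_eq_inverse_right[OF uv(2)] uv by auto
    then show ?thesis using that free_eq_in_words[OF that] fills_free_eq[OF fills_Nil]
      by (meson N_def pres_eq.trans)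
  qed
  have N_sym: "N k v u" if "N k u v" for k u v
    using that fills_inv_word[of A R UNIV k "u @ inv_word v"] by (auto simp: N_def)
  have N_free2: "N k u' v'" if "N k u v" "free_eq A u u'" "free_eq A v v'" for k u v u' v'
    using N_trans[OF N_trans[OF N_sym[OF N_free[OF that(2), of 0]] that(1)] N_free[OF that(3), of 0]] by simp
  have N_right: "N k (u @ w) (v @ w)" if "N k u v" "w \<in> words A" for k u v w
  proof -
    have "free_eq A (u @ inv_word v) (u @ w @ inv_word w @ inv_word v)"
      using free_eq_cancel_words(1)[of u A "inv_word v" w] that by (auto simp: N_def)
    then show ?thesis using that fills_free_eq[OF _ pres_eq.sym] by (fastforce simp: N_def)
  qed
  have N_rel: "N 1 p (p @ r)" if "r \<in> sym_rel R" "p \<in> words A" for p r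
    using that fills_conjugate[OF R, of "inv_word r" "inv_word p" UNIV] sym_rel_subset_words[OF R]
    by (auto simp: N_def)
  have "\<exists>Q m. m \<le> (card ?B)\<^sup>2 \<and> Q \<subseteq> ?B \<times> ?B \<and> equiv ?B Q \<and> fold_pairs A R d M Q \<subseteq> Q \<and>
    (\<forall>(u, v) \<in> Q. N (((\<lambda>k. 3 * k + 1) ^^ m) 0) u v)"
  proof (rule merge_closure)
    fix k Q p q u v
    assume *: "Q \<subseteq> ?B \<times> ?B" "\<forall>(u, v) \<in> Q. N k u v" "(p, q) \<in> fold_pairs A R d M Q"
      "(u, p) \<in> Q" "(q, v) \<in> Q"
    \<comment> \<open>A relator pair costs a single conjugate. A fold pair costs no more than the
      two equivalent vertices it starts from, because a common last letter cancels in
      \<open>u @ inv_word v\<close>.\<close>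
    from *(1,3) have "N (k + 1) p q"
    proof (cases rule: fold_pairs_step)
      case (1 r)
      then have "r \<in> words A" using sym_rel_subset_words[OF R] by auto
      then have "N 1 p q"
        using N_free2[OF N_rel[of r p] pres_eq.refl free_eq_nf[of "p @ r"]] 1 by auto
      then show ?thesis using N_mono by auto
    next
      case (2 p' q' a)
      then have "N k p q"
        using N_free2[OF N_right[of k p' q' "[a]"] free_eq_nf free_eq_nf] *(2) by auto
      then show ?thesis using N_mono by auto
    qed
    moreover have "N k u p" "N k q v" using * by auto
    \<comment> \<open>The passage runs from \<open>u\<close> to \<open>p\<close> in an old class,
      across the new pair, and from \<open>q\<close> to \<open>v\<close> in an old class.\<close>
    ultimately have "N (k + (k + 1 + k)) u v" by (meson N_trans)
    then show "N (3 * k + 1) u v" using N_mono by auto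
  next
    show "N 0 u u" if "u \<in> ?B" for u using that by (auto simp: tree_ball_def intro!: N_free pres_eq.refl)
    show "N (3 * k + 1) u v" if "N k u v" for k u v by (rule N_mono[OF that]) simp
  qed (use finite_tree_ball[OF A] N_sym in \<open>auto simp: fold_pairs_def\<close>)
  then obtain Q m where Q: "m \<le> (card ?B)\<^sup>2" "Q \<subseteq> ?B \<times> ?B" "equiv ?B Q" "fold_pairs A R d M Q \<subseteq> Q"
    and NQ: "\<forall>(u, v) \<in> Q. N (((\<lambda>k. 3 * k + 1) ^^ m) 0) u v" by blast
  \<comment> \<open>The added \<open>1\<close> makes the induction work, since
    \<open>3 * k + 2\<close> is at most \<open>4 * (k + 1)\<close>.\<close>
  have "((\<lambda>k. 3 * k + 1) ^^ m) 0 + 1 \<le> (4 :: nat) ^ m" by (induction m) auto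
  also have "\<dots> \<le> 4 ^ (((2 * card A + 1) ^ M)\<^sup>2)"
    using Q(1) card_tree_ball[OF A, of M] by (intro power_increasing) (auto intro: order.trans power_mono)
  finally have NQ': "\<forall>(u, v) \<in> Q. N (4 ^ (((2 * card A + 1) ^ M)\<^sup>2)) u v"
    using NQ by (auto intro: N_mono)
  \<comment> \<open>Only the changes of representative cost anything, one before each letter and one
    at the end; following an edge of the tree is free.\<close>
  have cost: "N ((length t + 1) * 4 ^ (((2 * card A + 1) ^ M)\<^sup>2)) (u @ t) v" (is "N (_ * ?L) _ _")
    if "reads ?B Q u t v" "t \<in> words A" for t u v
    using that
  proof (induction t arbitrary: u)
    case Nil
    then show ?case using NQ' by auto
  next
    case (Cons a t)
    then obtain p where p: "(u, p) \<in> Q" "nf (p @ [a]) \<in> ?B" "reads ?B Q (nf (p @ [a])) t v" by auto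
    have pA: "p \<in> words A" using p Q by (auto simp: tree_ball_def)
    have "N ?L (u @ a # t) (p @ a # t)"
      using N_right[of ?L u p "a # t"] NQ' p Cons.prems by auto
    moreover have "N 0 (p @ a # t) (nf (p @ [a]) @ t)"
    proof (rule N_free)
      have "free_eq A ((p @ [a]) @ t) (nf (p @ [a]) @ t)"
        using pA Cons.prems by (intro free_eq_append free_eq_nf pres_eq.refl) auto
      then show "free_eq A (p @ a # t) (nf (p @ [a]) @ t)" by simp
    qed
    moreover have "N ((length t + 1) * ?L) (nf (p @ [a]) @ t) v"
      using Cons p by auto
    ultimately have "N (?L + (0 + (length t + 1) * ?L)) (u @ a # t) v" by (meson N_trans)
    then show ?case by simp
  qed
  have reads: "reads ?B Q [] (nf w) []"
    by (rule nf_in_reads[OF _ M w]) (use R Q in unfold_locales)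
  have wA: "w \<in> words A" using w free_eq_in_words by (auto simp: fills_def)
  have "N ((length (nf w) + 1) * ?L) (nf w) []" using cost[OF reads] wA by simp
  then have "N ((length (nf w) + 1) * ?L) w []"
    using N_free2 pres_eq.sym[OF free_eq_nf[OF wA]] pres_eq.refl[of "[]" A "{}"] by auto
  then have "N ((length w + 1) * ?L) w []"
    by (rule N_mono) (simp add: length_nf_le)
  then show ?thesis by (simp add: N_def)
qed

text \<open>With respect to the length of intermediate words the same merging is almost ultrametric: it
  costs a single additional letter.\<close>

lemma rewritable_exponential:
  assumes A: "finite A" and R: "R \<subseteq> words A" and M: "\<And>r. r \<in> sym_rel R \<Longrightarrow> 2 * d + length r \<le> M"
    and w: "fills A R {x. length x \<le> d} k w"
  shows "rewritable A R (M + ((2 * card A + 1) ^ M)\<^sup>2 + length w) w []"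
proof -
  let ?B = "tree_ball A M"
  define N where "N k u v \<longleftrightarrow> rewritable A R (M + k) u v" for k u v
  have N_mono: "N k u v \<Longrightarrow> k \<le> l \<Longrightarrow> N l u v" for k l u v by (auto simp: N_def intro: rewritable_mono)
  have "\<exists>Q m. m \<le> (card ?B)\<^sup>2 \<and> Q \<subseteq> ?B \<times> ?B \<and> equiv ?B Q \<and> fold_pairs A R d M Q \<subseteq> Q \<and>
    (\<forall>(u, v) \<in> Q. N ((Suc ^^ m) 0) u v)"
  proof (rule merge_closure)
    fix k Q p q u v
    assume *: "Q \<subseteq> ?B \<times> ?B" "\<forall>(u, v) \<in> Q. N k u v" "(p, q) \<in> fold_pairs A R d M Q"
      "(u, p) \<in> Q" "(q, v) \<in> Q"
    from *(1,3) have "N (Suc k) p q"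
    proof (cases rule: fold_pairs_step)
      case (1 r)
      then have r: "r \<in> words A" using sym_rel_subset_words[OF R] by auto
      have "length (p @ r) \<le> M" using M[OF 1(1)] 1 by simp
      moreover have "rewrite_step A R (p @ r @ []) (p @ [] @ [])"
        by (rule rewrite_step.apply_relator) (use 1 r in auto)
      ultimately have "rewritable A R (M + Suc k) (p @ r) p" by (auto intro: rewritable_step)
      moreover have "rewritable A R (M + Suc k) (p @ r) q"
        unfolding 1 using \<open>length (p @ r) \<le> M\<close> 1 r by (intro rewritable_nf) auto
      ultimately show ?thesis unfolding N_def by (meson rewritable_trans rewritable_sym)
    next
      case (2 p' q' a)
      have "rewritable A R (M + Suc k) (p' @ [a]) p" "rewritable A R (M + Suc k) (q' @ [a]) q"
        unfolding 2 using 2 by (auto intro!: rewritable_nf)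
      \<comment> \<open>The letter \<open>a\<close> stays at the right end while \<open>p'\<close>
        is rewritten to \<open>q'\<close>; this is the additional letter in the budget.\<close>
      moreover have "rewritable A R (M + k) p' q'" using 2 *(2) by (auto simp: N_def)
      from rewritable_context[OF this, of "[]" "[a]"]
      have "rewritable A R (M + Suc k) (p' @ [a]) (q' @ [a])" by simp
      ultimately show ?thesis unfolding N_def by (meson rewritable_trans rewritable_sym)
    qed
    moreover have "N (Suc k) u p" "N (Suc k) q v" using * N_mono[of k _ _ "Suc k"] by auto
    ultimately show "N (Suc k) u v" unfolding N_def by (meson rewritable_trans)
  next
    show "N (Suc k) u v" if "N k u v" for k u v by (rule N_mono[OF that]) simp
  qed (use finite_tree_ball[OF A] in \<open>auto simp: fold_pairs_def N_def
      intro: rewritable_refl rewritable_sym\<close>)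
  then obtain Q m where Q: "m \<le> (card ?B)\<^sup>2" "Q \<subseteq> ?B \<times> ?B" "equiv ?B Q" "fold_pairs A R d M Q \<subseteq> Q"
    and NQ: "\<forall>(u, v) \<in> Q. N m u v" by (auto simp: Suc_funpow)
  define L where "L = M + ((2 * card A + 1) ^ M)\<^sup>2"
  have "m \<le> ((2 * card A + 1) ^ M)\<^sup>2"
    using Q(1) card_tree_ball[OF A, of M] by (meson order.trans power_mono zero_le)
  then have NQ: "\<forall>(u, v) \<in> Q. rewritable A R L u v"
    using NQ by (auto simp: N_def L_def intro: rewritable_mono)
  \<comment> \<open>While a representative is being changed, the unread rest of the word stands
    unchanged to its right, hence the summand \<open>length t\<close>.\<close>
  have cost: "rewritable A R (L + length t) (u @ t) v"
    if "reads ?B Q u t v" "t \<in> words A" for t u v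
    using that
  proof (induction t arbitrary: u)
    case Nil
    then show ?case using NQ by auto
  next
    case (Cons a t)
    then obtain p where p: "(u, p) \<in> Q" "nf (p @ [a]) \<in> ?B" "reads ?B Q (nf (p @ [a])) t v" by auto
    have pA: "p \<in> words A" "length p \<le> M" using p Q by (auto simp: tree_ball_def)
    have "rewritable A R (L + length (a # t)) (u @ a # t) (p @ a # t)"
      using rewritable_context[of A R L u p "[]" "a # t"] NQ p by auto
    moreover have "rewritable A R (L + length (a # t)) (p @ a # t) (nf (p @ [a]) @ t)"
      using cancels_imp_rewritable[OF cancels_append[OF cancels_nf[of "p @ [a]"], of "[]" t]]
        pA Cons.prems by (auto simp: L_def)
    moreover have "rewritable A R (L + length (a # t)) (nf (p @ [a]) @ t) v"
      using Cons p by (auto intro: rewritable_mono[of A R "L + length t"])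
    ultimately show ?case by (meson rewritable_trans)
  qed
  have reads: "reads ?B Q [] (nf w) []"
    by (rule nf_in_reads[OF _ M w]) (use R Q in unfold_locales)
  have wA: "w \<in> words A" using w free_eq_in_words by (auto simp: fills_def)
  have "rewritable A R (L + length (nf w)) (nf w) []" using cost[OF reads] wA by simp
  then have "rewritable A R (L + length w) (nf w) []"
    using length_nf_le[of w] by (auto intro: rewritable_mono)
  moreover have "rewritable A R (L + length w) w (nf w)" using wA by (intro rewritable_nf) auto
  ultimately show ?thesis unfolding L_def by (meson rewritable_trans)
qed

section \<open>Planar diagrams\<close>

text \<open>An edge is a triple of its source, its label and its target. Darts are letters over edges.\<close>

type_synonym ('v, 'a) dart = "('v \<times> 'a \<times> 'v) letter"

definition ini :: "('v, 'a) dart \<Rightarrow> 'v" where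
  "ini d = (if snd d then fst (fst d) else snd (snd (fst d)))"

definition ter :: "('v, 'a) dart \<Rightarrow> 'v" where
  "ter d = ini (inv_letter d)"

definition lbl :: "('v, 'a) dart \<Rightarrow> 'a letter" where
  "lbl d = (fst (snd (fst d)), snd d)"

definition mk_dart :: "'v \<Rightarrow> 'a letter \<Rightarrow> 'v \<Rightarrow> ('v, 'a) dart" where
  "mk_dart u x v = (if snd x then ((u, fst x, v), True) else ((v, fst x, u), False))"

definition ren :: "('v \<Rightarrow> 'u) \<Rightarrow> 'v \<times> 'a \<times> 'v \<Rightarrow> 'u \<times> 'a \<times> 'u" where
  "ren f = map_prod f (map_prod id f)"

definition rend :: "('v \<Rightarrow> 'u) \<Rightarrow> ('v, 'a) dart \<Rightarrow> ('u, 'a) dart" where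
  "rend f = map_prod (ren f) id"

fun walk :: "'v \<Rightarrow> ('v, 'a) dart list \<Rightarrow> 'v \<Rightarrow> bool" where
  "walk v [] v' = (v = v')"
| "walk v (d # p) v' = (ini d = v \<and> walk (ter d) p v')"

lemma ini_ter_inv_letter [simp]: "ini (inv_letter d) = ter d" "ter (inv_letter d) = ini d"
  by (simp_all add: ter_def)

lemma lbl_inv_letter [simp]: "lbl (inv_letter d) = inv_letter (lbl d)"
  by (simp add: lbl_def inv_letter_def)

lemma mk_dart_simps [simp]:
  "ini (mk_dart u x v) = u" "ter (mk_dart u x v) = v" "lbl (mk_dart u x v) = x"
  by (cases x; auto simp: mk_dart_def ini_def ter_def lbl_def inv_letter_def)+

lemma mk_dart_eta [simp]: "mk_dart (ini d) (lbl d) (ter d) = d"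
  by (cases d) (auto simp: mk_dart_def ini_def ter_def lbl_def inv_letter_def)

lemma dart_eqI: "ini d = ini e \<Longrightarrow> ter d = ter e \<Longrightarrow> lbl d = lbl e \<Longrightarrow> d = e"
  by (metis mk_dart_eta)

lemma rend_simps [simp]:
  "ini (rend f d) = f (ini d)" "ter (rend f d) = f (ter d)" "lbl (rend f d) = lbl d"
  "rend f (inv_letter d) = inv_letter (rend f d)" "fst (rend f d) = ren f (fst d)"
  by (auto simp: rend_def ren_def ini_def ter_def lbl_def inv_letter_def)

lemma map_rend_inv_word [simp]: "map (rend f) (inv_word p) = inv_word (map (rend f) p)"
  by (induction p) auto

lemma map_lbl_inv_word [simp]: "map lbl (inv_word p) = inv_word (map lbl p)"
  by (induction p) auto

lemma dart_ends: "fst (fst d) \<in> V \<and> snd (snd (fst d)) \<in> V \<longleftrightarrow> ini d \<in> V \<and> ter d \<in> V"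
  by (auto simp: ini_def ter_def inv_letter_def)

lemma walk_append: "walk v (p @ q) v' \<longleftrightarrow> (\<exists>u. walk v p u \<and> walk u q v')"
  by (induction p arbitrary: v) auto

lemma walk_inj: "walk v p u \<Longrightarrow> walk v p u' \<Longrightarrow> u = u'"
  by (induction p arbitrary: v) auto

lemma walk_inv_word [simp]: "walk u (inv_word p) v \<longleftrightarrow> walk v p u"
  by (induction p arbitrary: u v) (auto simp: walk_append)

lemma walk_rend: "walk v p u \<Longrightarrow> walk (f v) (map (rend f) p) (f u)"
  by (induction p arbitrary: v) auto

text \<open>Every diagram is built from its boundary walk by cutting at the first dart \<open>d\<close>: either \<open>d\<close> is
  a bridge between two disjoint diagrams, or removing the edge of \<open>d\<close> opens the face on its other
  side. The parameters of the predicate are the number of edges, the number of faces, the set of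
  vertices, the set of edges, the base vertex and the boundary walk.\<close>

inductive disc :: "'a word set \<Rightarrow> nat \<Rightarrow> nat \<Rightarrow> 'v set \<Rightarrow> ('v \<times> 'a \<times> 'v) set \<Rightarrow> 'v \<Rightarrow> ('v, 'a) dart list \<Rightarrow> bool"
  for C where
  disc_Nil: "disc C 0 0 {b} {} b []"
| disc_bridge: "ini d = b \<Longrightarrow> disc C m k V E (ter d) u \<Longrightarrow> disc C m' k' V' E' b v \<Longrightarrow> V \<inter> V' = {} \<Longrightarrow>
    disc C (Suc (m + m')) (k + k') (V \<union> V') (insert (fst d) (E \<union> E')) b (d # u @ inv_letter d # v)"
| disc_face: "map lbl (d # s) \<in> C \<Longrightarrow> ini d = b \<Longrightarrow> walk b (inv_word s) (ter d) \<Longrightarrow>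
    disc C m k V E b (inv_word s @ w) \<Longrightarrow> disc C (Suc m) (Suc k) V (insert (fst d) E) b (d # w)"

lemma disc_ConsE [consumes 1, case_names bridge face]:
  assumes "disc C m k V E b (d # w)"
  obtains m1 k1 V1 E1 p m2 k2 V2 E2 q where "ini d = b" "w = p @ inv_letter d # q"
      "disc C m1 k1 V1 E1 (ter d) p" "disc C m2 k2 V2 E2 b q" "V1 \<inter> V2 = {}"
      "m = Suc (m1 + m2)" "k = k1 + k2" "V = V1 \<union> V2" "E = insert (fst d) (E1 \<union> E2)"
  | s m' k' E' where "map lbl (d # s) \<in> C" "ini d = b" "walk b (inv_word s) (ter d)"
      "disc C m' k' V E' b (inv_word s @ w)" "m = Suc m'" "k = Suc k'" "E = insert (fst d) E'"
  using assms by cases blast+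

lemma disc_eq: "disc C m k V E b w \<Longrightarrow> m = m' \<Longrightarrow> k = k' \<Longrightarrow> V = V' \<Longrightarrow> E = E' \<Longrightarrow> w = w' \<Longrightarrow>
    disc C m' k' V' E' b w'"
  by simp

lemma disc_props:
  assumes "disc C m k V E b w"
  shows disc_finite: "finite V" and disc_base: "b \<in> V" and disc_walk: "walk b w b"
    and disc_darts: "fst ` set w \<subseteq> E" and disc_ends: "e \<in> E \<Longrightarrow> fst e \<in> V \<and> snd (snd e) \<in> V"
proof -
  have "finite V \<and> b \<in> V \<and> walk b w b \<and> fst ` set w \<subseteq> E \<and> (\<forall>e \<in> E. fst e \<in> V \<and> snd (snd e) \<in> V)"
    using assms
  proof induction
    case (disc_Nil b)
    then show ?case by simp
  next
    case (disc_bridge d b m k V E u m' k' V' E' v)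
    then have "fst (fst d) \<in> V \<union> V' \<and> snd (snd (fst d)) \<in> V \<union> V'"
      by (subst dart_ends) auto
    then show ?case using disc_bridge by (auto simp: walk_append)
  next
    case (disc_face d s b m k V E w)
    have "ter d \<in> V"
    proof (cases s)
      case Nil
      then show ?thesis using disc_face by auto
    next
      case (Cons x s')
      then have "fst x \<in> E" "ter d = ter (inv_letter x)"
        using disc_face by (auto simp: walk_append)
      then show ?thesis using disc_face dart_ends[of x V] by auto
    qed
    then have "fst (fst d) \<in> V \<and> snd (snd (fst d)) \<in> V"
      using disc_face by (subst dart_ends) auto
    moreover have "walk (ter d) w b"
      using disc_face.IH walk_inj[OF disc_face.hyps(3)] by (auto simp: walk_append simp del: walk_inv_word)
    ultimately show ?case using disc_face by auto
  qed
  then show "finite V" "b \<in> V" "walk b w b" "fst ` set w \<subseteq> E" "e \<in> E \<Longrightarrow> fst e \<in> V \<and> snd (snd e) \<in> V"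
    by auto
qed

lemma disc_dart_ends:
  assumes "disc C m k V E b w" "fst d \<in> E"
  shows "ini d \<in> V" "ter d \<in> V"
  using disc_ends[OF assms] dart_ends[of d V] by auto

lemma walk_in_disc:
  assumes "disc C m k V E b w" "walk v p v'" "fst ` set p \<subseteq> E" "v \<in> V"
  shows "v' \<in> V"
  using assms(2-4) by (induction p arbitrary: v) (use disc_dart_ends[OF assms(1)] in auto)

lemma disc_walk_prefix: "disc C m k V E b (u @ v) \<Longrightarrow> walk b u c \<Longrightarrow> c \<in> V"
  using walk_in_disc disc_darts disc_base by fastforce

text \<open>A wedge at the base vertex, by induction on the first diagram: the one-vertex diagram in
  which its walk ends is replaced by the second diagram.\<close>

lemma disc_append:
  assumes "disc C m k V E b u" "disc C m' k' V' E' b v" "V \<inter> V' = {b}"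
  shows "disc C (m + m') (k + k') (V \<union> V') (E \<union> E') b (u @ v)"
  using assms
proof (induction arbitrary: rule: disc.induct)
  case (disc_Nil b)
  then show ?case using disc_base[OF disc_Nil(1)] by (auto simp: insert_absorb)
next
  case (disc_bridge d b m1 k1 V1 E1 u1 m2 k2 V2 E2 u2)
  have b: "b \<in> V2" using disc_base[OF disc_bridge(3)] .
  have V: "V2 \<inter> V' = {b}" "V1 \<inter> (V2 \<union> V') = {}" using disc_bridge(4,8) b by auto
  from disc.disc_bridge[OF disc_bridge(1,2) disc_bridge(6)[OF disc_bridge(7) V(1)] V(2)]
  show ?case by (rule disc_eq) auto
next
  case (disc_face d s b m k V E w)
  then show ?case using disc.disc_face[OF disc_face(1-3)] by simp
qed

lemma disc_rename:
  assumes "disc C m k V E b w" "inj_on f V"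
  shows "disc C m k (f ` V) (ren f ` E) (f b) (map (rend f) w)"
  using assms
proof (induction rule: disc.induct)
  case (disc_Nil b)
  then show ?case using disc.disc_Nil by simp
next
  case (disc_bridge d b m k V E u m' k' V' E' v)
  have "f ` V \<inter> f ` V' = {}" using disc_bridge by (auto simp: inj_on_def)
  then show ?case
    using disc.disc_bridge[of "rend f d" "f b" C m k "f ` V" "ren f ` E" _ m' k' "f ` V'" "ren f ` E'"] disc_bridge
    by (auto simp: image_Un inj_on_Un)
next
  case (disc_face d s b m k V E w)
  have "disc C (Suc m) (Suc k) (f ` V) (insert (fst (rend f d)) (ren f ` E)) (f b) (rend f d # map (rend f) w)"
  proof (rule disc.disc_face)
    show "map lbl (rend f d # map (rend f) s) \<in> C" using disc_face(1) by (simp add: comp_def)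
    show "ini (rend f d) = f b" using disc_face(2) by simp
    show "walk (f b) (inv_word (map (rend f) s)) (ter (rend f d))"
      using walk_rend[OF disc_face(3), of f] by simp
    show "disc C m k (f ` V) (ren f ` E) (f b) (inv_word (map (rend f) s) @ map (rend f) w)"
      using disc_face(5)[OF disc_face(6)] by simp
  qed
  then show ?case by simp
qed

lemma disc_rename_id:
  assumes "disc C m k V E b w" "\<And>v. v \<in> V \<Longrightarrow> f v = v"
  shows "f ` V = V" "ren f ` E = E" "map (rend f) w = w"
proof -
  have e: "ren f e = e" if "e \<in> E" for e
    using disc_ends[OF assms(1) that] assms(2) by (cases e) (auto simp: ren_def)
  show "f ` V = V" "ren f ` E = E" using assms(2) e by auto
  have "rend f d = d" if "d \<in> set w" for d
    using that disc_darts[OF assms(1)] e[of "fst d"] by (auto simp: rend_def prod_eq_iff)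
  then show "map (rend f) w = w" by (simp add: map_idI)
qed

lemma append_Cons_eq_append_Cons:
  assumes "p @ a # q = u @ y # v"
  obtains (in_left) t where "p = u @ y # t" "v = t @ a # q"
  | (here) "p = u" "a = y" "q = v"
  | (in_right) t where "u = p @ a # t" "q = t @ y # v"
  using assms by (auto simp: append_eq_append_conv2 Cons_eq_append_conv append_eq_Cons_conv)

lemma append_eq_append_Cons:
  assumes "p @ q = u @ y # v"
  obtains (in_left) t where "p = u @ y # t" "v = t @ q"
  | (in_right) t where "u = p @ t" "q = t @ y # v"
  using assms by (auto simp: append_eq_append_conv2 Cons_eq_append_conv append_eq_Cons_conv)

section \<open>Cutting, rotating and splitting boundary walks\<close>

text \<open>Opening a face at another of its edges rotates the word read around it, and the embedded
  face is walked against the edge at which it was opened, which inverts the word. Both closure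
  conditions come from this.\<close>

locale relators =
  fixes C :: "'a word set"
  assumes C_rotate: "u @ v \<in> C \<Longrightarrow> v @ u \<in> C" and C_inv: "r \<in> C \<Longrightarrow> inv_word r \<in> C"
begin

text \<open>The same case distinction at an arbitrary dart \<open>y\<close> of the boundary walk \<open>u @ y # v\<close>.\<close>

inductive cut :: "nat \<Rightarrow> nat \<Rightarrow> 'v set \<Rightarrow> ('v \<times> 'a \<times> 'v) set \<Rightarrow> 'v \<Rightarrow>
    ('v, 'a) dart list \<Rightarrow> ('v, 'a) dart \<Rightarrow> ('v, 'a) dart list \<Rightarrow> bool" where
  cut_face: "map lbl (y # s) \<in> C \<Longrightarrow> walk (ini y) (inv_word s) (ter y) \<Longrightarrow>
    disc C m k V E b (u @ inv_word s @ v) \<Longrightarrow> cut (Suc m) (Suc k) V (insert (fst y) E) b u y v"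
| cut_right: "disc C m k V E (ter y) a \<Longrightarrow> disc C m' k' V' E' b (u @ c) \<Longrightarrow> V \<inter> V' = {} \<Longrightarrow>
    cut (Suc (m + m')) (k + k') (V \<union> V') (insert (fst y) (E \<union> E')) b u y (a @ inv_letter y # c)"
| cut_left: "disc C m k V E (ini y) c \<Longrightarrow> disc C m' k' V' E' b (a @ v) \<Longrightarrow> V \<inter> V' = {} \<Longrightarrow>
    cut (Suc (m + m')) (k + k') (V \<union> V') (insert (fst y) (E \<union> E')) b (a @ inv_letter y # c) y v"

lemma cut_eq: "cut m k V E b u y v \<Longrightarrow> m = m' \<Longrightarrow> k = k' \<Longrightarrow> V = V' \<Longrightarrow> E = E' \<Longrightarrow> u = u' \<Longrightarrow> v = v' \<Longrightarrow>
    cut m' k' V' E' b u' y v'"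
  by simp

text \<open>The first dart \<open>z\<close> of the walk is cut off, \<open>y\<close> is found by
  induction in a smaller diagram, and \<open>z\<close> is put back. Rotation of smaller diagrams
  enters in the case where the two cuts meet the same face, since a part is then needed from another
  base vertex.\<close>

lemma cut_step:
  fixes V :: "'v set"
  assumes disc: "disc C m k V E b (u @ y # v)"
    and cut_IH: "\<And>m' k' V' E' (b' :: 'v) u' y' v'. m' < m \<Longrightarrow> disc C m' k' V' E' b' (u' @ y' # v') \<Longrightarrow>
      cut m' k' V' E' b' u' y' v'"
    and rotate_IH: "\<And>m' k' V' E' (b' :: 'v) u' v' c'. m' < m \<Longrightarrow> disc C m' k' V' E' b' (u' @ v') \<Longrightarrow>
      walk b' u' c' \<Longrightarrow> disc C m' k' V' E' c' (v' @ u')"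
  shows "cut m k V E b u y v"
proof (cases u)
  case Nil
  then have "disc C m k V E b (y # v)" using disc by simp
  then show ?thesis
  proof (cases rule: disc_ConsE)
    case (bridge m1 k1 V1 E1 p m2 k2 V2 E2 q)
    then show ?thesis using Nil cut_right[of m1 k1 V1 E1 y p m2 k2 V2 E2 b "[]" q] by simp
  next
    case (face s m' k' E')
    then show ?thesis using Nil cut_face[of y s m' k' V E' b "[]" v] by simp
  qed
next
  case (Cons z u')
  then have "disc C m k V E b (z # u' @ y # v)" using disc by simp
  then show ?thesis
  proof (cases rule: disc_ConsE)
    case (bridge m1 k1 V1 E1 p m2 k2 V2 E2 q)
    from bridge(2)[symmetric] show ?thesis
    proof (cases rule: append_Cons_eq_append_Cons)
      case (in_left t)
      have "cut m1 k1 V1 E1 (ter z) u' y t" using cut_IH[of m1] bridge in_left by auto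
      then show ?thesis
      proof cases
        case (cut_face s n l F)
        have "disc C (Suc (n + m2)) (l + k2) V (insert (fst z) (F \<union> E2)) b (z # (u' @ inv_word s @ t) @ inv_letter z # q)"
          unfolding bridge by (rule disc_bridge) (use cut_face bridge in auto)
        then have "disc C (Suc (n + m2)) (l + k2) V (insert (fst z) (F \<union> E2)) b (u @ inv_word s @ v)"
          by (simp add: Cons in_left)
        from cut.cut_face[OF cut_face(4,5) this] show ?thesis
          by (rule cut_eq) (use cut_face bridge in auto)
      next
        case (cut_right n l W F a n' l' W' F' c)
        have "disc C (Suc (n' + m2)) (l' + k2) (W' \<union> V2) (insert (fst z) (F' \<union> E2)) b (z # (u' @ c) @ inv_letter z # q)"
          by (rule disc_bridge) (use cut_right bridge in auto)
        then have "disc C (Suc (n' + m2)) (l' + k2) (W' \<union> V2) (insert (fst z) (F' \<union> E2)) b (u @ c @ inv_letter z # q)"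
          by (simp add: Cons)
        from cut.cut_right[OF cut_right(6) this] show ?thesis
          by (rule cut_eq) (use cut_right bridge in \<open>auto simp: in_left\<close>)
      next
        case (cut_left n l W F c n' l' W' F' a)
        have "disc C (Suc (n' + m2)) (l' + k2) (W' \<union> V2) (insert (fst z) (F' \<union> E2)) b (z # (a @ t) @ inv_letter z # q)"
          by (rule disc_bridge) (use cut_left bridge in auto)
        then have "disc C (Suc (n' + m2)) (l' + k2) (W' \<union> V2) (insert (fst z) (F' \<union> E2)) b ((z # a) @ v)"
          by (simp add: in_left)
        from cut.cut_left[OF cut_left(6) this] show ?thesis
          by (rule cut_eq) (use cut_left bridge in \<open>auto simp: Cons\<close>)
      qed
    next
      case here
      then have "ini y = ter z" "fst y = fst z" "inv_letter y = z" by auto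
      then show ?thesis
        using cut.cut_left[of m1 k1 V1 E1 y p m2 k2 V2 E2 b "[]" q] bridge here Cons by auto
    next
      case (in_right t)
      have "cut m2 k2 V2 E2 b t y v" using cut_IH[of m2] bridge in_right by auto
      then show ?thesis
      proof cases
        case (cut_face s n l F)
        have "disc C (Suc (m1 + n)) (k1 + l) V (insert (fst z) (E1 \<union> F)) b (z # p @ inv_letter z # (t @ inv_word s @ v))"
          unfolding bridge by (rule disc_bridge) (use cut_face bridge in auto)
        then have "disc C (Suc (m1 + n)) (k1 + l) V (insert (fst z) (E1 \<union> F)) b (u @ inv_word s @ v)"
          by (simp add: Cons in_right)
        from cut.cut_face[OF cut_face(4,5) this] show ?thesis
          by (rule cut_eq) (use cut_face bridge in auto)
      next
        case (cut_right n l W F a n' l' W' F' c)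
        have "disc C (Suc (m1 + n')) (k1 + l') (V1 \<union> W') (insert (fst z) (E1 \<union> F')) b (z # p @ inv_letter z # (t @ c))"
          by (rule disc_bridge) (use cut_right bridge in auto)
        then have "disc C (Suc (m1 + n')) (k1 + l') (V1 \<union> W') (insert (fst z) (E1 \<union> F')) b (u @ c)"
          by (simp add: Cons in_right)
        from cut.cut_right[OF cut_right(6) this] show ?thesis
          by (rule cut_eq) (use cut_right bridge in auto)
      next
        case (cut_left n l W F c n' l' W' F' a)
        have "disc C (Suc (m1 + n')) (k1 + l') (V1 \<union> W') (insert (fst z) (E1 \<union> F')) b (z # p @ inv_letter z # (a @ v))"
          by (rule disc_bridge) (use cut_left bridge in auto)
        then have "disc C (Suc (m1 + n')) (k1 + l') (V1 \<union> W') (insert (fst z) (E1 \<union> F')) b ((z # p @ inv_letter z # a) @ v)"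
          by simp
        from cut.cut_left[OF cut_left(6) this] show ?thesis
          by (rule cut_eq) (use cut_left bridge in \<open>auto simp: Cons in_right\<close>)
      qed
    qed
  next
    case (face s m' k' E')
    have "cut m' k' V E' b (inv_word s @ u') y v" using cut_IH[of m'] face by auto
    then show ?thesis
    proof cases
      case (cut_face t n l F)
      have "disc C (Suc n) (Suc l) V (insert (fst z) F) b (z # (u' @ inv_word t @ v))"
        by (rule disc_face) (use cut_face face in auto)
      then have "disc C (Suc n) (Suc l) V (insert (fst z) F) b (u @ inv_word t @ v)" by (simp add: Cons)
      from cut.cut_face[OF cut_face(4,5) this] show ?thesis
        by (rule cut_eq) (use cut_face face in auto)
    next
      case (cut_right n l W F a n' l' W' F' c)
      have "disc C (Suc n') (Suc l') W' (insert (fst z) F') b (z # (u' @ c))"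
        by (rule disc_face) (use cut_right face in auto)
      then have "disc C (Suc n') (Suc l') W' (insert (fst z) F') b (u @ c)" by (simp add: Cons)
      from cut.cut_right[OF cut_right(6) this] show ?thesis
        by (rule cut_eq) (use cut_right face in auto)
    next
      case (cut_left n l W F c n' l' W' F' a)
      from cut_left(5) show ?thesis
      proof (cases rule: append_eq_append_Cons)
        case (in_right t)
        have "disc C (Suc n') (Suc l') W' (insert (fst z) F') b (z # (t @ v))"
          by (rule disc_face) (use cut_left face in_right in auto)
        then have "disc C (Suc n') (Suc l') W' (insert (fst z) F') b ((z # t) @ v)" by simp
        from cut.cut_left[OF cut_left(6) this] show ?thesis
          by (rule cut_eq) (use cut_left face in \<open>auto simp: Cons in_right\<close>)
      next
        case (in_left c')
        text \<open>The dart \<open>y\<close> is a bridge once the face at \<open>z\<close> has been opened, so both belong to this face,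
          and \<open>z\<close> is a bridge once the face has been opened at \<open>y\<close>.\<close>
        have s: "s = inv_word c' @ y # inv_word a" using arg_cong[OF in_left(1), of inv_word] by simp
        let ?t = "inv_word a @ z # inv_word c'"
        have w: "walk b (a @ inv_letter y # c') (ter z)" using face in_left by simp
        then have wa: "walk b a (ter y)" "walk (ini y) c' (ter z)" by (auto simp: walk_append)
        have "map lbl (y # ?t) \<in> C"
          using C_rotate[of "map lbl (z # inv_word c')" "map lbl (y # inv_word a)"] face(1) by (simp add: s)
        moreover have "walk (ini y) (inv_word ?t) (ter y)" using wa face(2) by (auto simp: walk_append)
        moreover have "disc C n l W F (ter z) (u' @ c')"
          by (rule rotate_IH[of n]) (use cut_left face in_left wa in auto)
        then have "disc C (Suc (n + n')) (l + l') (W \<union> W') (insert (fst z) (F \<union> F')) b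
            (z # (u' @ c') @ inv_letter z # (a @ v))"
          by (rule disc_bridge[OF face(2)]) (use cut_left in auto)
        then have "disc C (Suc (n + n')) (l + l') (W \<union> W') (insert (fst z) (F \<union> F')) b (u @ inv_word ?t @ v)"
          by (simp add: Cons)
        ultimately have "cut (Suc (Suc (n + n'))) (Suc (l + l')) (W \<union> W') (insert (fst y) (insert (fst z) (F \<union> F'))) b u y v"
          by (rule cut.cut_face)
        then show ?thesis by (rule cut_eq) (use cut_left face in auto)
      qed
    qed
  qed
qed

text \<open>Moving the last dart to the front suffices, as iteration gives all rotations. Cutting at
  \<open>y\<close> expresses the diagram by smaller ones, from which it is rebuilt with
  \<open>y\<close> as its first dart.\<close>

lemma rotate_step:
  fixes V :: "'v set"
  assumes disc: "disc C m k V E b (u @ [y])"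
    and cut: "\<And>V E (b :: 'v) u y v. disc C m k V E b (u @ y # v) \<Longrightarrow> cut m k V E b u y v"
    and rotate_IH: "\<And>m' k' V' E' (b' :: 'v) u' v' c'. m' < m \<Longrightarrow> disc C m' k' V' E' b' (u' @ v') \<Longrightarrow>
      walk b' u' c' \<Longrightarrow> disc C m' k' V' E' c' (v' @ u')"
  shows "disc C m k V E (ini y) (y # u)"
proof -
  have w: "walk b u (ini y)" using disc_walk[OF disc] by (auto simp: walk_append)
  from cut[OF disc] show ?thesis
  proof cases
    case (cut_face s n l F)
    have "disc C n l V F (ini y) (inv_word s @ u)"
      by (rule rotate_IH[of n]) (use cut_face w in auto)
    from disc_face[OF cut_face(4) HOL.refl cut_face(5) this] show ?thesis using cut_face by simp
  next
    case (cut_right n l W F a n' l' W' F' c)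
    then show ?thesis by simp
  next
    case (cut_left n l W F c n' l' W' F' a)
    have "walk b a b" using disc_walk[OF cut_left(7)] by simp
    then have "ter y = b" using w cut_left by (auto simp: walk_append dest: walk_inj)
    then have "disc C (Suc (n' + n)) (l' + l) (W' \<union> W) (insert (fst y) (F' \<union> F)) (ini y) (y # a @ inv_letter y # c)"
      by (intro disc_bridge) (use cut_left in auto)
    then show ?thesis by (rule disc_eq) (use cut_left in auto)
  qed
qed

text \<open>Proved jointly by induction on the number of edges: cutting needs rotation of smaller
  diagrams, and rotation needs cutting for the same number of edges.\<close>

lemma cut_and_rotate:
  fixes V :: "'v set"
  shows "(disc C m k V E b (u @ y # v) \<longrightarrow> cut m k V E b u y v) \<and>
    (disc C m k V E b (p @ q) \<longrightarrow> walk b p c \<longrightarrow> disc C m k V E c (q @ p))"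
proof (induction m arbitrary: k V E b u y v p q c rule: less_induct)
  case (less m)
  have cut_IH: "cut m' k' V' E' b' u' y' v'"
    if "m' < m" "disc C m' k' V' E' b' (u' @ y' # v')" for m' k' V' E' and b' :: 'v and u' y' v'
    using less that by blast
  have rotate_IH: "disc C m' k' V' E' c' (v' @ u')"
    if "m' < m" "disc C m' k' V' E' b' (u' @ v')" "walk b' u' c'"
    for m' k' V' E' and b' :: 'v and u' v' c'
    using less that by blast
  have cut: "cut m k V E b u y v" if "disc C m k V E b (u @ y # v)" for k V E and b :: 'v and u y v
    using cut_step[OF that cut_IH rotate_IH] .
  have "disc C m k V E c (q @ p)" if "disc C m k V E b (p @ q)" "walk b p c"
    for k V E and b c :: 'v and p q
    using that
  proof (induction q arbitrary: b p rule: rev_induct)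
    case Nil
    then show ?case using disc_walk[OF Nil(1)] walk_inj by fastforce
  next
    case (snoc y q)
    have "disc C m k V E b ((p @ q) @ [y])" using snoc by simp
    from rotate_step[OF this cut rotate_IH] have disc: "disc C m k V E (ini y) ((y # p) @ q)"
      unfolding append_Cons .
    have "ter y = b" using disc_walk[OF snoc(2)] by (auto simp: walk_append)
    then have "disc C m k V E c (q @ y # p)" using snoc.IH[OF disc] snoc.prems by simp
    then show ?case by simp
  qed
  then show ?case using cut by blast
qed

lemma disc_cut: "disc C m k V E b (u @ y # v) \<Longrightarrow> cut m k V E b u y v"
  by (rule cut_and_rotate[THEN conjunct1, THEN mp])

lemma disc_rotate: "disc C m k V E b (p @ q) \<Longrightarrow> walk b p c \<Longrightarrow> disc C m k V E c (q @ p)"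
  by (rule cut_and_rotate[THEN conjunct2, THEN mp, THEN mp])

text \<open>The converse of \<open>disc_append\<close>: a return of the boundary walk to the base
  exhibits a wedge. If the first dart is a bridge, the return cannot happen on its far side, whose
  vertices are disjoint from the part containing \<open>b\<close>.\<close>

lemma disc_split:
  assumes "disc C m k V E b (u @ v)" "walk b u b"
  shows "\<exists>m1 k1 V1 E1 m2 k2 V2 E2. disc C m1 k1 V1 E1 b u \<and> disc C m2 k2 V2 E2 b v \<and> V1 \<inter> V2 = {b} \<and>
    V = V1 \<union> V2 \<and> E = E1 \<union> E2 \<and> k = k1 + k2"
  using assms
proof (induction m arbitrary: k V E u v rule: less_induct)
  case (less m)
  show ?case
  proof (cases u)
    case Nil
    then have "disc C 0 0 {b} {} b u" "b \<in> V" using disc_Nil disc_base[OF less(2)] by auto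
    moreover have "disc C m k V E b v" using less(2) Nil by simp
    moreover have "V = {b} \<union> V" "E = {} \<union> E" "k = 0 + k" "{b} \<inter> V = {b}"
      using \<open>b \<in> V\<close> by auto
    ultimately show ?thesis by metis
  next
    case (Cons z u')
    then have "disc C m k V E b (z # u' @ v)" using less by simp
    then show ?thesis
    proof (cases rule: disc_ConsE)
      case (bridge m1 k1 V1 E1 p m2 k2 V2 E2 q)
      have wp: "walk (ter z) p (ter z)" using disc_walk[OF bridge(3)] .
      from bridge(2) consider (left) t where "p = u' @ t" "v = t @ inv_letter z # q"
        | (right) t where "u' = p @ inv_letter z # t" "q = t @ v"
        by (auto simp: append_eq_append_conv2 append_eq_Cons_conv Cons_eq_append_conv)
      then show ?thesis
      proof cases
        case left
        have "walk (ter z) u' b" using less(3) Cons by simp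
        then have "b \<in> V1" using disc_walk_prefix bridge(3) left by metis
        then show ?thesis using disc_base[OF bridge(4)] bridge(5) by auto
      next
        case right
        have "walk b t b" using less(3) wp Cons right bridge(1) by (auto simp: walk_append dest: walk_inj)
        then obtain n l W F n' l' W' F' where *: "disc C n l W F b t" "disc C n' l' W' F' b v"
          "W \<inter> W' = {b}" "V2 = W \<union> W'" "E2 = F \<union> F'" "k2 = l + l'"
          using less(1)[of m2 k2 V2 E2 t v] bridge right by auto
        have "disc C (Suc (m1 + n)) (k1 + l) (V1 \<union> W) (insert (fst z) (E1 \<union> F)) b (z # p @ inv_letter z # t)"
          by (rule disc_bridge) (use bridge * in auto)
        moreover have "(V1 \<union> W) \<inter> W' = {b}" using bridge * disc_base[OF *(1)] by auto
        moreover have "V = (V1 \<union> W) \<union> W'" "E = insert (fst z) (E1 \<union> F) \<union> F'" "k = (k1 + l) + l'"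
          "u = z # p @ inv_letter z # t"
          using * Cons right bridge by auto
        ultimately show ?thesis using *(2) by blast
      qed
    next
      case (face s m' k' E')
      have "walk b (inv_word s @ u') b" using less(3) Cons face by (auto simp: walk_append)
      then obtain n l W F n' l' W' F' where *: "disc C n l W F b (inv_word s @ u')" "disc C n' l' W' F' b v"
          "W \<inter> W' = {b}" "V = W \<union> W'" "E' = F \<union> F'" "k' = l + l'"
        using less(1)[of m' k' V E' "inv_word s @ u'" v] face by auto
      have "disc C (Suc n) (Suc l) W (insert (fst z) F) b u" unfolding Cons
        by (rule disc_face) (use face * in auto)
      moreover have "E = insert (fst z) F \<union> F'" "k = Suc l + l'" using * face by auto
      ultimately show ?thesis using *(2-4) by blast
    qed
  qed
qed

end

section \<open>Gluing and cancelling along the boundary walk\<close>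

context relators
begin

text \<open>Gluing a face along its whole boundary \<open>inv_word u\<close> identifies the ends \<open>b\<close> and \<open>b'\<close> of \<open>u\<close>.\<close>

lemma disc_pinch:
  assumes "disc C m k V E b (u @ v)" "walk b u b'" "b \<noteq> b'" "map lbl (inv_word u) \<in> C"
  shows "\<exists>m'. disc C m' (Suc k) (id(b' := b) ` V) (ren (id(b' := b)) ` E) b (map (rend (id(b' := b))) v)"
  using assms
proof (induction m arbitrary: k V E v rule: less_induct)
  case (less m)
  define f where "f = id(b' := b)"
  have f: "f b' = b" "f b = b" "\<And>x. x \<noteq> b' \<Longrightarrow> f x = x" by (auto simp: f_def)
  have wv: "walk b' v b" using disc_walk[OF less(2)] less(3) by (auto simp: walk_append dest: walk_inj)
  then obtain y v' where v: "v = y # v'" using less(4) by (cases v) auto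
  have y: "ini y = b'" using wv v by simp
  have "cut m k V E b u y v'" by (rule disc_cut) (use less v in simp)
  then have "\<exists>m'. disc C m' (Suc k) (f ` V) (ren f ` E) b (map (rend f) v)"
  proof cases
    case (cut_face s n l F)
    obtain m' where "disc C m' (Suc l) (f ` V) (ren f ` F) b (map (rend f) (inv_word s @ v'))"
      using less(1)[OF _ cut_face(6) less(3-5), folded f_def] cut_face by auto
    then have "disc C (Suc m') (Suc (Suc l)) (f ` V) (insert (fst (rend f y)) (ren f ` F)) b (rend f y # map (rend f) v')"
    proof (intro disc_face[where s = "map (rend f) s"])
      show "map lbl (rend f y # map (rend f) s) \<in> C" using cut_face by (simp add: comp_def)
      show "walk b (inv_word (map (rend f) s)) (ter (rend f y))"
        using walk_rend[OF cut_face(5), of f] y f by simp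
    qed (use y f in auto)
    then show ?thesis using v cut_face by auto
  next
    case (cut_right n l W F a n' l' W' F' c)
    \<comment> \<open>The far side \<open>a\<close> of the bridge \<open>y\<close> does not contain
      \<open>b'\<close>, so the renaming leaves it unchanged and the induction acts on the
      rest.\<close>
    have b': "b' \<in> W'" using disc_walk_prefix[OF cut_right(7) less(3)] .
    obtain m' where *: "disc C m' (Suc l') (f ` W') (ren f ` F') b (map (rend f) c)"
      using less(1)[OF _ cut_right(7) less(3-5), folded f_def] cut_right by auto
    have "f x = x" if "x \<in> W" for x using that b' cut_right by (intro f(3)) auto
    note id = disc_rename_id[OF cut_right(6) this]
    have ter: "ter y \<in> W" using disc_base[OF cut_right(6)] .
    have "disc C (Suc (n + m')) (l + Suc l') (W \<union> f ` W') (insert (fst (rend f y)) (F \<union> ren f ` F')) b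
        (rend f y # a @ inv_letter (rend f y) # map (rend f) c)"
    proof (rule disc_bridge)
      have "ter y \<noteq> b'" using ter b' cut_right by auto
      then show "disc C n l W F (ter (rend f y)) a" using cut_right f by simp
      have "f ` W' \<subseteq> W'" using f disc_base[OF cut_right(7)] by (auto simp: f_def)
      then show "W \<inter> f ` W' = {}" using cut_right by auto
    qed (use * y f in auto)
    then show ?thesis using v cut_right id by (auto simp: image_Un)
  next
    case (cut_left n l W F c n' l' W' F' a)
    \<comment> \<open>Here \<open>y\<close> is a bridge whose other occurrence lies in
      \<open>u\<close>, and it separates \<open>b\<close> from \<open>b'\<close>. After the
      identification its two sides form a wedge at \<open>b\<close>, and \<open>y\<close> closes the
      glued face from outside.\<close>
    have b': "b' \<in> W" using disc_base[OF cut_left(6)] y by simp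
    have b: "b \<in> W'" using disc_base[OF cut_left(7)] .
    have W: "disc C n l (f ` W) (ren f ` F) b (map (rend f) c)"
    proof -
      have "inj_on f W" using b cut_left by (auto simp: f_def inj_on_def)
      from disc_rename[OF cut_left(6) this] show ?thesis using y f by simp
    qed
    have "f x = x" if "x \<in> W'" for x using that b' cut_left by (intro f(3)) auto
    note id = disc_rename_id[OF cut_left(7) this]
    have wa: "walk b a (ter y)" "walk b' c b'"
      using less(3) cut_left y by (auto simp: walk_append)
    have ter: "ter y \<in> W'" using disc_walk_prefix[OF cut_left(7)] wa by simp
    then have fter: "f (ter y) = ter y" using b' cut_left by (intro f(3)) auto
    let ?c = "map (rend f) c"
    have "f ` W \<inter> W' = {b}"
      using f b b' cut_left by (auto simp: f_def)
    from disc_append[OF W cut_left(7) this]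
    have "disc C (n + n') (l + l') (f ` W \<union> W') (ren f ` F \<union> F') b (inv_word (inv_word a @ inv_word ?c) @ v')"
      by simp
    then have "disc C (Suc (n + n')) (Suc (l + l')) (f ` W \<union> W') (insert (fst (rend f y)) (ren f ` F \<union> F')) b
      (rend f y # v')"
    proof (rule disc_face[rotated 3])
      have "map lbl (inv_word c) @ map lbl (y # inv_word a) \<in> C" using less(5) cut_left by simp
      then show "map lbl (rend f y # inv_word a @ inv_word ?c) \<in> C"
        using C_rotate by (fastforce simp: comp_def)
      show "walk b (inv_word (inv_word a @ inv_word ?c)) (ter (rend f y))"
        using walk_rend[OF wa(2), of f] f wa(1) fter by (auto simp: walk_append)
    qed (use y f in auto)
    moreover have "map (rend f) v' = v'"
      using id(3) by simp
    ultimately show ?thesis using v cut_left id by (auto simp: image_Un)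
  qed
  then show ?case unfolding f_def .
qed

definition near :: "('v \<times> 'a \<times> 'v) set \<Rightarrow> nat \<Rightarrow> 'v \<Rightarrow> 'v set \<Rightarrow> bool" where
  "near E D b V \<longleftrightarrow> (\<forall>v \<in> V. \<exists>p. walk b p v \<and> fst ` set p \<subseteq> E \<and> length p \<le> D)"

lemma near_rename: "near E D b V \<Longrightarrow> near (ren f ` E) D (f b) (f ` V)"
  unfolding near_def
proof (intro ballI)
  fix v assume *: "\<forall>v\<in>V. \<exists>p. walk b p v \<and> fst ` set p \<subseteq> E \<and> length p \<le> D" "v \<in> f ` V"
  then obtain u p where "v = f u" "walk b p u" "fst ` set p \<subseteq> E" "length p \<le> D" by blast
  then show "\<exists>p. walk (f b) p v \<and> fst ` set p \<subseteq> ren f ` E \<and> length p \<le> D"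
    by (intro exI[of _ "map (rend f) p"]) (auto simp: walk_rend)
qed

lemma near_mono: "near E D b V \<Longrightarrow> E \<subseteq> E' \<Longrightarrow> D \<le> D' \<Longrightarrow> near E' D' b V"
  unfolding near_def by (meson order.trans)

lemma near_Un: "near E D b V \<Longrightarrow> near E D b V' \<Longrightarrow> near E D b (V \<union> V')"
  unfolding near_def by blast

text \<open>A path that enters the part of a diagram attached at the single vertex \<open>c\<close> leaves it through
  \<open>c\<close> again.\<close>

lemma near_restrict:
  assumes near: "near (E1 \<union> E2) D b (V1 \<union> V2)" and V: "V1 \<inter> V2 = {c}" and b: "b \<in> V2"
    and E1: "\<And>e. e \<in> E1 \<Longrightarrow> fst e \<in> V1 \<and> snd (snd e) \<in> V1"
    and E2: "\<And>e. e \<in> E2 \<Longrightarrow> fst e \<in> V2 \<and> snd (snd e) \<in> V2"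
  shows "near E2 D b V2"
proof -
  have c: "x = c" if "x \<in> V1" "x \<in> V2" for x using that V by auto
  have "\<exists>q. walk (if u \<in> V2 then u else c) q v \<and> fst ` set q \<subseteq> E2 \<and> length q \<le> length p"
    if "walk u p v" "fst ` set p \<subseteq> E1 \<union> E2" "v \<in> V2" for u p v
    using that
  proof (induction p arbitrary: u)
    case Nil
    then show ?case by (intro exI[of _ "[]"]) auto
  next
    case (Cons d p)
    have "walk (ter d) p v" "fst ` set p \<subseteq> E1 \<union> E2" using Cons.prems by auto
    from Cons.IH[OF this Cons.prems(3)] obtain q where
      q: "walk (if ter d \<in> V2 then ter d else c) q v" "fst ` set q \<subseteq> E2" "length q \<le> length p"
      by blast
    show ?case
    proof (cases "fst d \<in> E2")
      case True
      then have "ini d \<in> V2" "ter d \<in> V2" using E2[of "fst d"] dart_ends[of d V2] by auto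
      then show ?thesis using q True Cons.prems by (intro exI[of _ "d # q"]) auto
    next
      case False
      then have "ini d \<in> V1" "ter d \<in> V1" using E1[of "fst d"] dart_ends[of d V1] Cons.prems by auto
      then have "(if ter d \<in> V2 then ter d else c) = c" "(if u \<in> V2 then u else c) = c"
        using c Cons.prems by auto
      then show ?thesis using q by (intro exI[of _ q]) auto
    qed
  qed
  note restrict = this
  show ?thesis
    unfolding near_def
  proof
    fix v assume v: "v \<in> V2"
    then obtain p where p: "walk b p v" "fst ` set p \<subseteq> E1 \<union> E2" "length p \<le> D"
      using near unfolding near_def by blast
    from restrict[OF p(1,2) v] b obtain q where "walk b q v" "fst ` set q \<subseteq> E2" "length q \<le> length p"
      by auto
    then show "\<exists>q. walk b q v \<and> fst ` set q \<subseteq> E2 \<and> length q \<le> D" using p(3) by (meson order.trans)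
  qed
qed

text \<open>The walk is rotated to begin with \<open>d1 # d2\<close>. If these two darts return to
  their start, they bound a part that would close to a sphere; \<open>disc_split\<close> detaches it
  and it is dropped. Otherwise the two edges are glued by identifying the start of \<open>d1\<close>
  with the end of \<open>d2\<close>.\<close>

lemma disc_cancel:
  fixes V :: "'v set"
  assumes disc: "disc C m k V E b (u @ d1 # d2 # v)" and lbl: "lbl d2 = inv_letter (lbl d1)"
  obtains m' k' E' b' w and V' :: "'v set" where "disc C m' k' V' E' b' w" "map lbl w = map lbl (u @ v)" "k' \<le> k"
    "\<And>D. near E D b V \<Longrightarrow> near E' D b' V'"
proof -
  have wk: "walk b u (ini d1)" "ini d2 = ter d1" "walk (ter d2) v b"
    using disc_walk[OF disc] by (auto simp: walk_append)
  define c where "c = ini d1"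
  have nd1: "disc C m k V E c (d1 # d2 # v @ u)"
    using disc_rotate[OF disc, of c] wk by (simp add: c_def)
  show ?thesis
  proof (cases "ter d2 = c")
    case True
    have "disc C m k V E c ([d1, d2] @ (v @ u))" "walk c [d1, d2] c" using nd1 True wk c_def by auto
    from disc_split[OF this]
    obtain m1 k1 V1 E1 m2 k2 V2 E2 where *: "disc C m1 k1 V1 E1 c [d1, d2]" "disc C m2 k2 V2 E2 c (v @ u)"
      "V1 \<inter> V2 = {c}" "V = V1 \<union> V2" "E = E1 \<union> E2" "k = k1 + k2"
      by blast
    have wv: "walk c v b" using wk True by simp
    have "b \<in> V2" using disc_walk_prefix[OF *(2) wv] .
    then have "near E D b V \<Longrightarrow> near E2 D b V2" for D
      using near_restrict[OF _ *(3), of E1 E2] disc_ends[OF *(1)] disc_ends[OF *(2)] *(4,5) by blast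
    then show ?thesis
      using that[OF disc_rotate[OF *(2) wv]] *(6) by simp
  next
    case False
    define c' where "c' = ter d2"
    define f where "f = id(c' := c)"
    have cc': "c \<noteq> c'" using False by (simp add: c'_def)
    have f: "f c' = c" "f c = c" by (auto simp: f_def)
    have d12: "rend f d1 = inv_letter (rend f d2)"
      by (rule dart_eqI) (use wk f lbl c_def c'_def in auto)
    have e12: "ren f (fst d1) = ren f (fst d2)"
      using arg_cong[OF d12, of fst] by simp
    have "\<exists>m'. disc C m' k (f ` V) (ren f ` E) c (map (rend f) (v @ u))"
      using nd1
    proof (cases rule: disc_ConsE)
      case (bridge m1 k1 V1 E1 p m2 k2 V2 E2 q)
      \<comment> \<open>The far side of the bridge \<open>d1\<close> begins with \<open>d2\<close>.
        Rotated past \<open>d2\<close> and renamed, it becomes a wedge summand at \<open>c\<close>,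
        in which \<open>d2\<close> takes over the role of \<open>inv_letter d1\<close>.\<close>
      have "p \<noteq> []" using bridge(2) cc' by (auto simp: c_def c'_def)
      then obtain p' where p: "p = d2 # p'" "v @ u = p' @ inv_letter d1 # q"
        using bridge(2) by (cases p) auto
      have wp: "walk (ter d1) [d2] c'" using wk by (simp add: c'_def)
      have nd3: "disc C m1 k1 V1 E1 c' (p' @ [d2])"
        using disc_rotate[of m1 k1 V1 E1 "ter d1" "[d2]" p' c'] bridge(3) p wp by simp
      have c': "c' \<in> V1" "c \<in> V2" using disc_base[OF nd3] disc_base[OF bridge(4)] by auto
      have "inj_on f V1" using c' bridge(5) by (auto simp: f_def inj_on_def)
      from disc_rename[OF nd3 this]
      have "disc C m1 k1 (f ` V1) (ren f ` E1) c (map (rend f) (p' @ [d2]))" using f by simp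
      note V1 = this
      have "f x = x" if "x \<in> V2" for x using c' that bridge(5) by (auto simp: f_def)
      note id = disc_rename_id[OF bridge(4) this]
      have "f ` V1 \<inter> V2 = {c}" using c' bridge(5) by (auto simp: f_def)
      from disc_append[OF V1 bridge(4) this]
      have "disc C (m1 + m2) (k1 + k2) (f ` V1 \<union> V2) (ren f ` E1 \<union> E2) c (map (rend f) (p' @ [d2]) @ q)" .
      moreover have "ren f ` E = ren f ` E1 \<union> E2"
        using bridge(9) e12 id disc_darts[OF bridge(3)] p by (auto simp: image_Un)
      moreover have "map (rend f) (v @ u) = map (rend f) (p' @ [d2]) @ q"
        using p id(3) d12 by simp
      ultimately show ?thesis using bridge id by (auto simp: image_Un)
    next
      case (face s m' k' E')
      \<comment> \<open>Up to gluing, \<open>d2\<close> is the reverse of \<open>d1\<close>, so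
        \<open>inv_word s @ [d2]\<close> runs once around the opened face and
        \<open>disc_pinch\<close> restores the face without \<open>d1\<close>.\<close>
      have 1: "walk c (inv_word s @ [d2]) c'" using face(3) wk by (auto simp: walk_append c'_def)
      have 2: "map lbl (inv_word (inv_word s @ [d2])) \<in> C" using face(1) lbl by simp
      have 3: "disc C m' k' V E' c ((inv_word s @ [d2]) @ (v @ u))" using face(4) by simp
      from disc_pinch[OF 3 1 cc' 2, folded f_def]
      obtain n where "disc C n (Suc k') (f ` V) (ren f ` E') c (map (rend f) (v @ u))" ..
      moreover have "ren f ` E = ren f ` E'"
        using face(7) e12 disc_darts[OF face(4)] by auto
      ultimately show ?thesis using face by auto
    qed
    then obtain m' where "disc C m' k (f ` V) (ren f ` E) c (map (rend f) v @ map (rend f) u)" by auto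
    moreover have "walk c (map (rend f) v) (f b)"
      using walk_rend[OF wk(3), of f] f by (simp add: c'_def)
    ultimately have "disc C m' k (f ` V) (ren f ` E) (f b) (map (rend f) (u @ v))"
      using disc_rotate by simp
    then show ?thesis
      by (rule that) (auto simp: comp_def intro: near_rename)
  qed
qed

section \<open>Diagrams of products of conjugates\<close>

definition diagram :: "nat \<Rightarrow> nat \<Rightarrow> 'a word \<Rightarrow> bool" where
  "diagram D k w \<longleftrightarrow> (\<exists>m k' V E (b :: nat) p. disc C m k' V E b p \<and> k' \<le> k \<and> map lbl p = w \<and> near E D b V)"

lemma diagramI:
  fixes b :: nat
  assumes "disc C m k' V E b p" "k' \<le> k" "map lbl p = w" "near E D b V"
  shows "diagram D k w"
  unfolding diagram_def using assms by blast

lemma diagramE: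
  assumes "diagram D k w"
  obtains m k' V E and b :: nat and p where "disc C m k' V E b p" "k' \<le> k" "map lbl p = w" "near E D b V"
  using assms unfolding diagram_def by blast

lemma diagram_mono: "diagram D k w \<Longrightarrow> D \<le> D' \<Longrightarrow> diagram D' k w"
  by (elim diagramE) (rule diagramI, assumption+, erule near_mono, auto)

lemma diagram_Nil: "diagram 0 0 []"
  unfolding diagram_def
  by (intro exI[of _ 0] exI[of _ "{0}"] exI[of _ "{}"] exI[of _ "[]"]) (auto intro: disc_Nil simp: near_def)

lemma diagram_cancel1: "cancel1 w w' \<Longrightarrow> diagram D k w \<Longrightarrow> diagram D k w'"
proof -
  assume "cancel1 w w'" "diagram D k w"
  then obtain u x v m k' V E and b :: nat and p where w: "w = u @ x # inv_letter x # v" "w' = u @ v"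
    and p: "disc C m k' V E b p" "k' \<le> k" "map lbl p = w" "near E D b V"
    unfolding cancel1_def diagram_def by blast
  obtain p1 d1 d2 p2 where q: "p = p1 @ d1 # d2 # p2" "map lbl p1 = u" "lbl d1 = x" "lbl d2 = inv_letter x"
    "map lbl p2 = v"
    using p(3) unfolding w by (auto simp: map_eq_append_conv map_eq_Cons_conv)
  have *: "disc C m k' V E b (p1 @ d1 # d2 # p2)" "lbl d2 = inv_letter (lbl d1)" using p(1) q by auto
  obtain m' k'' E' b' w'' and V' :: "nat set" where
    "disc C m' k'' V' E' b' w''" "map lbl w'' = map lbl (p1 @ p2)" "k'' \<le> k'" "near E' D b' V'"
    by (rule disc_cancel[OF *]) (use p(4) in blast)
  then show "diagram D k w'" unfolding w
    by (intro diagramI[of m' k'' V' E' b' w'']) (use q p(2) in auto)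
qed

lemma diagram_cancels: "cancel1\<^sup>*\<^sup>* w w' \<Longrightarrow> diagram D k w \<Longrightarrow> diagram D k w'"
  by (induction rule: rtranclp_induct) (auto intro: diagram_cancel1)

lemma diagram_append:
  assumes "diagram D k w" "diagram D l v"
  shows "diagram D (k + l) (w @ v)"
proof -
  obtain m k' V E and b :: nat and p where 1: "disc C m k' V E b p" "k' \<le> k" "map lbl p = w" "near E D b V"
    using assms(1) by (auto simp: diagram_def)
  obtain m' l' V' E' and b' :: nat and q where 2: "disc C m' l' V' E' b' q" "l' \<le> l" "map lbl q = v" "near E' D b' V'"
    using assms(2) by (auto simp: diagram_def)
  \<comment> \<open>Moves the second diagram off the first, beyond \<open>Max V\<close>, except that
    the two base vertices are identified.\<close>
  define f where "f x = (if x = b' then b else Suc (x + Max V))" for x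
  have V: "x \<le> Max V" if "x \<in> V" for x using disc_finite[OF 1(1)] that by simp
  have b: "b \<in> V" using disc_base[OF 1(1)] .
  have inj: "inj_on f V'" using V[OF b] by (auto simp: f_def inj_on_def)
  have fb: "f b' = b" by (simp add: f_def)
  have "V \<inter> f ` V' = {b}" using V b disc_base[OF 2(1)] by (fastforce simp: f_def)
  from disc_append[OF 1(1) disc_rename[OF 2(1) inj, unfolded fb] this]
  have "disc C (m + m') (k' + l') (V \<union> f ` V') (E \<union> ren f ` E') b (p @ map (rend f) q)" .
  moreover have "near (E \<union> ren f ` E') D b (V \<union> f ` V')"
    using near_mono[OF 1(4)] near_mono[OF near_rename[OF 2(4), of f, unfolded fb]] by (intro near_Un) auto
  moreover have "map lbl (p @ map (rend f) q) = w @ v" using 1 2 by (simp add: comp_def)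
  moreover have "k' + l' \<le> k + l" using 1 2 by simp
  ultimately show ?thesis by - (rule diagramI)
qed

lemma near_stick:
  assumes "near E D b V" "ini d = n" "ter d = b" "b \<in> V"
  shows "near (insert (fst d) E) (Suc D) n (insert n V)"
  unfolding near_def
proof
  fix v assume "v \<in> insert n V"
  then consider "v = n" | "v \<in> V" by auto
  then show "\<exists>p. walk n p v \<and> fst ` set p \<subseteq> insert (fst d) E \<and> length p \<le> Suc D"
  proof cases
    case 1
    then show ?thesis by (intro exI[of _ "[]"]) auto
  next
    case 2
    then obtain p where "walk b p v" "fst ` set p \<subseteq> E" "length p \<le> D" using assms by (auto simp: near_def)
    then show ?thesis using assms by (intro exI[of _ "d # p"]) auto
  qed
qed

lemma disc_stick:
  assumes "disc C m k V E b p" "ter d = b" "ini d \<notin> V"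
  shows "disc C (Suc m) k (insert (ini d) V) (insert (fst d) E) (ini d) (d # p @ [inv_letter d])"
  using disc_bridge[of d "ini d" C m k V E p 0 0 "{ini d}" "{}" "[]"] disc_Nil[of C "ini d"] assms by simp

lemma fresh_vertex: "disc C m k V E b p \<Longrightarrow> \<exists>n :: nat. n \<notin> V"
  by (rule ex_new_if_finite[OF infinite_UNIV_nat disc_finite])

lemma diagram_conjugate1:
  assumes "diagram D k w"
  shows "diagram (Suc D) k (x # w @ [inv_letter x])"
proof -
  obtain m k' V E and b :: nat and p where *: "disc C m k' V E b p" "k' \<le> k" "map lbl p = w" "near E D b V"
    using assms by (auto simp: diagram_def)
  obtain n where n: "n \<notin> V" using fresh_vertex[OF *(1)] by blast
  define d where "d = mk_dart n x b"
  have d: "ini d = n" "ter d = b" "lbl d = x" by (auto simp: d_def)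
  have "disc C (Suc m) k' (insert n V) (insert (fst d) E) n (d # p @ [inv_letter d])"
    using disc_stick[OF *(1), of d] d n by simp
  then show ?thesis
    by (rule diagramI) (use near_stick[OF *(4) d(1,2) disc_base[OF *(1)]] d *(2,3) in auto)
qed

lemma diagram_conjugate: "diagram D k w \<Longrightarrow> diagram (D + length x) k (inv_word x @ w @ x)"
proof (induction x arbitrary: w D)
  case (Cons a x)
  then show ?case using Cons.IH[OF diagram_conjugate1[OF Cons.prems, of "inv_letter a"]] by simp
qed simp

text \<open>A path walked out and back. Replacing one of its two sides by a single closing edge
  gives the disc bounded by one relator.\<close>

lemma disc_arc:
  "\<exists>m V E (b :: nat) p c. disc C m 0 V E b (p @ inv_word p) \<and> walk b p c \<and> map lbl p = t \<and> near E (length t) b V"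
proof (induction t)
  case Nil
  then show ?case
    by (intro exI[of _ 0] exI[of _ "{0}"] exI[of _ "{}"] exI[of _ "[]"]) (auto intro: disc_Nil simp: near_def)
next
  case (Cons x t)
  then obtain m V E and b :: nat and p c where *: "disc C m 0 V E b (p @ inv_word p)" "walk b p c" "map lbl p = t"
    "near E (length t) b V" by blast
  obtain n where n: "n \<notin> V" using fresh_vertex[OF *(1)] by blast
  define d where "d = mk_dart n x b"
  have d: "ini d = n" "ter d = b" "lbl d = x" by (auto simp: d_def)
  have "disc C (Suc m) 0 (insert n V) (insert (fst d) E) n ((d # p) @ inv_word (d # p))"
    using disc_stick[OF *(1), of d] d n by simp
  moreover have "near (insert (fst d) E) (length (x # t)) n (insert n V)"
    using near_stick[OF *(4) d(1,2) disc_base[OF *(1)]] by simp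
  moreover have "walk n (d # p) c" "map lbl (d # p) = x # t" using d * by auto
  ultimately show ?case
    by (intro exI[of _ "Suc m"] exI[of _ "insert n V"] exI[of _ "insert (fst d) E"] exI[of _ n]
      exI[of _ "d # p"] exI[of _ c] conjI)
qed

lemma diagram_relator:
  assumes "r \<in> C" "r \<noteq> []"
  shows "diagram (length r) 1 r"
proof -
  obtain x s where r: "r = x # s" using assms by (cases r) auto
  obtain m V E and b :: nat and p c where *: "disc C m 0 V E b (p @ inv_word p)" "walk b p c"
    "map lbl p = inv_word s" "near E (length (inv_word s)) b V" using disc_arc by blast
  define d where "d = mk_dart b x c"
  have d: "ini d = b" "ter d = c" "lbl d = x" by (auto simp: d_def)
  have "disc C (Suc m) (Suc 0) V (insert (fst d) E) b (d # inv_word p)"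
    by (rule disc_face[of d "inv_word p"]) (use * d assms r in auto)
  moreover have "near (insert (fst d) E) (length r) b V" by (rule near_mono[OF *(4)]) (use r in auto)
  ultimately show ?thesis using r d * by (intro diagramI) auto
qed

lemma diagram_conj_prod:
  assumes "set ps \<subseteq> S \<times> {x. length x \<le> d}" "\<And>r. r \<in> S \<Longrightarrow> r \<in> C \<and> r \<noteq> [] \<and> length r \<le> K"
  shows "diagram (d + K) (length ps) (conj_prod ps)"
  using assms(1)
proof (induction ps)
  case Nil
  then show ?case using diagram_mono[OF diagram_Nil] by simp
next
  case (Cons a ps)
  obtain r x where a: "a = (r, x)" by (cases a)
  have "diagram (length r + length x) 1 (inv_word x @ r @ x)"
    using diagram_conjugate[OF diagram_relator] assms(2) Cons.prems a by simp
  moreover have "length r + length x \<le> d + K" using assms(2) Cons.prems a by fastforce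
  ultimately have "diagram (d + K) 1 (inv_word x @ r @ x)" using diagram_mono by blast
  from diagram_append[OF this Cons.IH] show ?case using Cons.prems a by simp
qed

text \<open>Each edge has two sides, and each side lies either on the boundary walk or on a face of
  perimeter at most \<open>K\<close>.\<close>

lemma disc_double_count:
  assumes "disc C m k V E b p" "\<And>r. r \<in> C \<Longrightarrow> length r \<le> K"
  shows "2 * m \<le> length p + K * k" "length p \<le> 2 * m"
proof -
  have "2 * m \<le> length p + K * k \<and> length p \<le> 2 * m"
    using assms(1)
  proof (induction rule: disc.induct)
    case (disc_bridge d b m k V E u m' k' V' E' v)
    then show ?case by (simp add: algebra_simps)
  next
    case (disc_face d s b m k V E w)
    have "Suc (length s) \<le> K" using assms(2)[OF disc_face(1)] by simp
    then show ?case using disc_face by simp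
  qed simp
  then show "2 * m \<le> length p + K * k" "length p \<le> 2 * m" by auto
qed

end

section \<open>Diagrams over a presentation and rewriting along them\<close>

text \<open>The face condition of \<open>van_kampen\<close> leaves the starting point of a loop
  free, so faces may be labelled by all rotations of relators; this set meets the closure conditions
  of \<open>relators\<close>.\<close>

definition cyclic_relators :: "'a word set \<Rightarrow> 'a word set" where
  "cyclic_relators R = {v @ u |u v. u @ v \<in> sym_rel R}"

lemma cyclic_relatorsI: "u @ v \<in> sym_rel R \<Longrightarrow> v @ u \<in> cyclic_relators R"
  by (auto simp: cyclic_relators_def)

lemma relators_cyclic: "relators (cyclic_relators R)"
proof
  fix u v assume "u @ v \<in> cyclic_relators R"
  then obtain p q where pq: "q @ p \<in> sym_rel R" "u @ v = p @ q" by (auto simp: cyclic_relators_def)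
  then consider t where "p = u @ t" "v = t @ q" | t where "u = p @ t" "q = t @ v"
    by (auto simp: append_eq_append_conv2)
  then show "v @ u \<in> cyclic_relators R"
    using cyclic_relatorsI[of "q @ _" _ R] cyclic_relatorsI[of _ "_ @ p" R] pq by cases (metis append.assoc)+
next
  fix r assume "r \<in> cyclic_relators R"
  then obtain p q where pq: "q @ p \<in> sym_rel R" "r = p @ q" by (auto simp: cyclic_relators_def)
  then have "inv_word p @ inv_word q \<in> sym_rel R" using inv_word_in_sym_rel[of "q @ p" R] by simp
  then show "inv_word r \<in> cyclic_relators R" using pq cyclic_relatorsI by simp
qed

lemma sym_rel_subset_cyclic: "sym_rel R \<subseteq> cyclic_relators R"
  using cyclic_relatorsI[of _ "[]" R] by auto

lemma cyclic_relators_words: "R \<subseteq> words A \<Longrightarrow> cyclic_relators R \<subseteq> words A"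
  using sym_rel_subset_words[of R A] by (fastforce simp: cyclic_relators_def)

lemma length_cyclic_relators:
  "(\<And>r. r \<in> sym_rel R \<Longrightarrow> length r \<le> K) \<Longrightarrow> r \<in> cyclic_relators R \<Longrightarrow> length r \<le> K"
  by (fastforce simp: cyclic_relators_def)

text \<open>A rewriting rule must spell out an unrotated relator. For a relator
  \<open>s2 @ x # s1\<close> the pair \<open>inv_word s2 @ s2\<close> is therefore inserted in front
  of \<open>x\<close>, and the length \<open>2 * K\<close> leaves room for it.\<close>

lemma rewritable_cyclic_relator:
  assumes R: "R \<subseteq> words A" and K: "\<And>r. r \<in> sym_rel R \<Longrightarrow> length r \<le> K"
    and xs: "x # s \<in> cyclic_relators R"
  shows "rewritable A R (2 * K) [x] (inv_word s)"
proof -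
  obtain s1 s2 where s: "s = s1 @ s2" "s2 @ x # s1 \<in> sym_rel R"
  proof -
    obtain u v where uv: "u @ v \<in> sym_rel R" "x # s = v @ u" using xs by (auto simp: cyclic_relators_def)
    show ?thesis
    proof (cases v)
      case Nil
      then show ?thesis using that[of s "[]"] uv by simp
    next
      case (Cons y v')
      then show ?thesis using that[of v' u] uv by simp
    qed
  qed
  have w: "s1 \<in> words A" "s2 \<in> words A" "x \<in> letters A"
    using s sym_rel_subset_words[OF R] by auto
  have l: "length s2 + length s1 + 1 \<le> K" using K[OF s(2)] by simp
  have "cancel1\<^sup>*\<^sup>* (inv_word s2 @ s2 @ [x]) [x]"
  proof (induction s2)
    case (Cons y t)
    have "cancel1 (inv_word (y # t) @ (y # t) @ [x]) (inv_word t @ t @ [x])"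
      unfolding cancel1_def
      by (intro exI[of _ "inv_word t"] exI[of _ "inv_letter y"] exI[of _ "t @ [x]"]) simp
    then show ?case using Cons by (rule converse_rtranclp_into_rtranclp)
  qed simp
  then have "rewritable A R (2 * K) (inv_word s2 @ s2 @ [x]) [x]"
    by (rule cancels_imp_rewritable) (use w l in auto)
  moreover have "rewrite_step A R (inv_word s2 @ (s2 @ [x]) @ []) (inv_word s2 @ inv_word s1 @ [])"
    by (rule rewrite_step.apply_relator) (use s w in auto)
  then have "rewritable A R (2 * K) (inv_word s2 @ s2 @ [x]) (inv_word s)"
    by (intro rewritable_step) (use s l in auto)
  ultimately show ?thesis by (meson rewritable_sym rewritable_trans)
qed

text \<open>Apart from the room \<open>2 * K\<close> for applying one relator, the intermediate
  words are boundary labels of what remains of the diagram, and a boundary walk of \<open>m\<close>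
  edges has length at most \<open>2 * m\<close>.\<close>

lemma rewritable_diagram:
  assumes R: "R \<subseteq> words A" and K: "\<And>r. r \<in> sym_rel R \<Longrightarrow> length r \<le> K"
    and "disc (cyclic_relators R) m k V E b p" "map lbl p \<in> words A"
  shows "rewritable A R (2 * m + 2 * K) (map lbl p) []"
  using assms(3,4)
proof (induction rule: disc.induct)
  case (disc_Nil b)
  then show ?case by (simp add: rewritable_refl)
next
  case (disc_bridge d b m k V E u m' k' V' E' v)
  interpret relators "cyclic_relators R" by (rule relators_cyclic)
  note len = disc_double_count(2)[of m k V E "ter d" u K] disc_double_count(2)[of m' k' V' E' b v K]
  have l: "length u \<le> 2 * m" "length v \<le> 2 * m'"
    using len disc_bridge length_cyclic_relators[OF K] by auto
  have x: "lbl d \<in> letters A" using disc_bridge by simp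
  let ?F = "2 * Suc (m + m') + 2 * K"
  let ?x = "lbl d" and ?u = "map lbl u" and ?v = "map lbl v"
  have "rewritable A R ?F ([?x] @ ?u @ inv_letter ?x # ?v) ([?x] @ [] @ inv_letter ?x # ?v)"
    by (rule rewritable_context[of A R "2 * m + 2 * K"]) (use disc_bridge l in auto)
  moreover have "rewritable A R ?F ([] @ [?x, inv_letter ?x] @ ?v) ([] @ ?v)"
    by (intro rewritable_step rewrite_step.free_reduction) (use x l in auto)
  moreover have "rewritable A R ?F ?v []"
    by (rule rewritable_mono[of A R "2 * m' + 2 * K"]) (use disc_bridge in auto)
  ultimately show ?case by (auto intro: rewritable_trans)
next
  case (disc_face d s b m k V E w)
  interpret relators "cyclic_relators R" by (rule relators_cyclic)
  have l: "length w \<le> 2 * m"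
    using disc_double_count(2)[of m k V E b "inv_word s @ w" K] disc_face length_cyclic_relators[OF K] by auto
  have "map lbl s \<in> words A" using cyclic_relators_words[OF R] disc_face(1) by auto
  then have "rewritable A R (2 * m + 2 * K) (map lbl (inv_word s @ w)) []" using disc_face by simp
  moreover have "rewritable A R (2 * m + 2 * K) ([] @ [lbl d] @ map lbl w) ([] @ inv_word (map lbl s) @ map lbl w)"
    by (rule rewritable_context[of A R "2 * K"])
      (use rewritable_cyclic_relator[OF R K, of "lbl d" "map lbl s"] disc_face(1) l in auto)
  ultimately have "rewritable A R (2 * m + 2 * K) (map lbl (d # w)) []" by (auto intro: rewritable_trans)
  then show ?case by (rule rewritable_mono) simp
qed

lemma diagram_nf_of_fills:
  assumes R: "R \<subseteq> words A" "[] \<notin> R" and K: "\<And>r. r \<in> sym_rel R \<Longrightarrow> length r \<le> K"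
    and w: "fills A R {x. length x \<le> d} k w"
  shows "\<exists>l \<le> k. relators.diagram (cyclic_relators R) (d + K) l (nf w)"
proof -
  interpret relators "cyclic_relators R" by (rule relators_cyclic)
  obtain ps where ps: "set ps \<subseteq> sym_rel R \<times> (words A \<inter> {x. length x \<le> d})" "free_eq A w (conj_prod ps)"
    "length ps \<le> k" using w by (auto simp: fills_def)
  have "[] \<notin> sym_rel R" using R(2) inv_word_eq_Nil by (metis (no_types, lifting) Un_iff image_iff sym_rel_def)
  then have "r \<in> cyclic_relators R \<and> r \<noteq> [] \<and> length r \<le> K" if "r \<in> sym_rel R" for r
    using that K sym_rel_subset_cyclic by blast
  then have "diagram (d + K) (length ps) (conj_prod ps)"
    by (rule diagram_conj_prod[rotated]) (use ps in auto)
  moreover have "cancel1\<^sup>*\<^sup>* (conj_prod ps) (nf w)"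
    using cancels_nf[of "conj_prod ps"] free_eq_imp_nf_eq[OF ps(2)] by simp
  ultimately show ?thesis using diagram_cancels ps(3) by blast
qed

lemma fills_bounded:
  assumes "fills A R UNIV k w"
  shows "\<exists>d. fills A R {x. length x \<le> d} k w"
proof -
  obtain ps where ps: "set ps \<subseteq> sym_rel R \<times> words A" "free_eq A w (conj_prod ps)" "length ps \<le> k"
    using assms by (auto simp: fills_def)
  define d where "d = Max ((length \<circ> snd) ` set ps)"
  have "length x \<le> d" if "(r, x) \<in> set ps" for r x
    unfolding d_def using imageI[OF that, of "length \<circ> snd"] by (intro Max_ge) auto
  then show ?thesis using ps unfolding fills_def by (intro exI[of _ d] exI[of _ ps]) auto
qed

lemma rewritable_of_fills:
  assumes R: "R \<subseteq> words A" "[] \<notin> R" and K: "\<And>r. r \<in> sym_rel R \<Longrightarrow> length r \<le> K"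
    and w: "fills A R UNIV k w"
  shows "rewritable A R (length w + K * k + 2 * K) w []"
proof -
  interpret relators "cyclic_relators R" by (rule relators_cyclic)
  have wA: "w \<in> words A" using w free_eq_in_words by (auto simp: fills_def)
  obtain d l where l: "l \<le> k" "diagram (d + K) l (nf w)"
    using fills_bounded[OF w] diagram_nf_of_fills[OF R K] by blast
  then obtain m k' V E and b :: nat and p where p: "disc (cyclic_relators R) m k' V E b p" "k' \<le> k" "map lbl p = nf w"
    using l(1) by (elim diagramE) (meson order.trans)
  have "2 * m \<le> length p + K * k'"
    using disc_double_count(1)[OF p(1)] length_cyclic_relators[OF K] by auto
  moreover have "length p \<le> length w" using length_nf_le[of w] p(3) by (metis length_map)
  moreover have "K * k' \<le> K * k" using p(2) by simp
  ultimately have "2 * m + 2 * K \<le> length w + K * k + 2 * K" by linarith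
  then have "rewritable A R (length w + K * k + 2 * K) (nf w) []"
    using rewritable_mono[OF rewritable_diagram[OF R(1) K p(1)]] p(3) wA by simp
  moreover have "rewritable A R (length w + K * k + 2 * K) w (nf w)" using wA by (intro rewritable_nf) auto
  ultimately show ?thesis by (meson rewritable_trans)
qed

section \<open>Cycles of a permutation as lists\<close>

text \<open>A cycle of \<open>f\<close> written out from some starting point. Its rotations are the
  other ways to write it, and \<open>support f x\<close> is the one that begins with
  \<open>x\<close>.\<close>

definition cyc :: "('b \<Rightarrow> 'b) \<Rightarrow> 'b list \<Rightarrow> bool" where
  "cyc f xs \<longleftrightarrow> xs \<noteq> [] \<and> distinct xs \<and> map f xs = rotate1 xs"

lemma cyc_funpow:
  assumes "cyc f xs"
  shows "(f ^^ i) (hd xs) = xs ! (i mod length xs)"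
proof (induction i)
  case 0
  then show ?case using assms by (simp add: cyc_def hd_conv_nth)
next
  case (Suc i)
  have i: "i mod length xs < length xs" using assms by (simp add: cyc_def)
  then have "f (xs ! (i mod length xs)) = map f xs ! (i mod length xs)" by simp
  also have "\<dots> = xs ! (Suc i mod length xs)"
    using assms i by (simp add: cyc_def nth_rotate1 mod_Suc_eq)
  finally show ?case using Suc by simp
qed

lemma cyc_support_hd:
  assumes "cyc f xs"
  shows "support f (hd xs) = xs"
proof -
  have xs: "xs \<noteq> []" "distinct xs" using assms by (auto simp: cyc_def)
  have "least_power f (hd xs) = length xs"
    unfolding least_power_def
  proof (rule Least_equality)
    show "(f ^^ length xs) (hd xs) = hd xs \<and> 0 < length xs"
      using xs cyc_funpow[OF assms, of "length xs"] by (simp add: hd_conv_nth)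
  next
    fix n assume n: "(f ^^ n) (hd xs) = hd xs \<and> 0 < n"
    then have "xs ! (n mod length xs) = xs ! 0" using xs cyc_funpow[OF assms, of n] by (simp add: hd_conv_nth)
    then have "n mod length xs = 0" using xs by (simp add: nth_eq_iff_index_eq)
    then show "length xs \<le> n" using n by (intro dvd_imp_le) auto
  qed
  then show ?thesis by (intro nth_equalityI) (auto simp: cyc_funpow[OF assms])
qed

lemma cyc_rotate1: "cyc f xs \<Longrightarrow> cyc f (rotate1 xs)"
  unfolding cyc_def by (simp flip: rotate1_map)

lemma cyc_rotate: "cyc f xs \<Longrightarrow> cyc f (rotate k xs)"
  by (induction k) (auto intro: cyc_rotate1)

lemma cyc_swap: "cyc f (p @ q) \<Longrightarrow> cyc f (q @ p)"
  using cyc_rotate[of f "p @ q" "length p"] by (simp add: rotate_append)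

lemma cyc_hd_rotate:
  assumes "cyc f xs" "x \<in> set xs"
  obtains k where "hd (rotate k xs) = x"
proof -
  obtain k where "k < length xs" "x = xs ! k" using assms by (auto simp: in_set_conv_nth)
  then have "hd (rotate k xs) = x" using assms by (subst hd_rotate_conv_nth) (auto simp: cyc_def)
  then show ?thesis by (rule that)
qed

lemma cyc_support:
  assumes "cyc f xs" "x \<in> set xs"
  obtains k where "support f x = rotate k xs"
  using cyc_hd_rotate[OF assms] cyc_support_hd[OF cyc_rotate[OF assms(1)]] by metis

lemma cyc_orbit:
  assumes "cyc f xs" "x \<in> set xs"
  shows "orbit f x = set xs"
proof -
  have *: "orbit f (hd ys) = set ys" if "cyc f ys" for ys
  proof -
    have "\<exists>n>0. y = (f ^^ n) (hd ys)" if "y \<in> set ys" for y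
    proof -
      obtain i where "i < length ys" "y = ys ! i" using \<open>y \<in> set ys\<close> by (auto simp: in_set_conv_nth)
      then show ?thesis using \<open>cyc f ys\<close>
        by (intro exI[of _ "i + length ys"]) (auto simp: cyc_funpow)
    qed
    then show ?thesis using that by (auto simp: orbit_altdef cyc_funpow cyc_def)
  qed
  obtain k where "hd (rotate k xs) = x" using cyc_hd_rotate[OF assms] .
  then show ?thesis using *[OF cyc_rotate[OF assms(1), of k]] by simp
qed

lemma cyc_cong: "cyc f xs \<Longrightarrow> (\<And>x. x \<in> set xs \<Longrightarrow> g x = f x) \<Longrightarrow> cyc g xs"
  unfolding cyc_def by (metis map_eq_conv)

lemma cyc_last: "cyc f xs \<Longrightarrow> f (last xs) = hd xs"
proof -
  assume c: "cyc f xs"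
  then have "last (map f xs) = last (rotate1 xs)" by (simp add: cyc_def)
  then show ?thesis using c by (cases xs) (auto simp: cyc_def last_map)
qed

lemma cyc_butlast: "cyc f xs \<Longrightarrow> map f (butlast xs) = tl xs"
  unfolding cyc_def by (metis butlast_snoc map_butlast rotate1_hd_tl)

lemma cyc_Cons_iff: "cyc f (x # xs) \<longleftrightarrow> distinct (x # xs) \<and> map f (x # xs) = xs @ [x]"
  by (auto simp: cyc_def)

lemma cyc_image: "cyc f xs \<Longrightarrow> f ` set xs = set xs"
  unfolding cyc_def by (metis list.set_map set_rotate1)

lemma cyc_of_inj:
  assumes S: "finite S" "inj_on f S" "f ` S \<subseteq> S" and x: "x \<in> S"
  shows "cyc f (support f x)" "set (support f x) \<subseteq> S" "hd (support f x) = x"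
proof -
  \<comment> \<open>Extended by the identity outside \<open>S\<close>, the map becomes a permutation
    with the same powers at \<open>x\<close>, to which the library facts on
    \<open>least_power\<close> apply.\<close>
  define g where "g y = (if y \<in> S then f y else y)" for y
  have "bij_betw f S S" using S by (simp add: bij_betw_def endo_inj_surj)
  then have "bij_betw g S S" by (subst bij_betw_cong[of S g f S]) (auto simp: g_def)
  then have perm: "permutation g"
    using S(1) by (intro permutes_imp_permutation[OF _ bij_imp_permutes]) (auto simp: g_def)
  have pow: "(f ^^ n) x = (g ^^ n) x \<and> (f ^^ n) x \<in> S" for n
    by (induction n) (use x S(3) in \<open>auto simp: g_def\<close>)
  have lp: "least_power f x = least_power g x" by (simp add: least_power_def pow)
  then have sup: "support f x = support g x" by (simp add: pow)
  have n: "(f ^^ least_power f x) x = x" "least_power f x > 0"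
    using least_power_of_permutation[OF perm, of x] pow lp by auto
  show "hd (support f x) = x" using n by (simp add: hd_map upt_rec[of 0])
  show "set (support f x) \<subseteq> S" using conjunct2[OF pow] by auto
  have "distinct (support f x)" unfolding sup by (rule cycle_of_permutation[OF perm])
  moreover have "map f (support f x) = rotate1 (support f x)"
  proof (rule nth_equalityI)
    fix i assume "i < length (map f (support f x))"
    then have i: "i < least_power f x" by simp
    then consider "Suc i < least_power f x" | "Suc i = least_power f x" by linarith
    then have "(f ^^ Suc i) x = (f ^^ (Suc i mod least_power f x)) x" using n by cases auto
    then show "map f (support f x) ! i = rotate1 (support f x) ! i"
      using n i by (simp add: nth_rotate1)
  qed simp
  ultimately show "cyc f (support f x)" using n by (simp add: cyc_def)
qed

text \<open>For a fixed point \<open>y\<close> of \<open>f\<close> this is composition with a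
  transposition: \<open>y\<close> enters the cycle of \<open>z\<close> directly behind
  \<open>z\<close>.\<close>

definition ins :: "('b \<Rightarrow> 'b) \<Rightarrow> 'b \<Rightarrow> 'b \<Rightarrow> 'b \<Rightarrow> 'b" where
  "ins f z y = f(z := y, y := f z)"

lemma ins_permutes:
  assumes "f permutes S" "z \<in> S" "y \<notin> S"
  shows "ins f z y permutes insert y S"
proof -
  have "f y = y" using assms by (simp add: permutes_not_in)
  then have "ins f z y = f \<circ> transpose z y" using assms by (auto simp: ins_def fun_eq_iff transpose_def)
  moreover have "f permutes insert y S" using permutes_subset[OF assms(1)] by blast
  moreover have "transpose z y permutes insert y S" using assms by (intro permutes_swap_id) auto
  ultimately show ?thesis using permutes_compose by metis
qed

lemma cyc_ins:
  assumes "cyc f xs" "last xs = z" "y \<notin> set xs"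
  shows "cyc (ins f z y) (xs @ [y])"
proof -
  obtain ys where xs: "xs = ys @ [z]" using assms by (metis append_butlast_last_id cyc_def)
  have fz: "f z = hd xs" using cyc_last[OF assms(1)] assms(2) by simp
  have "map (ins f z y) ys = map f ys" using assms xs by (auto simp: ins_def cyc_def)
  moreover have "map f ys = tl xs"
    using assms(1) unfolding xs cyc_def by (cases ys) (auto simp: rotate1_hd_tl)
  ultimately show ?thesis using assms fz xs by (cases ys) (auto simp: cyc_def ins_def)
qed

definition vertex_cycles :: "('b \<Rightarrow> 'b) \<Rightarrow> 'b set \<Rightarrow> ('b \<Rightarrow> 'v) \<Rightarrow> bool" where
  "vertex_cycles \<sigma> S org \<longleftrightarrow> (\<forall>x \<in> S. orbit \<sigma> x = {x' \<in> S. org x' = org x})"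

lemma vertex_cycles_cong:
  "vertex_cycles \<sigma> S org \<Longrightarrow> (\<And>x. x \<in> S \<Longrightarrow> org' x = org x) \<Longrightarrow> vertex_cycles \<sigma> S org'"
  by (auto simp: vertex_cycles_def)

lemma vertex_cycles_isolated:
  assumes "vertex_cycles \<sigma> S org" "\<sigma> y = y" "\<And>x. x \<in> S \<Longrightarrow> org x \<noteq> org y"
  shows "vertex_cycles \<sigma> (insert y S) org"
proof -
  have "cyc \<sigma> [y]" using assms by (simp add: cyc_def)
  from cyc_orbit[OF this] have "orbit \<sigma> y = {y}" by simp
  then show ?thesis using assms by (fastforce simp: vertex_cycles_def)
qed

lemma permutes_cyc:
  assumes "f permutes S" "finite S" "x \<in> S"
  shows "cyc f (support f x)" "set (support f x) \<subseteq> S" "hd (support f x) = x"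
  using cyc_of_inj[OF assms(2) _ _ assms(3), of f] permutes_inj_on[OF assms(1)] permutes_image[OF assms(1)]
  by auto

lemma vertex_cycles_ins:
  assumes v: "vertex_cycles \<sigma> S org" and S: "\<sigma> permutes S" "finite S"
    and z: "z \<in> S" and y: "y \<notin> S" "org y = org z"
  shows "vertex_cycles (ins \<sigma> z y) (insert y S) org"
proof -
  \<comment> \<open>The cycle of \<open>z\<close> written with \<open>z\<close> last, so that the
    new dart can be appended.\<close>
  let ?zs = "rotate1 (support \<sigma> z)"
  note cz = permutes_cyc[OF S z]
  have zs: "cyc \<sigma> ?zs" "set ?zs \<subseteq> S" using cyc_rotate1[OF cz(1)] cz by simp_all
  have "support \<sigma> z \<noteq> []" using cz(1) by (simp add: cyc_def)
  then have last: "last ?zs = z" using cz(3) by (cases "support \<sigma> z") auto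
  then have zin: "z \<in> set ?zs" using zs by (metis cyc_def last_in_set)
  have "orbit \<sigma> z = set ?zs" by (rule cyc_orbit[OF zs(1) zin])
  then have set_zs: "set ?zs = {x \<in> S. org x = org z}" using v z by (auto simp: vertex_cycles_def)
  have cyc: "cyc (ins \<sigma> z y) (?zs @ [y])" by (rule cyc_ins[OF zs(1) last]) (use y zs in auto)
  have "orbit (ins \<sigma> z y) x = {x' \<in> insert y S. org x' = org x}" if "x \<in> insert y S" for x
  proof (cases "org x = org z")
    case True
    then have "x \<in> set (?zs @ [y])" using that set_zs by auto
    from cyc_orbit[OF cyc this] show ?thesis using set_zs True y by auto
  next
    case False
    then have x: "x \<in> S" using that y by auto
    note cx = permutes_cyc[OF S x]
    have "x \<in> set (support \<sigma> x)" using cx by (metis cyc_def hd_in_set)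
    moreover from this have set: "set (support \<sigma> x) = {x' \<in> S. org x' = org x}"
      using cyc_orbit[OF cx(1)] v x by (auto simp: vertex_cycles_def)
    then have "cyc (ins \<sigma> z y) (support \<sigma> x)"
      using False y by (intro cyc_cong[OF cx(1)]) (auto simp: ins_def)
    ultimately show ?thesis using cyc_orbit[of "ins \<sigma> z y" "support \<sigma> x" x] set False y by auto
  qed
  then show ?thesis by (simp add: vertex_cycles_def)
qed

section \<open>Plane maps\<close>

text \<open>The edge set of \<open>disc\<close> cannot tell apart parallel edges with the same
  label. Embedded edges are therefore named by natural numbers, and \<tau> sends a name to its
  triple, not necessarily injectively.\<close>

definition proj :: "('e \<Rightarrow> 'v \<times> 'a \<times> 'v) \<Rightarrow> 'e letter \<Rightarrow> ('v, 'a) dart" where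
  "proj \<tau> = map_prod \<tau> id"

lemma proj_inv_letter [simp]: "proj \<tau> (inv_letter d) = inv_letter (proj \<tau> d)"
  by (simp add: proj_def inv_letter_def)

abbreviation face_map :: "(nat letter \<Rightarrow> nat letter) \<Rightarrow> nat letter \<Rightarrow> nat letter" where
  "face_map \<sigma> \<equiv> \<sigma> \<circ> inv_letter"

definition inner :: "nat set \<Rightarrow> nat word \<Rightarrow> nat letter set" where
  "inner Ed bs = letters Ed - set bs"

text \<open>The embedding part of \<open>disc_complex\<close>, in a form that can be maintained edge
  by edge. Connectedness and the labels of faces are recorded in \<open>planar\<close>.\<close>

definition plane_map :: "nat set \<Rightarrow> nat set \<Rightarrow> (nat \<Rightarrow> nat \<times> 'a \<times> nat) \<Rightarrow> (nat letter \<Rightarrow> nat letter) \<Rightarrow>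
    nat word \<Rightarrow> bool" where
  "plane_map V Ed \<tau> \<sigma> bs \<longleftrightarrow> finite V \<and> finite Ed \<and> V \<noteq> {} \<and>
    (\<forall>d \<in> letters Ed. ini (proj \<tau> d) \<in> V) \<and> \<sigma> permutes letters Ed \<and>
    vertex_cycles \<sigma> (letters Ed) (ini \<circ> proj \<tau>) \<and>
    (if Ed = {} then bs = [] else cyc (face_map \<sigma>) bs) \<and> set bs \<subseteq> letters Ed \<and>
    card V + card (orbit (face_map \<sigma>) ` inner Ed bs) = card Ed + 1"

lemma face_map_inj:
  assumes "\<sigma> permutes letters Ed"
  shows "inj_on (face_map \<sigma>) (letters Ed)" "(face_map \<sigma>) ` letters Ed \<subseteq> letters Ed"
proof -
  show "inj_on (face_map \<sigma>) (letters Ed)"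
    by (rule inj_onI) (simp add: inj_eq[OF permutes_inj[OF assms]])
  show "(face_map \<sigma>) ` letters Ed \<subseteq> letters Ed"
    by (simp add: image_subset_iff permutes_in_image[OF assms])
qed

lemma inner_support:
  assumes pm: "plane_map V Ed \<tau> \<sigma> bs" and d: "d \<in> inner Ed bs"
  shows "cyc (face_map \<sigma>) (support (face_map \<sigma>) d)"
    "set (support (face_map \<sigma>) d) \<subseteq> inner Ed bs" "hd (support (face_map \<sigma>) d) = d"
proof -
  let ?\<phi> = "face_map \<sigma>"
  have \<sigma>: "\<sigma> permutes letters Ed" and fin: "finite Ed" using pm by (auto simp: plane_map_def)
  have img: "?\<phi> ` set bs = set bs" "set bs \<subseteq> letters Ed"
    using pm cyc_image[of ?\<phi> bs] by (auto simp: plane_map_def split: if_splits)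
  have "?\<phi> x \<in> inner Ed bs" if x: "x \<in> inner Ed bs" for x
  proof -
    have "?\<phi> x \<notin> set bs"
    proof
      assume "?\<phi> x \<in> set bs"
      then obtain y where y: "y \<in> set bs" "?\<phi> y = ?\<phi> x" using img by (metis imageE)
      moreover have "y \<in> letters Ed" "x \<in> letters Ed" using y img x by (auto simp: inner_def)
      ultimately have "y = x" using face_map_inj(1)[OF \<sigma>] by (meson inj_onD)
      then show False using y x by (simp add: inner_def)
    qed
    then show ?thesis using face_map_inj(2)[OF \<sigma>] x by (auto simp: inner_def)
  qed
  moreover have "inj_on ?\<phi> (inner Ed bs)"
    using inj_on_subset[OF face_map_inj(1)[OF \<sigma>]] by (auto simp: inner_def)
  moreover have "finite (inner Ed bs)" using finite_letters[OF fin] by (simp add: inner_def)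
  ultimately show "cyc ?\<phi> (support ?\<phi> d)" "set (support ?\<phi> d) \<subseteq> inner Ed bs" "hd (support ?\<phi> d) = d"
    using cyc_of_inj[of "inner Ed bs" ?\<phi> d] d by blast+
qed

text \<open>An edge drawn in the outer region changes the face map only on darts of the outer walk,
  so the existing faces survive unaltered.\<close>

lemma inner_unchanged:
  assumes pm: "plane_map V Ed \<tau> \<sigma> bs" and d: "d \<in> inner Ed bs"
    and agree: "\<And>x. x \<in> inner Ed bs \<Longrightarrow> \<phi> x = (face_map \<sigma>) x"
  shows "support \<phi> d = support (face_map \<sigma>) d" "orbit \<phi> d = orbit (face_map \<sigma>) d"
    "orbit \<phi> d \<subseteq> inner Ed bs"
proof -
  note * = inner_support[OF pm d]
  have c: "cyc \<phi> (support (face_map \<sigma>) d)" by (rule cyc_cong[OF *(1)]) (use *(2) agree in blast)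
  have d: "d \<in> set (support (face_map \<sigma>) d)" using * by (metis cyc_def hd_in_set)
  show "support \<phi> d = support (face_map \<sigma>) d" using cyc_support_hd[OF c] *(3) by simp
  show "orbit \<phi> d = orbit (face_map \<sigma>) d" using cyc_orbit[OF c d] cyc_orbit[OF *(1) d] by simp
  show "orbit \<phi> d \<subseteq> inner Ed bs" using cyc_orbit[OF c d] *(2) by simp
qed

lemma letters_insert: "letters (insert (fst d) Ed) = insert d (insert (inv_letter d) (letters Ed))"
  by (cases d) (auto simp: letters_def inv_letter_def; metis)

lemma plane_map_rotate:
  assumes "plane_map V Ed \<tau> \<sigma> (p @ q)"
  shows "plane_map V Ed \<tau> \<sigma> (q @ p)"
  using assms cyc_swap[of "face_map \<sigma>" p q] by (auto simp: plane_map_def inner_def Un_commute split: if_splits)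

text \<open>A hair drawn into the outer region at the beginning of the boundary walk. It adds one
  vertex and one edge and no face, which preserves Euler's formula.\<close>

lemma plane_map_leaf:
  assumes pm: "plane_map V Ed \<tau> \<sigma> bs" and b: "ini (proj \<tau> d) \<in> V"
    and bs: "bs \<noteq> [] \<Longrightarrow> ini (proj \<tau> (hd bs)) = ini (proj \<tau> d)"
    and new: "fst d \<notin> Ed" "ter (proj \<tau> d) \<notin> V"
  shows "\<exists>\<sigma>'. plane_map (insert (ter (proj \<tau> d)) V) (insert (fst d) Ed) \<tau> \<sigma>' (d # inv_letter d # bs) \<and>
    (\<forall>x \<in> inner Ed bs. (face_map \<sigma>') x = (face_map \<sigma>) x)"
proof -
  let ?d' = "inv_letter d" and ?org = "ini \<circ> proj \<tau>" and ?\<phi> = "face_map \<sigma>"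
  have fin: "finite V" "finite Ed" and \<sigma>: "\<sigma> permutes letters Ed"
    and vc: "vertex_cycles \<sigma> (letters Ed) ?org" and ends: "\<And>x. x \<in> letters Ed \<Longrightarrow> ini (proj \<tau> x) \<in> V"
    and bsL: "set bs \<subseteq> letters Ed"
    and euler: "card V + card (orbit ?\<phi> ` inner Ed bs) = card Ed + 1"
    using pm by (auto simp: plane_map_def)
  have dL: "d \<notin> letters Ed" "?d' \<notin> letters Ed"
    using new(1) by (cases d; auto simp: letters_def inv_letter_def)+
  have \<sigma>d: "\<sigma> d = d" "\<sigma> ?d' = ?d'" using \<sigma> dL by (auto simp: permutes_not_in)
  let ?L = "letters (insert (fst d) Ed)"
  have L: "?L = insert ?d' (insert d (letters Ed))" using letters_insert by blast
  have neq: "ini (proj \<tau> d) \<noteq> ter (proj \<tau> d)" using b new by auto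
  \<comment> \<open>Since \<sigma> maps \<open>z\<close> to \<open>hd bs\<close>, the outer corner
    at the base lies between these two darts; the new dart goes there.\<close>
  define z where "z = inv_letter (last bs)"
  define \<sigma>' where "\<sigma>' = (if bs = [] then \<sigma> else ins \<sigma> z d)"
  have cyc: "cyc ?\<phi> bs" if "bs \<noteq> []" using pm that by (auto simp: plane_map_def split: if_splits)
  have z: "z \<in> letters Ed" "\<sigma> z = hd bs" "ini (proj \<tau> z) = ini (proj \<tau> d)" if "bs \<noteq> []"
  proof -
    show zL: "z \<in> letters Ed" using that bsL last_in_set[OF that] by (auto simp: z_def)
    show *: "\<sigma> z = hd bs" using cyc_last[OF cyc[OF that]] by (simp add: z_def)
    have "\<sigma> z \<in> orbit \<sigma> z" by (rule orbit.base)
    then show "ini (proj \<tau> z) = ini (proj \<tau> d)"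
      using vc zL bs[OF that] by (auto simp: vertex_cycles_def *)
  qed
  have L1: "\<sigma>' permutes insert d (letters Ed)"
    using ins_permutes[OF \<sigma> z(1) dL(1)] permutes_subset[OF \<sigma>, of "insert d (letters Ed)"] by (auto simp: \<sigma>'_def)
  have \<sigma>'d': "\<sigma>' ?d' = ?d'" by (rule permutes_not_in[OF L1]) (use dL in auto)
  have "vertex_cycles \<sigma>' (insert d (letters Ed)) ?org"
  proof (cases "bs = []")
    case True
    then have "Ed = {}" using pm by (auto simp: plane_map_def cyc_def split: if_splits)
    then show ?thesis using True \<sigma>d vertex_cycles_isolated[OF vc, of d] by (auto simp: \<sigma>'_def letters_def)
  next
    case False
    then show ?thesis
      using vertex_cycles_ins[OF vc \<sigma> finite_letters[OF fin(2)] z(1)[OF False] dL(1)] z(3)[OF False]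
      by (auto simp: \<sigma>'_def)
  qed
  moreover have "?org x \<noteq> ?org ?d'" if "x \<in> insert d (letters Ed)" for x
    using that new(2) neq ends[of x] by (cases "x = d") auto
  ultimately have vc': "vertex_cycles \<sigma>' ?L ?org"
    unfolding L using \<sigma>'d' by (intro vertex_cycles_isolated[where \<sigma> = \<sigma>' and y = ?d'])
  have \<phi>: "(face_map \<sigma>') x = ?\<phi> x" if "x \<in> letters Ed" "bs \<noteq> [] \<Longrightarrow> x \<noteq> last bs" for x
    using that dL by (auto simp: \<sigma>'_def ins_def z_def)
  have "cyc (face_map \<sigma>') (d # ?d' # bs)"
  proof (cases "bs = []")
    case True
    then show ?thesis using \<sigma>d by (simp add: cyc_def \<sigma>'_def)
  next
    case False
    then obtain cs l where bl: "bs = cs @ [l]" by (metis append_butlast_last_id)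
    have "map ?\<phi> cs = tl bs"
      using cyc[OF False] unfolding bl cyc_def by (cases cs) auto
    moreover have "map (face_map \<sigma>') cs = map ?\<phi> cs"
    proof (rule map_cong[OF HOL.refl])
      fix x assume "x \<in> set cs"
      then show "(face_map \<sigma>') x = ?\<phi> x"
        using bsL cyc[OF False] bl by (intro \<phi>) (auto simp: cyc_def)
    qed
    moreover have "(face_map \<sigma>') l = d" "(face_map \<sigma>') ?d' = hd bs"
      using False z(2)[OF False] dL z(1)[OF False] by (auto simp: \<sigma>'_def ins_def z_def bl)
    moreover have "(face_map \<sigma>') d = ?d'" using \<sigma>'d' by simp
    moreover have "distinct (d # ?d' # bs)" using dL bsL cyc[OF False] by (auto simp: cyc_def)
    ultimately show ?thesis using False by (simp add: cyc_Cons_iff) (simp add: bl)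
  qed
  moreover have inner: "inner (insert (fst d) Ed) (d # ?d' # bs) = inner Ed bs"
    unfolding inner_def using letters_insert[of d Ed] dL by auto
  moreover have agree: "(face_map \<sigma>') x = ?\<phi> x" if "x \<in> inner Ed bs" for x
    using that by (intro \<phi>) (auto simp: inner_def)
  moreover have "orbit (face_map \<sigma>') ` inner Ed bs = orbit ?\<phi> ` inner Ed bs"
    by (rule image_cong[OF HOL.refl]) (rule inner_unchanged(2)[OF pm _ agree])
  moreover have "\<sigma>' permutes ?L" unfolding L by (rule permutes_subset[OF L1]) auto
  moreover have "ini (proj \<tau> x) \<in> insert (ter (proj \<tau> d)) V" if "x \<in> ?L" for x
    using that ends[of x] b unfolding L by auto
  moreover have "set (d # ?d' # bs) \<subseteq> ?L" using bsL unfolding L by auto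
  ultimately show ?thesis
    using fin vc' euler new by (intro exI[of _ \<sigma>']) (auto simp: plane_map_def)
qed

lemma distinct_butlast_last:
  assumes "distinct (p @ q)"
  shows "x \<in> set (butlast p) \<Longrightarrow> x \<in> set p \<and> x \<noteq> last p \<and> x \<noteq> last (p @ q)"
    and "x \<in> set (butlast q) \<Longrightarrow> x \<in> set q \<and> x \<noteq> last (p @ q) \<and> (p \<noteq> [] \<longrightarrow> x \<noteq> last p)"
  using assms by (cases p rule: rev_cases; cases q rule: rev_cases; auto)+

text \<open>A chord drawn in the outer region from the start to the end of \<open>p\<close>:
  \<open>inv_letter d # p\<close> becomes the boundary of a new face and \<open>d # q\<close> the
  outer walk. One edge and one face are added, which preserves Euler's formula.\<close>

lemma plane_map_face:
  assumes pm: "plane_map V Ed \<tau> \<sigma> (p @ q)" and b: "ini (proj \<tau> d) \<in> V"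
    and walk: "walk (ini (proj \<tau> d)) (map (proj \<tau>) p) (ter (proj \<tau> d))"
    and q: "walk (ter (proj \<tau> d)) (map (proj \<tau>) q) (ini (proj \<tau> d))"
    and new: "fst d \<notin> Ed"
  shows "\<exists>\<sigma>'. plane_map V (insert (fst d) Ed) \<tau> \<sigma>' (d # q) \<and> cyc (face_map \<sigma>') (inv_letter d # p) \<and>
    (\<forall>x \<in> inner Ed (p @ q). (face_map \<sigma>') x = (face_map \<sigma>) x)"
proof -
  let ?d' = "inv_letter d" and ?org = "ini \<circ> proj \<tau>" and ?\<phi> = "face_map \<sigma>" and ?bs = "p @ q"
  have fin: "finite V" "finite Ed" "V \<noteq> {}" and \<sigma>: "\<sigma> permutes letters Ed"
    and vc: "vertex_cycles \<sigma> (letters Ed) ?org" and ends: "\<And>x. x \<in> letters Ed \<Longrightarrow> ini (proj \<tau> x) \<in> V"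
    and bsL: "set ?bs \<subseteq> letters Ed"
    and euler: "card V + card (orbit ?\<phi> ` inner Ed ?bs) = card Ed + 1"
    using pm by (auto simp: plane_map_def)
  have dL: "d \<notin> letters Ed" "?d' \<notin> letters Ed"
    using new(1) by (cases d; auto simp: letters_def inv_letter_def)+
  have \<sigma>d: "\<sigma> d = d" "\<sigma> ?d' = ?d'" using \<sigma> dL by (auto simp: permutes_not_in)
  let ?L = "letters (insert (fst d) Ed)"
  have L: "?L = insert ?d' (insert d (letters Ed))" using letters_insert by blast
  have ter: "ter (proj \<tau> d) \<in> V"
  proof (cases q)
    case Nil
    then show ?thesis using q b by simp
  next
    case (Cons x q')
    then show ?thesis using q ends[of x] bsL by auto
  qed
  have cyc: "cyc ?\<phi> ?bs" if "?bs \<noteq> []" using pm that by (auto simp: plane_map_def split: if_splits)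
  have "\<exists>\<sigma>'. \<sigma>' permutes ?L \<and> vertex_cycles \<sigma>' ?L ?org \<and> cyc (face_map \<sigma>') (d # q) \<and>
    cyc (face_map \<sigma>') (?d' # p) \<and> (\<forall>x \<in> inner Ed ?bs. (face_map \<sigma>') x = ?\<phi> x)"
  proof (cases "?bs = []")
    case True
    \<comment> \<open>There is no edge yet, so the chord is a loop at the only vertex and the new
      rotation interchanges its two darts.\<close>
    then have "Ed = {}" using pm by (auto simp: plane_map_def cyc_def split: if_splits)
    then have L0: "letters Ed = {}" by (simp add: letters_def)
    then have "\<sigma> = id" using \<sigma> by simp
    have loop: "ini (proj \<tau> d) = ter (proj \<tau> d)" using True walk by simp
    define \<sigma>' where "\<sigma>' = ins \<sigma> d ?d'"
    have "vertex_cycles \<sigma> {d} ?org" using vertex_cycles_isolated[OF vc \<sigma>d(1)] L0 by simp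
    then have "vertex_cycles \<sigma>' ?L ?org" unfolding \<sigma>'_def L L0
      by (rule vertex_cycles_ins) (use \<open>\<sigma> = id\<close> loop in \<open>auto simp: permutes_def\<close>)
    moreover have "\<sigma>' permutes ?L" unfolding \<sigma>'_def L L0
      by (rule ins_permutes) (use \<open>\<sigma> = id\<close> in \<open>auto simp: permutes_def\<close>)
    moreover have "cyc (face_map \<sigma>') (d # q)" "cyc (face_map \<sigma>') (?d' # p)"
      using True \<sigma>d by (auto simp: cyc_def \<sigma>'_def ins_def)
    ultimately show ?thesis using L0 by (intro exI[of _ \<sigma>']) (auto simp: inner_def)
  next
    case False
    \<comment> \<open>The dart \<open>d\<close> enters the outer corner at the base, behind
      \<open>z\<close>, and \<open>inv_letter d\<close> the outer corner at the end of
      \<open>p\<close>, behind \<open>y\<close>. For empty \<open>p\<close> the chord is a loop with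
      both darts in the same corner, and \<open>inv_letter d\<close> comes directly behind
      \<open>d\<close>.\<close>
    define z where "z = inv_letter (last ?bs)"
    define y where "y = (if p = [] then d else inv_letter (last p))"
    define \<sigma>1 where "\<sigma>1 = ins \<sigma> z d"
    define \<sigma>' where "\<sigma>' = ins \<sigma>1 y ?d'"
    have zL: "z \<in> letters Ed" using False bsL last_in_set[OF False] by (auto simp: z_def)
    have \<sigma>z: "\<sigma> z = hd ?bs" using cyc_last[OF cyc[OF False]] by (simp add: z_def)
    have w: "walk (ini (proj \<tau> d)) (map (proj \<tau>) ?bs) (ini (proj \<tau> d))"
      using walk q by (auto simp: walk_append)
    then have "ini (proj \<tau> (hd ?bs)) = ini (proj \<tau> d)" using False by (cases ?bs) auto
    moreover have "\<sigma> z \<in> orbit \<sigma> z" by (rule orbit.base)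
    ultimately have orgz: "?org d = ?org z"
      using vc zL by (auto simp: vertex_cycles_def \<sigma>z)
    have p1: "\<sigma>1 permutes insert d (letters Ed)" unfolding \<sigma>1_def by (rule ins_permutes[OF \<sigma> zL dL(1)])
    have v1: "vertex_cycles \<sigma>1 (insert d (letters Ed)) ?org" unfolding \<sigma>1_def
      by (rule vertex_cycles_ins[OF vc \<sigma> finite_letters[OF fin(2)] zL dL(1) orgz])
    have y: "y \<in> insert d (letters Ed)" "?org ?d' = ?org y"
    proof -
      have "p \<noteq> [] \<Longrightarrow> last p \<in> letters Ed" using bsL last_in_set[of p] by fastforce
      then show "y \<in> insert d (letters Ed)" by (simp add: y_def)
      show "?org ?d' = ?org y"
      proof (cases p rule: rev_cases)
        case Nil
        then show ?thesis using walk by (simp add: y_def)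
      next
        case (snoc p' x)
        then show ?thesis using walk by (simp add: y_def walk_append)
      qed
    qed
    have "\<sigma>' permutes ?L" unfolding L \<sigma>'_def by (rule ins_permutes[OF p1 y(1)]) (use dL in auto)
    moreover have "vertex_cycles \<sigma>' ?L ?org" unfolding L \<sigma>'_def
      by (rule vertex_cycles_ins[OF v1 p1 _ y(1) _ y(2)]) (use dL finite_letters[OF fin(2)] in auto)
    moreover have \<phi>: "(face_map \<sigma>') x = ?\<phi> x" if "x \<in> letters Ed" "x \<noteq> last ?bs" "p \<noteq> [] \<Longrightarrow> x \<noteq> last p" for x
    proof -
      have "inv_letter x \<in> letters Ed" using that(1) by simp
      then have "inv_letter x \<noteq> d" "inv_letter x \<noteq> ?d'" using dL by metis+
      moreover have "inv_letter x \<noteq> z" using that(2) unfolding z_def inv_letter_eq_iff .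
      moreover have "inv_letter x \<noteq> y"
        using that(3) calculation(1) by (cases "p = []") (simp_all add: y_def)
      ultimately show ?thesis by (simp add: \<sigma>'_def \<sigma>1_def ins_def)
    qed
    have dist: "distinct (p @ q)" "map ?\<phi> (p @ q) = rotate1 (p @ q)"
      using cyc[OF False] by (auto simp: cyc_def)
    have inside: "map (face_map \<sigma>') (butlast p) = tl p" "map (face_map \<sigma>') (butlast q) = tl q"
      "p \<noteq> [] \<Longrightarrow> q \<noteq> [] \<Longrightarrow> ?\<phi> (last p) = hd q"
    proof -
      have tlb: "map ?\<phi> (butlast (p @ q)) = tl (p @ q)"
        by (rule cyc_butlast[OF cyc[OF False]])
      show "p \<noteq> [] \<Longrightarrow> q \<noteq> [] \<Longrightarrow> ?\<phi> (last p) = hd q"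
        using cyc_last[OF cyc_swap[OF cyc[OF False]]] by simp
      have bp: "map ?\<phi> (butlast p) = tl p"
      proof (cases "p = []")
        case False
        have "map ?\<phi> (butlast (p @ q)) = map ?\<phi> (butlast p) @ map ?\<phi> (drop (length (butlast p)) (butlast (p @ q)))"
          using False by (cases p rule: rev_cases) (auto simp: butlast_append)
        moreover have "tl (p @ q) = tl p @ q" using False by simp
        ultimately show ?thesis using tlb by (metis append_eq_append_conv length_butlast length_map length_tl)
      qed simp
      have bq: "map ?\<phi> (butlast q) = tl q"
      proof (cases "q = []")
        case False
        have "butlast (p @ q) = p @ butlast q" using False by (simp add: butlast_append)
        moreover have "tl (p @ q) = (if p = [] then [] else tl p @ [hd q]) @ tl q" using False by (cases p) auto
        ultimately have "map ?\<phi> p @ map ?\<phi> (butlast q) = (if p = [] then [] else tl p @ [hd q]) @ tl q"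
          using tlb by simp
        moreover have "length (map ?\<phi> p) = length (if p = [] then [] else tl p @ [hd q])" by simp
        ultimately show ?thesis by (metis append_eq_append_conv)
      qed simp
      have "map (face_map \<sigma>') (butlast p) = map ?\<phi> (butlast p)"
      proof (rule map_cong[OF HOL.refl])
        fix x assume "x \<in> set (butlast p)"
        then show "(face_map \<sigma>') x = ?\<phi> x"
          using bsL distinct_butlast_last(1)[OF dist(1), of x] by (intro \<phi>) auto
      qed
      then show "map (face_map \<sigma>') (butlast p) = tl p" using bp by simp
      have "map (face_map \<sigma>') (butlast q) = map ?\<phi> (butlast q)"
      proof (rule map_cong[OF HOL.refl])
        fix x assume "x \<in> set (butlast q)"
        then show "(face_map \<sigma>') x = ?\<phi> x"
          using bsL distinct_butlast_last(2)[OF dist(1), of x] by (intro \<phi>) auto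
      qed
      then show "map (face_map \<sigma>') (butlast q) = tl q" using bq by simp
    qed
    have zd: "z \<noteq> d" "z \<noteq> ?d'" using zL dL by auto
    have "cyc (face_map \<sigma>') (d # q) \<and> cyc (face_map \<sigma>') (?d' # p)"
    proof (cases "p = []")
      case True
      then have q: "q \<noteq> []" using False by simp
      have v: "\<sigma>' z = d" "\<sigma>' d = ?d'" "\<sigma>' ?d' = hd q"
        using True zd \<sigma>z by (auto simp: \<sigma>'_def \<sigma>1_def ins_def y_def)
      obtain r l where ql: "q = r @ [l]" using q by (metis append_butlast_last_id)
      have "map (face_map \<sigma>') q = tl q @ [d]"
        using inside(2) v(1) True ql by (simp add: z_def)
      then show ?thesis using v True q dist dL bsL by (auto simp: cyc_Cons_iff)
    next
      case p: False
      then obtain r l where pl: "p = r @ [l]" by (metis append_butlast_last_id)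
      show ?thesis
      proof (cases "q = []")
        case True
        then have "y = z" using p by (simp add: y_def z_def)
        then have v: "\<sigma>' z = ?d'" "\<sigma>' ?d' = d" "\<sigma>' d = hd p"
          using True zd \<sigma>z by (auto simp: \<sigma>'_def \<sigma>1_def ins_def)
        have "map (face_map \<sigma>') p = tl p @ [?d']"
          using inside(1) v(1) True pl by (simp add: z_def)
        then show ?thesis using v True p dist dL bsL by (auto simp: cyc_Cons_iff)
      next
        case q: False
        obtain r' l' where ql: "q = r' @ [l']" using q by (metis append_butlast_last_id)
        have "y \<noteq> z" using dist(1) by (simp add: y_def z_def pl ql)
        moreover have "y \<in> letters Ed" using bsL pl by (simp add: y_def)
        moreover have "\<sigma> y = hd q" using inside(3)[OF p q] p by (simp add: y_def)
        ultimately have v: "\<sigma>' z = d" "\<sigma>' d = hd p" "\<sigma>' y = ?d'" "\<sigma>' ?d' = hd q"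
          using zd \<sigma>z p dL by (auto simp: \<sigma>'_def \<sigma>1_def ins_def)
        have "map (face_map \<sigma>') p = tl p @ [?d']" "map (face_map \<sigma>') q = tl q @ [d]"
          using inside(1,2) v pl ql by (simp_all add: z_def y_def)
        then show ?thesis using v p q dist dL bsL by (auto simp: cyc_Cons_iff)
      qed
    qed
    moreover have "(face_map \<sigma>') x = ?\<phi> x" if "x \<in> inner Ed ?bs" for x
    proof (rule \<phi>)
      show "x \<noteq> last ?bs" using that last_in_set[OF False] by (auto simp only: inner_def)
      show "x \<noteq> last p" if "p \<noteq> []" using \<open>x \<in> inner Ed ?bs\<close> last_in_set[OF that] by (auto simp: inner_def)
    qed (use that in \<open>simp add: inner_def\<close>)
    ultimately show ?thesis by blast
  qed
  then obtain \<sigma>' where \<sigma>': "\<sigma>' permutes ?L" "vertex_cycles \<sigma>' ?L ?org" "cyc (face_map \<sigma>') (d # q)"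
    "cyc (face_map \<sigma>') (?d' # p)" "\<forall>x \<in> inner Ed ?bs. (face_map \<sigma>') x = ?\<phi> x" by blast
  let ?\<phi>' = "face_map \<sigma>'"
  have dist: "distinct (p @ q)" using cyc by (cases "?bs = []") (auto simp: cyc_def)
  have inner: "inner (insert (fst d) Ed) (d # q) = inner Ed ?bs \<union> set (?d' # p)"
    unfolding inner_def using letters_insert[of d Ed] dL bsL dist by auto
  have "orbit ?\<phi>' ` set (?d' # p) = {set (?d' # p)}"
    using cyc_orbit[OF \<sigma>'(4)] by (auto simp del: comp_apply)
  moreover have "orbit ?\<phi>' ` inner Ed ?bs = orbit ?\<phi> ` inner Ed ?bs"
    by (rule image_cong[OF HOL.refl]) (rule inner_unchanged(2)[OF pm], use \<sigma>'(5) in auto)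
  ultimately have orb: "orbit ?\<phi>' ` inner (insert (fst d) Ed) (d # q) = insert (set (?d' # p)) (orbit ?\<phi> ` inner Ed ?bs)"
    unfolding inner by (auto simp only: image_Un)
  have "set (?d' # p) \<notin> orbit ?\<phi> ` inner Ed ?bs"
  proof
    assume "set (?d' # p) \<in> orbit ?\<phi> ` inner Ed ?bs"
    then obtain x where "x \<in> inner Ed ?bs" "?d' \<in> orbit ?\<phi> x" by auto
    then show False using inner_unchanged(3)[OF pm, of x ?\<phi>] dL by (auto simp: inner_def)
  qed
  moreover have "finite (inner Ed ?bs)" using finite_letters[OF fin(2)] by (simp add: inner_def)
  ultimately have "card (orbit ?\<phi>' ` inner (insert (fst d) Ed) (d # q)) = Suc (card (orbit ?\<phi> ` inner Ed ?bs))"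
    unfolding orb by simp
  then have "plane_map V (insert (fst d) Ed) \<tau> \<sigma>' (d # q)"
    using fin \<sigma>' euler new ends b ter bsL unfolding plane_map_def L by auto
  then show ?thesis using \<sigma>' by blast
qed

lemma plane_map_cong:
  assumes "plane_map V Ed \<tau> \<sigma> bs" "\<And>e. e \<in> Ed \<Longrightarrow> \<tau>' e = \<tau> e"
  shows "plane_map V Ed \<tau>' \<sigma> bs"
proof -
  have "proj \<tau>' x = proj \<tau> x" if "x \<in> letters Ed" for x
    using that assms(2) by (cases x) (auto simp: proj_def letters_def)
  moreover from this have "vertex_cycles \<sigma> (letters Ed) (ini \<circ> proj \<tau>')"
    using assms(1) by (auto simp: plane_map_def intro: vertex_cycles_cong)
  ultimately show ?thesis using assms(1) by (auto simp: plane_map_def)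
qed

section \<open>Realising inductive diagrams by plane maps\<close>

definition linked :: "'v set \<Rightarrow> ('v \<times> 'a \<times> 'v) set \<Rightarrow> bool" where
  "linked V E \<longleftrightarrow> (\<forall>u \<in> V. \<forall>v \<in> V. \<exists>p. walk u p v \<and> fst ` set p \<subseteq> E)"

lemma linked_mono: "linked V E \<Longrightarrow> E \<subseteq> E' \<Longrightarrow> linked V E'"
  unfolding linked_def by (meson order.trans)

lemma linked_insert:
  assumes "linked V E" "ini d \<in> V"
  shows "linked (insert (ter d) V) (insert (fst d) E)"
  unfolding linked_def
proof (intro ballI)
  fix u v assume uv: "u \<in> insert (ter d) V" "v \<in> insert (ter d) V"
  have out: "\<exists>p. walk u p (ini d) \<and> fst ` set p \<subseteq> insert (fst d) E" if "u \<in> insert (ter d) V" for u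
  proof (cases "u \<in> V")
    case True
    from assms(1)[unfolded linked_def, rule_format, OF this assms(2)]
    show ?thesis by (elim exE) (rule exI, auto)
  next
    case False
    then show ?thesis using that by (intro exI[of _ "[inv_letter d]"]) auto
  qed
  obtain p where p: "walk u p (ini d)" "fst ` set p \<subseteq> insert (fst d) E" using out[OF uv(1)] by blast
  obtain q where q: "walk v q (ini d)" "fst ` set q \<subseteq> insert (fst d) E" using out[OF uv(2)] by blast
  have "fst ` set (inv_word q) = fst ` set q" by (induction q) auto
  then show "\<exists>p. walk u p v \<and> fst ` set p \<subseteq> insert (fst d) E"
    using p q by (intro exI[of _ "p @ inv_word q"]) (simp add: walk_append image_Un, blast)
qed

abbreviation faces_ok :: "'a word set \<Rightarrow> nat set \<Rightarrow> nat set \<Rightarrow> (nat \<Rightarrow> nat \<times> 'a \<times> nat) \<Rightarrow>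
    (nat letter \<Rightarrow> nat letter) \<Rightarrow> nat word \<Rightarrow> bool" where
  "faces_ok C Z Ed \<tau> \<sigma> bs \<equiv>
    \<forall>d \<in> inner Ed bs. map (lbl \<circ> proj \<tau>) (support (face_map \<sigma>) d) \<in> C \<and> ini (proj \<tau> d) \<in> Z"

text \<open>The set \<open>Z\<close> contains the vertices on faces and is a parameter separate from
  \<open>V\<close>: attaching hairs enlarges \<open>V\<close>, while distances are controlled on
  \<open>Z\<close> alone.\<close>

definition planar :: "'a word set \<Rightarrow> nat set \<Rightarrow> nat set \<Rightarrow> (nat \<times> 'a \<times> nat) set \<Rightarrow> nat \<Rightarrow> nat \<Rightarrow>
    (nat, 'a) dart list \<Rightarrow> bool" where
  "planar C Z V E k b w \<longleftrightarrow> b \<in> V \<and> walk b w b \<and> linked V E \<and>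
    (\<exists>Ed \<tau> \<sigma> bs. plane_map V Ed \<tau> \<sigma> bs \<and> \<tau> ` Ed = E \<and> map (proj \<tau>) bs = w \<and>
      card (orbit (face_map \<sigma>) ` inner Ed bs) \<le> k \<and>
      faces_ok C Z Ed \<tau> \<sigma> bs)"

lemma planar_Nil: "planar C Z {b} {} 0 b []"
proof -
  have "plane_map {b} {} (\<lambda>_. undefined) id []"
    by (auto simp: plane_map_def letters_def vertex_cycles_def inner_def)
  then show ?thesis
    by (auto simp: planar_def linked_def inner_def letters_def intro!: exI[of _ "{}"] exI[of _ "[]"])
qed

lemma planar_walk_end:
  assumes "planar C Z V E k b (p @ q)" "walk b p c"
  shows "c \<in> V"
proof (cases q)
  case Nil
  then show ?thesis using assms by (auto simp: planar_def dest: walk_inj)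
next
  case (Cons x q')
  obtain Ed \<tau> \<sigma> bs where *: "plane_map V Ed \<tau> \<sigma> bs" "map (proj \<tau>) bs = p @ x # q'"
    using assms Cons by (auto simp: planar_def)
  obtain u y v where "bs = u @ y # v" "proj \<tau> y = x"
    using *(2) by (auto simp: map_eq_append_conv map_eq_Cons_conv)
  then have "ini x \<in> V" using *(1) by (auto simp: plane_map_def)
  moreover have "ini x = c"
    using assms Cons by (auto simp: planar_def walk_append dest: walk_inj)
  ultimately show ?thesis by simp
qed

lemma planar_rotate:
  assumes "planar C Z V E k b (p @ q)" "walk b p c"
  shows "planar C Z V E k c (q @ p)"
proof -
  have c: "c \<in> V" using planar_walk_end[OF assms] .
  have w: "walk c (q @ p) c" using assms by (auto simp: planar_def walk_append dest: walk_inj)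
  obtain Ed \<tau> \<sigma> bs where *: "plane_map V Ed \<tau> \<sigma> bs" "\<tau> ` Ed = E" "map (proj \<tau>) bs = p @ q"
    "card (orbit (face_map \<sigma>) ` inner Ed bs) \<le> k"
    "faces_ok C Z Ed \<tau> \<sigma> bs"
    using assms by (auto simp: planar_def)
  obtain bs1 bs2 where bs: "bs = bs1 @ bs2" "map (proj \<tau>) bs1 = p" "map (proj \<tau>) bs2 = q"
    using *(3) by (auto simp: map_eq_append_conv)
  have "inner Ed (bs2 @ bs1) = inner Ed bs" by (auto simp: inner_def bs)
  then show ?thesis unfolding planar_def
    using c w assms(1) * plane_map_rotate[of V Ed \<tau> \<sigma> bs1 bs2] bs
    by (intro conjI exI[of _ Ed] exI[of _ \<tau>] exI[of _ \<sigma>] exI[of _ "bs2 @ bs1"]) (auto simp: planar_def)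
qed

lemma planar_new_edge:
  assumes "planar C Z V E k b w"
  obtains Ed \<tau> \<sigma> bs dd where "plane_map V Ed \<tau> \<sigma> bs" "\<tau> ` insert (fst dd) Ed = insert (fst d) E" "\<tau> ` Ed = E"
    "map (proj \<tau>) bs = w" "card (orbit (face_map \<sigma>) ` inner Ed bs) \<le> k"
    "faces_ok C Z Ed \<tau> \<sigma> bs"
    "fst dd \<notin> Ed" "proj \<tau> dd = d"
proof -
  obtain Ed \<tau> \<sigma> bs where *: "plane_map V Ed \<tau> \<sigma> bs" "\<tau> ` Ed = E" "map (proj \<tau>) bs = w"
    "card (orbit (face_map \<sigma>) ` inner Ed bs) \<le> k"
    "faces_ok C Z Ed \<tau> \<sigma> bs"
    using assms by (auto simp: planar_def)
  have "finite Ed" using *(1) by (simp add: plane_map_def)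
  then obtain e where e: "e \<notin> Ed" using ex_new_if_finite infinite_UNIV_nat by metis
  define \<tau>' where "\<tau>' = \<tau>(e := fst d)"
  have agree: "\<And>x. x \<in> Ed \<Longrightarrow> \<tau>' x = \<tau> x" using e by (auto simp: \<tau>'_def)
  have pr: "proj \<tau>' x = proj \<tau> x" if "x \<in> letters Ed" for x
    using that agree by (cases x) (auto simp: proj_def letters_def)
  have bs: "set bs \<subseteq> letters Ed" using *(1) by (simp add: plane_map_def)
  show ?thesis
  proof (rule that[of Ed \<tau>' \<sigma> bs "(e, snd d)"])
    show "plane_map V Ed \<tau>' \<sigma> bs" by (rule plane_map_cong[OF *(1) agree])
    show img: "\<tau>' ` Ed = E" using *(2) agree by (metis image_cong)
    have "\<tau>' e = fst d" by (simp add: \<tau>'_def)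
    then show "\<tau>' ` insert (fst (e, snd d)) Ed = insert (fst d) E" using img by simp
    show "map (proj \<tau>') bs = w" using *(3) bs pr by (metis (no_types, lifting) map_cong subsetD)
    show "fst (e, snd d) \<notin> Ed" using e by simp
    show "proj \<tau>' (e, snd d) = d" by (simp add: proj_def \<tau>'_def)
    show "\<forall>d \<in> inner Ed bs. map (lbl \<circ> proj \<tau>') (support (face_map \<sigma>) d) \<in> C \<and> ini (proj \<tau>' d) \<in> Z"
    proof
      fix x assume x: "x \<in> inner Ed bs"
      have s: "set (support (face_map \<sigma>) x) \<subseteq> letters Ed"
        using inner_support(2)[OF *(1) x] by (auto simp: inner_def)
      have "map (lbl \<circ> proj \<tau>') (support (face_map \<sigma>) x) = map (lbl \<circ> proj \<tau>) (support (face_map \<sigma>) x)"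
        by (rule map_cong[OF HOL.refl]) (use s pr in force)
      moreover have "x \<in> letters Ed" using x by (simp add: inner_def)
      ultimately show "map (lbl \<circ> proj \<tau>') (support (face_map \<sigma>) x) \<in> C \<and> ini (proj \<tau>' x) \<in> Z"
        using *(5) x pr by metis
    qed
  qed (use * in auto)
qed

lemma planar_leaf:
  assumes pl: "planar C Z V E k b w" and d: "ini d = b" "ter d \<notin> V"
  shows "planar C Z (insert (ter d) V) (insert (fst d) E) k b (d # inv_letter d # w)"
proof -
  obtain Ed \<tau> \<sigma> bs dd where *: "plane_map V Ed \<tau> \<sigma> bs" "\<tau> ` insert (fst dd) Ed = insert (fst d) E" "\<tau> ` Ed = E"
    "map (proj \<tau>) bs = w" "card (orbit (face_map \<sigma>) ` inner Ed bs) \<le> k"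
    "faces_ok C Z Ed \<tau> \<sigma> bs"
    "fst dd \<notin> Ed" "proj \<tau> dd = d"
    by (rule planar_new_edge[OF pl, where d = d])
  have bV: "b \<in> V" "walk b w b" "linked V E" using pl by (auto simp: planar_def)
  have "ini (proj \<tau> (hd bs)) = ini (proj \<tau> dd)" if "bs \<noteq> []"
    using that bV(2) d *(4,8) by (cases bs) auto
  then obtain \<sigma>' where \<sigma>': "plane_map (insert (ter (proj \<tau> dd)) V) (insert (fst dd) Ed) \<tau> \<sigma>' (dd # inv_letter dd # bs)"
    "\<And>x. x \<in> inner Ed bs \<Longrightarrow> (face_map \<sigma>') x = (face_map \<sigma>) x"
    using plane_map_leaf[OF *(1), of dd] *(7,8) d bV by auto
  have ddL: "dd \<notin> letters Ed" "inv_letter dd \<notin> letters Ed"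
    using *(7) by (cases dd; auto simp: letters_def inv_letter_def)+
  have inner: "inner (insert (fst dd) Ed) (dd # inv_letter dd # bs) = inner Ed bs"
    unfolding inner_def letters_insert using ddL by auto
  have "card (orbit (face_map \<sigma>') ` inner Ed bs) = card (orbit (face_map \<sigma>) ` inner Ed bs)"
    using \<sigma>'(1) *(1,7,8) d unfolding plane_map_def inner by auto
  moreover have "\<forall>x \<in> inner Ed bs. map (lbl \<circ> proj \<tau>) (support (face_map \<sigma>') x) \<in> C \<and> ini (proj \<tau> x) \<in> Z"
    using inner_unchanged(1)[where \<phi> = "face_map \<sigma>'", OF *(1) _ \<sigma>'(2)] *(6) by metis
  moreover have "linked (insert (ter d) V) (insert (fst d) E)" using linked_insert bV d by metis
  ultimately show ?thesis
    unfolding planar_def using \<sigma>'(1) * d bV inner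
    by (intro conjI exI[of _ "insert (fst dd) Ed"] exI[of _ \<tau>] exI[of _ \<sigma>'] exI[of _ "dd # inv_letter dd # bs"]) auto
qed

context relators
begin

lemma C_rotate_k: "r \<in> C \<Longrightarrow> rotate k r \<in> C"
  using C_rotate[of "take (k mod length r) r" "drop (k mod length r) r"] by (simp add: rotate_drop_take)

lemma planar_face:
  assumes pl: "planar C Z V E k b (inv_word s @ w)" and ds: "map lbl (d # s) \<in> C"
    and d: "ini d = b" "walk b (inv_word s) (ter d)" and Z: "V \<subseteq> Z"
  shows "planar C Z V (insert (fst d) E) (Suc k) b (d # w)"
proof -
  obtain Ed \<tau> \<sigma> bs dd where *: "plane_map V Ed \<tau> \<sigma> bs" "\<tau> ` insert (fst dd) Ed = insert (fst d) E" "\<tau> ` Ed = E"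
    "map (proj \<tau>) bs = inv_word s @ w" "card (orbit (face_map \<sigma>) ` inner Ed bs) \<le> k"
    "faces_ok C Z Ed \<tau> \<sigma> bs"
    "fst dd \<notin> Ed" "proj \<tau> dd = d"
    by (rule planar_new_edge[OF pl, where d = d])
  obtain p q where bs: "bs = p @ q" "map (proj \<tau>) p = inv_word s" "map (proj \<tau>) q = w"
    using *(4) by (auto simp: map_eq_append_conv)
  have bV: "b \<in> V" "linked V E" and w: "walk b (inv_word s @ w) b" using pl by (auto simp: planar_def)
  obtain c where "walk b (inv_word s) c" "walk c w b" using w unfolding walk_append by blast
  then have wq: "walk (ter d) w b" using walk_inj[OF _ d(2)] by metis
  have "\<exists>\<sigma>'. plane_map V (insert (fst dd) Ed) \<tau> \<sigma>' (dd # q) \<and> cyc (face_map \<sigma>') (inv_letter dd # p) \<and>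
    (\<forall>x \<in> inner Ed (p @ q). (face_map \<sigma>') x = (face_map \<sigma>) x)"
    by (rule plane_map_face) (use * bs bV d wq in auto)
  then obtain \<sigma>' where \<sigma>': "plane_map V (insert (fst dd) Ed) \<tau> \<sigma>' (dd # q)" "cyc (face_map \<sigma>') (inv_letter dd # p)"
    "\<And>x. x \<in> inner Ed bs \<Longrightarrow> (face_map \<sigma>') x = (face_map \<sigma>) x" unfolding bs(1) by blast
  have inner: "inner (insert (fst dd) Ed) (dd # q) \<subseteq> inner Ed bs \<union> set (inv_letter dd # p)"
    unfolding inner_def letters_insert bs(1) by auto
  have "card (orbit (face_map \<sigma>') ` inner (insert (fst dd) Ed) (dd # q)) = Suc (card (orbit (face_map \<sigma>) ` inner Ed bs))"
    using \<sigma>'(1) *(1,7) unfolding plane_map_def by auto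
  moreover have "map (lbl \<circ> proj \<tau>) (support (face_map \<sigma>') x) \<in> C \<and> ini (proj \<tau> x) \<in> Z"
    if x: "x \<in> inner (insert (fst dd) Ed) (dd # q)" for x
  proof (cases "x \<in> inner Ed bs")
    case True
    then show ?thesis
      using inner_unchanged(1)[where \<phi> = "face_map \<sigma>'", OF *(1) _ \<sigma>'(3)] *(6) by metis
  next
    case False
    then have "x \<in> set (inv_letter dd # p)" using x inner by auto
    then obtain i where i: "support (face_map \<sigma>') x = rotate i (inv_letter dd # p)"
      using cyc_support[OF \<sigma>'(2)] by blast
    have "map (lbl \<circ> proj \<tau>) p = map lbl (inv_word s)" using bs(2) by (metis list.map_comp)
    \<comment> \<open>The embedded face is walked against \<open>d\<close>, so its label is a
      rotation of the inverse of \<open>map lbl (d # s)\<close>.\<close>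
    then have "map (lbl \<circ> proj \<tau>) (inv_letter dd # p) = inv_letter (lbl d) # inv_word (map lbl s)"
      using *(8) by simp
    moreover have "inv_letter (lbl d) # inv_word (map lbl s) \<in> C"
      using C_rotate[of "inv_word (map lbl s)" "[inv_letter (lbl d)]"] C_inv[OF ds] by simp
    ultimately have "map (lbl \<circ> proj \<tau>) (support (face_map \<sigma>') x) \<in> C"
      unfolding i using C_rotate_k by (metis rotate_map)
    moreover have "ini (proj \<tau> x) \<in> V" using \<sigma>'(1) x by (auto simp: plane_map_def inner_def)
    ultimately show ?thesis using Z by auto
  qed
  moreover have "linked V (insert (fst d) E)" using linked_mono bV by blast
  ultimately show ?thesis
    unfolding planar_def using \<sigma>'(1) * bs bV d wq
    by (intro conjI exI[of _ "insert (fst dd) Ed"] exI[of _ \<tau>] exI[of _ \<sigma>'] exI[of _ "dd # q"]) auto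
qed

lemma planar_leaf_at:
  assumes pl: "planar C Z V E k b (p @ q)" and p: "walk b p (ini d)" and new: "ter d \<notin> V"
  shows "planar C Z (insert (ter d) V) (insert (fst d) E) k b (p @ d # inv_letter d # q)"
proof -
  have "walk b (p @ q) b" using pl by (simp add: planar_def)
  then have q: "walk (ini d) (d # inv_letter d # q) b" using p by (auto simp: walk_append dest: walk_inj)
  have "planar C Z (insert (ter d) V) (insert (fst d) E) k (ini d) ((d # inv_letter d # q) @ p)"
    using planar_leaf[OF planar_rotate[OF pl p] HOL.refl new] by simp
  from planar_rotate[OF this q] show ?thesis .
qed

lemma planar_face_at:
  assumes pl: "planar C Z V E k b (p @ inv_word s @ q)" and ds: "map lbl (d # s) \<in> C"
    and p: "walk b p (ini d)" and d: "walk (ini d) (inv_word s) (ter d)" and Z: "V \<subseteq> Z"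
  shows "planar C Z V (insert (fst d) E) (Suc k) b (p @ d # q)"
proof -
  have "walk b (p @ inv_word s @ q) b" using pl by (simp add: planar_def)
  then obtain u c where u: "walk b p u" "walk u (inv_word s) c" "walk c q b"
    unfolding walk_append by blast
  have "u = ini d" using walk_inj[OF u(1) p] .
  then have "c = ter d" using walk_inj[OF u(2)] d by simp
  then have q: "walk (ini d) (d # q) b" using u(3) by simp
  have "planar C Z V (insert (fst d) E) (Suc k) (ini d) ((d # q) @ p)"
    using planar_face[of Z V E k "ini d" s "q @ p" d] planar_rotate[OF pl p] ds d Z by simp
  from planar_rotate[OF this q] show ?thesis .
qed

text \<open>Replays the construction of a \<open>disc\<close> in the outer corner between
  \<open>p\<close> and \<open>q\<close> of a diagram already embedded. An arbitrary surrounding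
  diagram is needed for the induction: at a bridge the near side is drawn, then the bridge as a
  hair, and the far side goes into the corner at its tip.\<close>

lemma planar_insert_disc:
  assumes "disc C m k V E b w" "planar C Z V0 E0 k0 b0 (p @ q)" "walk b0 p b" "V \<inter> V0 = {b}" "V \<union> V0 \<subseteq> Z"
  shows "planar C Z (V \<union> V0) (E \<union> E0) (k + k0) b0 (p @ w @ q)"
  using assms
proof (induction arbitrary: V0 E0 k0 p q rule: disc.induct)
  case (disc_Nil b)
  then have "b \<in> V0" by auto
  then show ?case using disc_Nil by (simp add: insert_absorb)
next
  case (disc_bridge d b m k V E u m' k' V' E' v)
  have b: "b \<in> V'" and t: "ter d \<in> V" using disc_base disc_bridge.hyps by metis+
  have 1: "planar C Z (V' \<union> V0) (E' \<union> E0) (k' + k0) b0 (p @ v @ q)"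
    by (rule disc_bridge.IH(2)) (use disc_bridge.prems b in auto)
  have fresh: "ter d \<notin> V' \<union> V0" using disc_bridge.prems disc_bridge.hyps(4) b t by auto
  have "planar C Z (insert (ter d) (V' \<union> V0)) (insert (fst d) (E' \<union> E0)) (k' + k0) b0 ((p @ [d]) @ inv_letter d # v @ q)"
    using planar_leaf_at[OF 1 _ fresh] disc_bridge by simp
  then have "planar C Z (V \<union> insert (ter d) (V' \<union> V0)) (E \<union> insert (fst d) (E' \<union> E0)) (k + (k' + k0)) b0
      ((p @ [d]) @ u @ inv_letter d # v @ q)"
  proof (rule disc_bridge.IH(1))
    have "x \<notin> V0" if "x \<in> V" for x
    proof
      assume "x \<in> V0"
      then have "x \<in> (V \<union> V') \<inter> V0" using that by simp
      then have "x \<in> V'" using disc_bridge.prems(3) b by simp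
      then show False using disc_bridge.hyps(4) that by auto
    qed
    then show "V \<inter> insert (ter d) (V' \<union> V0) = {ter d}" using disc_bridge.hyps(4) t by auto
  qed (use disc_bridge.prems disc_bridge.hyps t in \<open>auto simp: walk_append\<close>)
  moreover have "V \<union> insert (ter d) (V' \<union> V0) = V \<union> V' \<union> V0" using t by auto
  moreover have "E \<union> insert (fst d) (E' \<union> E0) = insert (fst d) (E \<union> E') \<union> E0" by auto
  ultimately show ?case by (simp add: add.assoc)
next
  case (disc_face d s b m k V E w)
  have "planar C Z (V \<union> V0) (E \<union> E0) (k + k0) b0 (p @ inv_word s @ (w @ q))"
    using disc_face.IH[OF disc_face.prems] by simp
  from planar_face_at[OF this disc_face.hyps(1)] show ?case
    using disc_face by simp
qed

lemma planar_of_disc: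
  fixes V :: "nat set"
  assumes "disc C m k V E b w"
  shows "planar C V V E k b w"
proof -
  have "b \<in> V" using disc_base[OF assms] .
  then show ?thesis
    using planar_insert_disc[OF assms, of V "{b}" "{}" 0 b "[]" "[]"] planar_Nil[of C V b]
    by (simp add: insert_absorb)
qed

definition near_planar :: "nat \<Rightarrow> nat \<Rightarrow> 'a word \<Rightarrow> bool" where
  "near_planar D k w \<longleftrightarrow>
    (\<exists>Z V E b b0 p. planar C Z V E k b p \<and> map lbl p = w \<and> near E D b0 Z)"

lemma near_planar_diagram: "diagram D k w \<Longrightarrow> \<exists>l \<le> k. near_planar D l w"
  by (elim diagramE) (unfold near_planar_def, blast dest: planar_of_disc)

text \<open>The inserted cancelling pair becomes a hair in the outer region. No face is created, so
  \<open>Z\<close> and the bound on distances are kept.\<close>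

lemma near_planar_expand:
  assumes "cancel1 w w'" "near_planar D k w'"
  shows "near_planar D k w"
proof -
  obtain u x v where w: "w = u @ x # inv_letter x # v" "w' = u @ v" using assms(1) by (auto simp: cancel1_def)
  obtain Z V E b b0 p where *: "planar C Z V E k b p" "map lbl p = w'" "near E D b0 Z"
    using assms(2) by (auto simp: near_planar_def)
  obtain p1 p2 where p: "p = p1 @ p2" "map lbl p1 = u" "map lbl p2 = v"
    using *(2) w by (auto simp: map_eq_append_conv)
  have "walk b (p1 @ p2) b" "finite V" using *(1) p by (auto simp: planar_def plane_map_def)
  then obtain c n where c: "walk b p1 c" and n: "n \<notin> V"
    unfolding walk_append using ex_new_if_finite[OF infinite_UNIV_nat, of V] by blast
  let ?d = "mk_dart c x n"
  have "planar C Z (insert n V) (insert (fst ?d) E) k b (p1 @ ?d # inv_letter ?d # p2)"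
    using planar_leaf_at[of Z V E k b p1 p2 ?d] *(1) p c n by simp
  moreover have "map lbl (p1 @ ?d # inv_letter ?d # p2) = w" using p w by simp
  moreover have "near (insert (fst ?d) E) D b0 Z" by (rule near_mono[OF *(3)]) auto
  ultimately show ?thesis unfolding near_planar_def by blast
qed

lemma near_planar_expands: "cancel1\<^sup>*\<^sup>* w w' \<Longrightarrow> near_planar D k w' \<Longrightarrow> near_planar D k w"
  by (induction rule: converse_rtranclp_induct) (auto intro: near_planar_expand)

end

section \<open>Folding\<close>

fun dpath :: "('v, 'e, 'a) two_complex \<Rightarrow> 'v \<Rightarrow> 'e word \<Rightarrow> 'v \<Rightarrow> bool" where
  "dpath X v [] v' = (v = v')"
| "dpath X v (d # p) v' = (d \<in> darts X \<and> origin X d = v \<and> dpath X (origin X (inv_letter d)) p v')"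

definition morph :: "('v, 'e, 'a) two_complex \<Rightarrow> ('v, 'e, 'a) two_complex \<Rightarrow> ('e \<Rightarrow> 'e) \<Rightarrow> ('v \<Rightarrow> 'v) \<Rightarrow> bool" where
  "morph X Y g h \<longleftrightarrow> edges Y = g ` edges X \<and> loops Y = map (map_prod g id) ` loops X \<and>
    (\<forall>x \<in> edges X. src Y (g x) = h (src X x) \<and> tgt Y (g x) = h (tgt X x) \<and> lab Y (g x) = lab X x)"

lemma morph_trans: "morph X Y g h \<Longrightarrow> morph Y Z g' h' \<Longrightarrow> morph X Z (g' \<circ> g) (h' \<circ> h)"
  unfolding morph_def by (auto simp: image_image prod.map_comp comp_def id_def)

lemma fold_step_morph: "fold_step X Y \<Longrightarrow> \<exists>g h. morph X Y g h"
proof (induction rule: fold_step.induct)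
  case (fold_out e X e')
  then show ?case
    by (intro exI[of _ "id(e' := e)"] exI[of _ "id(tgt X e' := tgt X e)"]) (auto simp: morph_def identify_def fun_upd_def)
next
  case (fold_in e X e')
  then show ?case
    by (intro exI[of _ "id(e' := e)"] exI[of _ "id(src X e' := src X e)"]) (auto simp: morph_def identify_def fun_upd_def)
qed

lemma fold_steps_morph: "fold_step\<^sup>*\<^sup>* X Y \<Longrightarrow> \<exists>g h. morph X Y g h"
proof (induction rule: rtranclp_induct)
  case base
  have "morph X X id id" by (simp add: morph_def prod.map_id0)
  then show ?case by blast
next
  case (step Y Z)
  then show ?case using fold_step_morph morph_trans by blast
qed

lemma fold_step_card:
  assumes "fold_step X Y" "finite (edges X)"
  shows "finite (edges Y)" "card (edges Y) < card (edges X)"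
proof -
  obtain e e' where e: "e \<in> edges X" "e' \<in> edges X" "e \<noteq> e'" "edges Y = id(e' := e) ` edges X"
    using assms(1) by cases (auto simp: identify_def)
  show "finite (edges Y)" using e assms by simp
  have "edges Y \<subseteq> edges X - {e'}" using e by auto
  then have "card (edges Y) \<le> card (edges X - {e'})" using assms(2) by (intro card_mono) auto
  also have "\<dots> < card (edges X)" using e assms(2) by (intro card_Diff1_less)
  finally show "card (edges Y) < card (edges X)" .
qed

lemma folds_to_exists: "finite (edges X) \<Longrightarrow> \<exists>Y. folds_to X Y"
proof (induction "card (edges X)" arbitrary: X rule: less_induct)
  case less
  show ?case
  proof (cases "\<exists>Z. fold_step X Z")
    case True
    then obtain Z where Z: "fold_step X Z" ..
    then obtain Y where "folds_to Z Y" using less fold_step_card by blast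
    then show ?thesis using Z unfolding folds_to_def by (meson converse_rtranclp_into_rtranclp)
  next
    case False
    then show ?thesis unfolding folds_to_def by blast
  qed
qed

lemma map_prod_inv_word: "map (map_prod g id) (inv_word l) = inv_word (map (map_prod g id) l)"
  by (induction l) (auto simp: inv_letter_def)

lemma loop_class_map: "loop_class (map (map_prod g id) l) = map (map_prod g id) ` loop_class l"
  unfolding loop_class_def image_UN by (simp add: rotate_map flip: map_prod_inv_word)

lemma loop_class_swap: "loop_class (v @ u) \<subseteq> loop_class (u @ v)"
proof -
  have "rotate k (v @ u) \<in> loop_class (u @ v)" for k
    unfolding loop_class_def
    by (rule UN_I[of "k + length u"]) (auto simp: rotate_append simp flip: rotate_rotate)
  moreover have "rotate k (inv_word (v @ u)) \<in> loop_class (u @ v)" for k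
    unfolding loop_class_def
    by (rule UN_I[of "k + length v"]) (auto simp: rotate_append[of "inv_word v", simplified] simp flip: rotate_rotate)
  ultimately show ?thesis unfolding loop_class_def[of "v @ u"] by auto
qed

lemma loop_class_rotate: "loop_class (rotate k l) = loop_class l"
  using loop_class_swap[of "take (k mod length l) l" "drop (k mod length l) l"]
    loop_class_swap[of "drop (k mod length l) l" "take (k mod length l) l"]
  by (auto simp: rotate_drop_take)

text \<open>Rotating and reversing loops commutes with a morphism of complexes, so classes of loops
  are mapped onto classes of loops.\<close>

lemma face_count_morph:
  assumes "morph X Y g h" "finite (loops X)"
  shows "face_count Y \<le> face_count X"
proof -
  have "loop_class ` loops Y = image (map (map_prod g id)) ` (loop_class ` loops X)"
    using assms(1) by (simp add: morph_def image_image loop_class_map)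
  then show ?thesis unfolding face_count_def using card_image_le assms(2) by (metis finite_imageI)
qed

lemma dart_morph:
  assumes "morph X Y g h" "d \<in> darts X"
  shows "map_prod g id d \<in> darts Y" "origin Y (map_prod g id d) = h (origin X d)"
    "map_prod (lab Y) id (map_prod g id d) = map_prod (lab X) id d"
  using assms by (cases d; auto simp: morph_def darts_def letters_def origin_def)+

lemma inv_letter_map_prod: "inv_letter (map_prod g id d) = map_prod g id (inv_letter d)"
  by (simp add: inv_letter_def)

lemma inv_letter_in_darts [simp]: "inv_letter d \<in> darts X \<longleftrightarrow> d \<in> darts X"
  by (simp add: darts_def)

lemma dpath_morph:
  assumes "morph X Y g h" "dpath X v p u"
  shows "dpath Y (h v) (map (map_prod g id) p) (h u)" "path_label Y (map (map_prod g id) p) = path_label X p"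
  using assms(2)
  by (induction p arbitrary: v)
    (auto simp: path_label_def dart_morph[OF assms(1)] inv_letter_map_prod simp del: map_prod_simp)

text \<open>Two such darts, if distinct, would permit another fold. A completely folded complex is
  thus deterministic: a path is determined by its start and its label.\<close>

lemma folded_darts_eq:
  assumes "\<nexists>Z. fold_step Y Z" "d \<in> darts Y" "d' \<in> darts Y" "origin Y d = origin Y d'"
    "map_prod (lab Y) id d = map_prod (lab Y) id d'"
  shows "d = d'"
proof (rule ccontr)
  assume "d \<noteq> d'"
  moreover obtain e s e' s' where d: "d = (e, s)" "d' = (e', s')" by (metis surj_pair)
  ultimately have "e \<noteq> e'" "s = s'" "e \<in> edges Y" "e' \<in> edges Y" "lab Y e = lab Y e'"
    using assms by (auto simp: darts_def letters_def)
  then show False using assms(1,4) fold_out[of e Y e'] fold_in[of e Y e'] d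
    by (cases s) (auto simp: origin_def)
qed

lemma folded_dpath_eq:
  assumes "\<nexists>Z. fold_step Y Z" "dpath Y v p u" "dpath Y v q u'" "path_label Y p = path_label Y q"
  shows "p = q \<and> u = u'"
  using assms(2-4)
proof (induction p arbitrary: v q)
  case Nil
  then show ?case by (auto simp: path_label_def)
next
  case (Cons d p)
  then obtain d' q' where q: "q = d' # q'" by (cases q) (auto simp: path_label_def)
  have "d = d'"
    by (rule folded_darts_eq[OF assms(1)]) (use Cons.prems q in \<open>auto simp: path_label_def\<close>)
  then show ?case using Cons q by (auto simp: path_label_def)
qed

lemma card_loops_folded:
  assumes Y: "\<nexists>Z. fold_step Y Z" and A: "finite A" "lab Y ` edges Y \<subseteq> A" and S: "finite S"
    and loops: "\<And>l. l \<in> loops Y \<Longrightarrow> \<exists>v p. dpath Y b p v \<and> length p \<le> D \<and> dpath Y v l v \<and> path_label Y l \<in> S"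
  shows "face_count Y \<le> (2 * card A + 1) ^ D * card S"
proof -
  obtain v p where vp: "\<And>l. l \<in> loops Y \<Longrightarrow> dpath Y b (p l) (v l) \<and> length (p l) \<le> D \<and>
      dpath Y (v l) l (v l) \<and> path_label Y l \<in> S"
    using loops by metis
  let ?W = "{w \<in> words A. length w \<le> D}" and ?f = "\<lambda>l. (path_label Y (p l), path_label Y l)"
  have words: "path_label Y q \<in> words A" if "dpath Y u q u'" for u q u'
    using that A(2) by (induction q arbitrary: u) (auto simp: path_label_def darts_def letters_def)
  have inj: "inj_on ?f (loops Y)"
  proof (rule inj_onI)
    fix l l' assume l: "l \<in> loops Y" "l' \<in> loops Y" "?f l = ?f l'"
    then have "v l = v l'" using folded_dpath_eq[OF Y, of b "p l" "v l" "p l'" "v l'"] vp by auto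
    then have "dpath Y (v l) l (v l)" "dpath Y (v l) l' (v l)" using vp[OF l(1)] vp[OF l(2)] by auto
    then show "l = l'" using folded_dpath_eq[OF Y] l(3) by blast
  qed
  have img: "?f ` loops Y \<subseteq> ?W \<times> S" using vp words by (auto simp: path_label_def)
  have fin: "finite (?W \<times> S)" using finite_words_length_le[OF A(1)] S by auto
  have "face_count Y \<le> card (loops Y)"
    unfolding face_count_def by (rule card_image_le[OF inj_on_finite[OF inj img fin]])
  also have "\<dots> \<le> card (?W \<times> S)" by (rule card_inj_on_le[OF inj img fin])
  also have "\<dots> \<le> (2 * card A + 1) ^ D * card S"
    using card_words_length_le[OF A(1)] by (simp add: card_cartesian_product)
  finally show ?thesis .
qed

section \<open>Van Kampen diagrams\<close>

definition map_complex :: "nat set \<Rightarrow> nat set \<Rightarrow> (nat \<Rightarrow> nat \<times> 'a \<times> nat) \<Rightarrow> (nat letter \<Rightarrow> nat letter) \<Rightarrow>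
    nat word \<Rightarrow> (nat, nat, 'a) two_complex" where
  "map_complex V Ed \<tau> \<sigma> bs = \<lparr>verts = V, edges = Ed, src = fst \<circ> \<tau>, tgt = snd \<circ> snd \<circ> \<tau>,
    lab = fst \<circ> snd \<circ> \<tau>, loops = support (face_map \<sigma>) ` inner Ed bs\<rparr>"

lemma map_complex_simps [simp]:
  "verts (map_complex V Ed \<tau> \<sigma> bs) = V" "edges (map_complex V Ed \<tau> \<sigma> bs) = Ed"
  "loops (map_complex V Ed \<tau> \<sigma> bs) = support (face_map \<sigma>) ` inner Ed bs"
  "darts (map_complex V Ed \<tau> \<sigma> bs) = letters Ed"
  "origin (map_complex V Ed \<tau> \<sigma> bs) = ini \<circ> proj \<tau>"
  "map_prod (lab (map_complex V Ed \<tau> \<sigma> bs)) id d = lbl (proj \<tau> d)"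
  by (cases d; auto simp: map_complex_def darts_def origin_def fun_eq_iff ini_def proj_def lbl_def)+

lemma path_label_map_complex [simp]: "path_label (map_complex V Ed \<tau> \<sigma> bs) p = map (lbl \<circ> proj \<tau>) p"
  unfolding path_label_def by simp

lemma walk_lift:
  assumes "walk u p v" "fst ` set p \<subseteq> \<tau> ` Ed"
  shows "\<exists>q. dpath (map_complex V Ed \<tau> \<sigma> bs) u q v \<and> length q = length p"
  using assms
proof (induction p arbitrary: u)
  case Nil
  then show ?case by (intro exI[of _ "[]"]) auto
next
  case (Cons d p)
  then obtain e where e: "e \<in> Ed" "\<tau> e = fst d" by auto
  then have d: "proj \<tau> (e, snd d) = d" "(e, snd d) \<in> letters Ed" by (auto simp: proj_def letters_def)
  have "walk (ter d) p v" "fst ` set p \<subseteq> \<tau> ` Ed" using Cons.prems by auto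
  from Cons.IH[OF this] obtain q where
    "dpath (map_complex V Ed \<tau> \<sigma> bs) (ter d) q v" "length q = length p" by blast
  then show ?case using d Cons.prems by (intro exI[of _ "(e, snd d) # q"]) auto
qed

lemma dpath_reachable:
  "dpath X u p v \<Longrightarrow> (u, v) \<in> {(origin X d, origin X (inv_letter d)) |d. d \<in> darts X}\<^sup>*"
  by (induction p arbitrary: u) (auto intro: converse_rtrancl_into_rtrancl)

lemma disc_complex_map_complex:
  assumes pm: "plane_map V Ed \<tau> \<sigma> bs" and linked: "linked V (\<tau> ` Ed)"
  shows "disc_complex (map_complex V Ed \<tau> \<sigma> bs) \<sigma> bs" (is "disc_complex ?X \<sigma> bs")
proof -
  have dart: "(e, s) \<in> letters Ed" if "e \<in> Ed" for e s using that by (simp add: letters_def)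
  have ends: "src ?X ` Ed \<subseteq> V" "tgt ?X ` Ed \<subseteq> V"
  proof -
    have "src ?X e = ini (proj \<tau> (e, True))" "tgt ?X e = ini (proj \<tau> (e, False))" for e
      by (simp_all add: map_complex_def ini_def proj_def)
    then show "src ?X ` Ed \<subseteq> V" "tgt ?X ` Ed \<subseteq> V" using pm dart by (auto simp: plane_map_def)
  qed
  have "letters Ed = {} \<longleftrightarrow> Ed = {}" by (auto simp: letters_def)
  moreover have "hd bs \<in> letters Ed" if "Ed \<noteq> {}"
  proof -
    have "bs \<noteq> []" "set bs \<subseteq> letters Ed" using pm that by (auto simp: plane_map_def cyc_def)
    then show ?thesis using hd_in_set by blast
  qed
  moreover have "bs = support (face_map \<sigma>) (hd bs)" if "Ed \<noteq> {}"
    using pm that cyc_support_hd[of "face_map \<sigma>" bs] by (simp add: plane_map_def)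
  ultimately have bs: "if darts ?X = {} then bs = [] else \<exists>d \<in> darts ?X. bs = support (face_map \<sigma>) d"
    using pm by (auto simp del: comp_apply simp: plane_map_def split: if_splits)
  have "(u, v) \<in> {(origin ?X d, origin ?X (inv_letter d)) |d. d \<in> darts ?X}\<^sup>*" if "u \<in> V" "v \<in> V" for u v
  proof -
    from linked[unfolded linked_def, rule_format, OF that]
    obtain p where p: "walk u p v" "fst ` set p \<subseteq> \<tau> ` Ed" by blast
    obtain q where "dpath ?X u q v" using walk_lift[OF p] by blast
    then show ?thesis by (rule dpath_reachable)
  qed
  moreover have "loops ?X = {support (face_map \<sigma>) d |d. d \<in> darts ?X - set bs}"
    unfolding map_complex_simps inner_def by (rule Setcompr_eq_image[symmetric])
  moreover have "\<forall>d \<in> darts ?X. orbit \<sigma> d = {d' \<in> darts ?X. origin ?X d' = origin ?X d}"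
    using pm unfolding map_complex_simps plane_map_def vertex_cycles_def by blast
  ultimately show ?thesis
    unfolding disc_complex_def using pm ends bs by (simp add: plane_map_def inner_def)
qed

text \<open>An orbit determines its loop up to rotation, whereas \<open>face_count\<close> also
  ignores direction, so the class of a loop factors through its orbit.\<close>

lemma card_loop_classes:
  assumes pm: "plane_map V Ed \<tau> \<sigma> bs"
  shows "face_count (map_complex V Ed \<tau> \<sigma> bs) \<le> card (orbit (face_map \<sigma>) ` inner Ed bs)"
proof -
  let ?\<phi> = "face_map \<sigma>"
  define F where "F S = loop_class (support ?\<phi> (SOME d. d \<in> S))" for S
  have "loop_class (support ?\<phi> d) = F (orbit ?\<phi> d)" if d: "d \<in> inner Ed bs" for d
  proof -
    note c = inner_support[OF pm d]
    have dd: "d \<in> set (support ?\<phi> d)" using c by (metis cyc_def hd_in_set)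
    have o: "orbit ?\<phi> d = set (support ?\<phi> d)" by (rule cyc_orbit[OF c(1) dd])
    define d' where "d' = (SOME d'. d' \<in> orbit ?\<phi> d)"
    have "d' \<in> orbit ?\<phi> d" unfolding d'_def using dd o by (metis someI_ex)
    then obtain k where k: "support ?\<phi> d' = rotate k (support ?\<phi> d)" using cyc_support[OF c(1)] o by metis
    then show ?thesis by (simp add: F_def loop_class_rotate flip: d'_def)
  qed
  then have "loop_class ` loops (map_complex V Ed \<tau> \<sigma> bs) = F ` (orbit ?\<phi> ` inner Ed bs)"
    by (simp add: image_image)
  moreover have "finite (inner Ed bs)" using pm finite_letters by (auto simp: plane_map_def inner_def)
  ultimately show ?thesis unfolding face_count_def using card_image_le by (metis finite_imageI)
qed

text \<open>The face map sends a dart to one that leaves from its end, so consecutive darts of a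
  face cycle fit together.\<close>

lemma dpath_face_walk:
  assumes "map \<phi> xs = tl xs @ [y]" "xs \<noteq> []" "set xs \<subseteq> darts X"
    "\<And>x. x \<in> darts X \<Longrightarrow> origin X (\<phi> x) = origin X (inv_letter x)"
  shows "dpath X (origin X (hd xs)) xs (origin X y)"
  using assms(1-3)
proof (induction xs)
  case (Cons x xs)
  then show ?case using assms(4)[of x] by (cases xs) auto
qed simp

lemma van_kampen_of_planar:
  assumes A: "finite A" and R: "R \<subseteq> words A" and fin: "finite (cyclic_relators R)"
    and pl: "relators.near_planar (cyclic_relators R) D k w" and w: "w \<in> words A"
  shows "\<exists>X :: (nat, nat, 'a) two_complex. van_kampen A R w X \<and> folded_area X \<le> k \<and>
    folded_area X \<le> (2 * card A + 1) ^ D * card (cyclic_relators R)"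
proof -
  let ?C = "cyclic_relators R"
  interpret relators ?C by (rule relators_cyclic)
  obtain Z V E b b0 p where *: "planar ?C Z V E k b p" "map lbl p = w" "near E D b0 Z"
    using pl by (auto simp: near_planar_def)
  obtain Ed \<tau> \<sigma> bs where pm: "plane_map V Ed \<tau> \<sigma> bs" and E: "\<tau> ` Ed = E" and bs: "map (proj \<tau>) bs = p"
    and k: "card (orbit (face_map \<sigma>) ` inner Ed bs) \<le> k"
    and faces: "\<And>d. d \<in> inner Ed bs \<Longrightarrow> map (lbl \<circ> proj \<tau>) (support (face_map \<sigma>) d) \<in> ?C \<and> ini (proj \<tau> d) \<in> Z"
    using *(1) unfolding planar_def by blast
  define X where "X = map_complex V Ed \<tau> \<sigma> bs"
  let ?\<phi> = "face_map \<sigma>"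
  \<comment> \<open>The forward dart of an edge lies on the outer walk, which is labelled by
    \<open>w\<close>, or on a face, which is labelled by a rotated relator.\<close>
  have lab: "fst (snd (\<tau> e)) \<in> A" if "e \<in> Ed" for e
  proof -
    have label: "(fst (snd (\<tau> e)), True) = lbl (proj \<tau> (e, True))" by (simp add: lbl_def proj_def)
    have e: "(e, True) \<in> letters Ed" using that by (simp add: letters_def)
    have "lbl (proj \<tau> (e, True)) \<in> letters A"
    proof (cases "(e, True) \<in> set bs")
      case True
      then have "lbl (proj \<tau> (e, True)) \<in> set w" using bs *(2) by (auto simp flip: bs)
      then show ?thesis using w by (auto simp: words_def)
    next
      case False
      then have i: "(e, True) \<in> inner Ed bs" using e by (simp add: inner_def)
      note c = inner_support[OF pm i]
      have "(e, True) \<in> set (support ?\<phi> (e, True))" using c by (metis cyc_def hd_in_set)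
      then have "lbl (proj \<tau> (e, True)) \<in> set (map (lbl \<circ> proj \<tau>) (support ?\<phi> (e, True)))"
        by (metis (no_types, lifting) comp_apply image_eqI list.set_map)
      then show ?thesis using faces[OF i] cyclic_relators_words[OF R] by (auto simp: words_def lists_eq_set simp del: comp_apply set_map)
    qed
    then show ?thesis by (simp add: letters_def flip: label)
  qed
  have "lab X ` edges X \<subseteq> A" using lab by (auto simp: X_def map_complex_def)
  moreover have "disc_complex X \<sigma> bs"
    unfolding X_def using *(1) E by (intro disc_complex_map_complex[OF pm]) (auto simp: planar_def)
  moreover have "path_label X bs = w" using bs *(2) by (auto simp: X_def)
  moreover have "\<exists>i. path_label X (rotate i l) \<in> sym_rel R" if "l \<in> loops X" for l
  proof -
    have "path_label X l \<in> ?C" using that faces by (auto simp: X_def simp del: map_map)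
    then obtain u v where "u @ v \<in> sym_rel R" "path_label X l = v @ u" by (auto simp: cyclic_relators_def)
    then show ?thesis
      by (intro exI[of _ "length v"]) (simp add: path_label_def rotate_append flip: rotate_map)
  qed
  ultimately have vk: "van_kampen A R w X" unfolding van_kampen_def by blast
  have "finite Ed" using pm by (simp add: plane_map_def)
  then have finE: "finite (edges X)" and finL: "finite (loops X)"
    using finite_letters[of Ed] by (simp_all add: X_def inner_def)
  define Y where "Y = (SOME Y. folds_to X Y)"
  have Y: "folds_to X Y" unfolding Y_def using folds_to_exists[OF finE] by (rule someI_ex)
  then obtain g h where gh: "morph X Y g h" using fold_steps_morph unfolding folds_to_def by blast
  have area: "folded_area X = face_count Y" by (simp add: folded_area_def Y_def)
  have "folded_area X \<le> k"
    unfolding area using face_count_morph[OF gh finL] card_loop_classes[OF pm] k by (simp add: X_def)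
  moreover have "folded_area X \<le> (2 * card A + 1) ^ D * card ?C"
    unfolding area
  proof (rule card_loops_folded[where b = "h b0"])
    show "\<nexists>Z. fold_step Y Z" using Y by (simp add: folds_to_def)
    show "lab Y ` edges Y \<subseteq> A" using gh lab by (auto simp: morph_def X_def map_complex_def)
    fix l assume "l \<in> loops Y"
    then obtain l0 where l0: "l0 \<in> loops X" "l = map (map_prod g id) l0" using gh by (auto simp: morph_def)
    then obtain d where d: "d \<in> inner Ed bs" "l0 = support ?\<phi> d" by (auto simp: X_def)
    note c = inner_support[OF pm d(1)]
    obtain q where "walk b0 q (ini (proj \<tau> d))" "fst ` set q \<subseteq> E" "length q \<le> D"
      using *(3) faces[OF d(1)] unfolding near_def by blast
    then obtain q' where q': "dpath X b0 q' (origin X d)" "length q' \<le> D"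
      unfolding X_def using walk_lift[of b0 q "ini (proj \<tau> d)" \<tau> Ed V \<sigma> bs] E by auto
    have "origin X (?\<phi> x) = origin X (inv_letter x)" if "x \<in> darts X" for x
    proof -
      have "\<sigma> (inv_letter x) \<in> orbit \<sigma> (inv_letter x)" by (rule orbit.base)
      moreover have "inv_letter x \<in> letters Ed" using that by (simp add: X_def)
      ultimately show ?thesis using pm unfolding X_def plane_map_def vertex_cycles_def by auto
    qed
    moreover have "map ?\<phi> l0 = tl l0 @ [hd l0]" "l0 \<noteq> []"
      using c(1) d(2) by (auto simp: cyc_def rotate1_hd_tl simp del: map_map)
    moreover have "set l0 \<subseteq> darts X" using c(2) d(2) by (auto simp: X_def inner_def)
    ultimately have "dpath X (origin X (hd l0)) l0 (origin X (hd l0))" by (intro dpath_face_walk)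
    then have "dpath X (origin X d) l0 (origin X d)" using c(3) d(2) by simp
    moreover have "path_label X l0 \<in> ?C" using faces[OF d(1)] d(2) by (simp add: X_def)
    ultimately show "\<exists>v p. dpath Y (h b0) p v \<and> length p \<le> D \<and> dpath Y v l v \<and> path_label Y l \<in> ?C"
      using dpath_morph[OF gh] q' l0(2) by (metis length_map)
  qed (use A fin in auto)
  ultimately show ?thesis using vk by blast
qed

lemma van_kampen_of_fills:
  assumes A: "finite A" and R: "R \<subseteq> words A" "[] \<notin> R" and K: "\<And>r. r \<in> sym_rel R \<Longrightarrow> length r \<le> K"
    and w: "fills A R {x. length x \<le> d} k w"
  shows "\<exists>X :: (nat, nat, 'a) two_complex. van_kampen A R w X \<and> folded_area X \<le> k \<and>
    folded_area X \<le> (2 * card A + 1) ^ (d + K) * card (cyclic_relators R)"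
proof -
  interpret relators "cyclic_relators R" by (rule relators_cyclic)
  have wA: "w \<in> words A" using w free_eq_in_words by (auto simp: fills_def)
  have "cyclic_relators R \<subseteq> {r \<in> words A. length r \<le> K}"
    using cyclic_relators_words[OF R(1)] length_cyclic_relators[OF K] by blast
  then have fin: "finite (cyclic_relators R)"
    using finite_words_length_le[OF A] finite_subset by blast
  obtain l where l: "l \<le> k" "diagram (d + K) l (nf w)" using diagram_nf_of_fills[OF R K w] by blast
  then obtain l' where l': "l' \<le> k" "near_planar (d + K) l' (nf w)"
    using near_planar_diagram order.trans by blast
  from near_planar_expands[OF cancels_nf l'(2)] have "near_planar (d + K) l' w" .
  from van_kampen_of_planar[OF A R(1) fin this wA] show ?thesis using l'(1) order.trans by blast
qed

section \<open>The inequalities\<close>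

locale finite_presentation =
  fixes A :: "'a set" and R :: "'a word set"
  assumes A: "finite A" and finR: "finite R" and R: "R \<subseteq> words A" and Nil: "[] \<notin> R"
begin

definition trivial_words :: "'a word set" where
  "trivial_words = {w \<in> words A. pres_eq A R w []}"

text \<open>The inserted \<open>0\<close> covers a presentation without relators.\<close>

definition K :: nat where
  "K = Max (insert 0 (length ` sym_rel R))"

definition N :: nat where
  "N = card (cyclic_relators R)"

abbreviation "B \<equiv> 2 * card A + 1"

lemma length_le_K: "r \<in> sym_rel R \<Longrightarrow> length r \<le> K"
  unfolding K_def using finR by (intro Max_ge) (auto simp: sym_rel_def)

lemma finite_trivial_words: "finite {w \<in> trivial_words. length w = n}"
  by (rule finite_subset[OF _ finite_words_length_le[OF A, of n]]) (auto simp: trivial_words_def)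

lemma trivial_fills: "w \<in> trivial_words \<Longrightarrow> \<exists>k. fills A R UNIV k w"
  using fills_of_trivial[OF R] by (simp add: trivial_words_def)

lemma ball_trivial_words: "(\<forall>w \<in> trivial_words. Q w) \<longleftrightarrow> (\<forall>w \<in> words A. pres_eq A R w [] \<longrightarrow> Q w)"
  by (auto simp: trivial_words_def)

section \<open>The minimum functions as pointwise least bounds\<close>

lemma P_min_eq: "P_min A R = (LEAST P. \<forall>w \<in> trivial_words. fills A R UNIV (P (length w)) w)"
  unfolding P_min_def isoperimetric_def fills_def ball_trivial_words by simp

lemma d_min_eq: "d_min A R = (LEAST D. \<forall>w \<in> trivial_words. \<exists>k. fills A R {x. length x \<le> D (length w)} k w)"
proof -
  have "isodiametric A R D \<longleftrightarrow> (\<forall>w \<in> trivial_words. \<exists>k. fills A R {x. length x \<le> D (length w)} k w)" for D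
    unfolding isodiametric_def fills_def ball_trivial_words by (fastforce intro!: order.refl)
  then show ?thesis by (simp add: d_min_def)
qed

lemma f_min_eq: "f_min A R = (LEAST F. \<forall>w \<in> trivial_words. rewritable A R (F (length w)) w [])"
  unfolding f_min_def filling_length_def rewritable_def ball_trivial_words by simp

lemma p_min_eq: "p_min A R = (LEAST p. \<forall>w \<in> trivial_words.
    \<exists>X :: (nat, nat, 'a) two_complex. van_kampen A R w X \<and> folded_area X \<le> p (length w))"
  unfolding p_min_def folded_isoperimetric_def ball_trivial_words by simp

lemma P_min:
  shows fills_P_min: "w \<in> trivial_words \<Longrightarrow> fills A R UNIV (P_min A R (length w)) w"
    and P_min_le: "(\<And>w. w \<in> trivial_words \<Longrightarrow> length w = n \<Longrightarrow> fills A R UNIV k w) \<Longrightarrow> P_min A R n \<le> k"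
proof -
  note * = pointwise_Least[where Q = "\<lambda>w k. fills A R UNIV k w" and W = trivial_words and size = length]
  show "w \<in> trivial_words \<Longrightarrow> fills A R UNIV (P_min A R (length w)) w"
    unfolding P_min_eq by (rule *(1)) (use finite_trivial_words trivial_fills in \<open>auto intro: fills_mono\<close>)
  show "(\<And>w. w \<in> trivial_words \<Longrightarrow> length w = n \<Longrightarrow> fills A R UNIV k w) \<Longrightarrow> P_min A R n \<le> k"
    unfolding P_min_eq by (rule *(2)) (use finite_trivial_words trivial_fills in \<open>auto intro: fills_mono\<close>)
qed

lemma d_min:
  shows fills_d_min: "w \<in> trivial_words \<Longrightarrow> \<exists>k. fills A R {x. length x \<le> d_min A R (length w)} k w"
    and d_min_le: "(\<And>w. w \<in> trivial_words \<Longrightarrow> length w = n \<Longrightarrow> \<exists>k. fills A R {x. length x \<le> d} k w) \<Longrightarrow>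
      d_min A R n \<le> d"
proof -
  note * = pointwise_Least[where Q = "\<lambda>w d. \<exists>k. fills A R {x. length x \<le> d} k w" and W = trivial_words and size = length]
  have ex: "\<exists>d k. fills A R {x. length x \<le> d} k w" if "w \<in> trivial_words" for w
    using trivial_fills[OF that] fills_bounded by blast
  have mono: "\<exists>k. fills A R {x. length x \<le> d'} k w" if "\<exists>k. fills A R {x. length x \<le> d} k w" "d \<le> d'" for w d d'
  proof -
    have "{x. length x \<le> d} \<subseteq> {x. length x \<le> d'}" using that(2) by auto
    then show ?thesis using that(1) fills_mono by blast
  qed
  show "w \<in> trivial_words \<Longrightarrow> \<exists>k. fills A R {x. length x \<le> d_min A R (length w)} k w"
    unfolding d_min_eq by (rule *(1)) (use finite_trivial_words ex mono in auto)
  show "(\<And>w. w \<in> trivial_words \<Longrightarrow> length w = n \<Longrightarrow> \<exists>k. fills A R {x. length x \<le> d} k w) \<Longrightarrow>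
      d_min A R n \<le> d"
    unfolding d_min_eq by (rule *(2)) (use finite_trivial_words ex mono in auto)
qed

lemma f_min:
  shows rewritable_f_min: "w \<in> trivial_words \<Longrightarrow> rewritable A R (f_min A R (length w)) w []"
    and f_min_le: "(\<And>w. w \<in> trivial_words \<Longrightarrow> length w = n \<Longrightarrow> rewritable A R k w []) \<Longrightarrow> f_min A R n \<le> k"
proof -
  have ex: "\<exists>k. rewritable A R k w []" if "w \<in> trivial_words" for w
    using trivial_fills[OF that] rewritable_of_fills[OF R Nil length_le_K] by blast
  note * = pointwise_Least[where Q = "\<lambda>w k. rewritable A R k w []" and W = trivial_words and size = length]
  show "w \<in> trivial_words \<Longrightarrow> rewritable A R (f_min A R (length w)) w []"
    unfolding f_min_eq by (rule *(1)) (use finite_trivial_words ex in \<open>auto intro: rewritable_mono\<close>)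
  show "(\<And>w. w \<in> trivial_words \<Longrightarrow> length w = n \<Longrightarrow> rewritable A R k w []) \<Longrightarrow> f_min A R n \<le> k"
    unfolding f_min_eq by (rule *(2)) (use finite_trivial_words ex in \<open>auto intro: rewritable_mono\<close>)
qed

lemma p_min_le:
  assumes "\<And>w. w \<in> trivial_words \<Longrightarrow> length w = n \<Longrightarrow>
    \<exists>X :: (nat, nat, 'a) two_complex. van_kampen A R w X \<and> folded_area X \<le> k"
  shows "p_min A R n \<le> k"
  unfolding p_min_eq
proof (rule pointwise_Least(2)[where size = length])
  fix w assume "w \<in> trivial_words"
  then obtain l d where "fills A R {x. length x \<le> d} l w" using trivial_fills fills_bounded by blast
  from van_kampen_of_fills[OF A R Nil length_le_K this]
  show "\<exists>k. \<exists>X :: (nat, nat, 'a) two_complex. van_kampen A R w X \<and> folded_area X \<le> k" by blast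
qed (use finite_trivial_words assms order.trans in blast)+

section \<open>The inequalities over the natural numbers\<close>

lemma d_min_le_f_min: "d_min A R n \<le> f_min A R n div 2"
proof (rule d_min_le)
  fix w assume w: "w \<in> trivial_words" "length w = n"
  then show "\<exists>k. fills A R {x. length x \<le> f_min A R n div 2} k w"
    using fills_if_rewritable[OF A R _ rewritable_f_min[OF w(1)]] by (auto simp: trivial_words_def)
qed

text \<open>The additive \<open>2 * K\<close> is absorbed as \<open>2 * K * n\<close> when
  \<open>n\<close> is positive; for \<open>n = 0\<close> the word is already empty.\<close>

lemma f_min_le_P_min: "f_min A R n \<le> (3 * K + 1) * (P_min A R n + n)"
proof (rule f_min_le)
  fix w assume w: "w \<in> trivial_words" "length w = n"
  show "rewritable A R ((3 * K + 1) * (P_min A R n + n)) w []"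
  proof (cases "n = 0")
    case True
    then show ?thesis using w by (simp add: rewritable_refl)
  next
    case False
    then have "K * 1 \<le> K * n" by (intro mult_le_mono2) simp
    then have "n + K * P_min A R n + 2 * K \<le> n + K * P_min A R n + 2 * (K * n)" by linarith
    also have "\<dots> \<le> (3 * K + 1) * (P_min A R n + n)" by (simp add: algebra_simps)
    finally have "n + K * P_min A R n + 2 * K \<le> (3 * K + 1) * (P_min A R n + n)" .
    moreover have "rewritable A R (n + K * P_min A R n + 2 * K) w []"
      using rewritable_of_fills[OF R Nil length_le_K fills_P_min[OF w(1)]] w(2) by simp
    ultimately show ?thesis using rewritable_mono by blast
  qed
qed

lemma p_min_le_P_min: "p_min A R n \<le> P_min A R n"
proof (rule p_min_le)
  fix w assume w: "w \<in> trivial_words" "length w = n"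
  obtain d where "fills A R {x. length x \<le> d} (P_min A R n) w"
    using fills_bounded[OF fills_P_min[OF w(1)]] w(2) by blast
  from van_kampen_of_fills[OF A R Nil length_le_K this]
  show "\<exists>X :: (nat, nat, 'a) two_complex. van_kampen A R w X \<and> folded_area X \<le> P_min A R n" by blast
qed

text \<open>The exponent is the square of the bound \<open>B ^ (2 * d + K)\<close> on the size of
  the ball, sorted by powers of \<open>d\<close>. The factor \<open>n + 1\<close> is at most
  \<open>2 * n\<close> for positive \<open>n\<close>, and the empty word needs no conjugates at
  all.\<close>

lemma P_min_double_exponential: "P_min A R n \<le> 2 * n * 4 ^ (B ^ (2 * K) * (B ^ 4) ^ d_min A R n)"
proof (rule P_min_le)
  fix w assume w: "w \<in> trivial_words" "length w = n"
  let ?d = "d_min A R n"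
  show "fills A R UNIV (2 * n * 4 ^ (B ^ (2 * K) * (B ^ 4) ^ ?d)) w"
  proof (cases "n = 0")
    case True
    then show ?thesis using w by (simp add: fills_Nil)
  next
    case False
    obtain k where "fills A R {x. length x \<le> ?d} k w" using fills_d_min w by blast
    then have fills: "fills A R UNIV ((length w + 1) * 4 ^ ((B ^ (2 * ?d + K))\<^sup>2)) w"
      by (rule fills_double_exponential[OF A R, rotated]) (use length_le_K in auto)
    have E: "(B ^ (2 * ?d + K))\<^sup>2 = B ^ (2 * K) * (B ^ 4) ^ ?d"
      by (simp only: power_mult[symmetric] power_add[symmetric]) (simp add: algebra_simps)
    have "(length w + 1) * 4 ^ (B ^ (2 * K) * (B ^ 4) ^ ?d) \<le> 2 * n * 4 ^ (B ^ (2 * K) * (B ^ 4) ^ ?d)"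
      by (rule mult_right_mono) (use False w in simp_all)
    from fills_mono[OF fills[unfolded E] this order.refl] show ?thesis .
  qed
qed

lemma P_min_le_exp_f_min: "P_min A R n \<le> (B\<^sup>2) ^ f_min A R n"
proof (rule P_min_le)
  fix w assume w: "w \<in> trivial_words" "length w = n"
  then obtain k where "k \<le> (B\<^sup>2) ^ f_min A R n" "fills A R {x. length x \<le> f_min A R n div 2} k w"
    using fills_if_rewritable[OF A R _ rewritable_f_min[OF w(1)]] by (auto simp: trivial_words_def)
  then show "fills A R UNIV ((B\<^sup>2) ^ f_min A R n) w" by (rule_tac fills_mono) auto
qed

text \<open>All terms are collected in one power with exponent \<open>m = d + n\<close>. This
  exponent is positive unless the word is empty, so constant factors can be moved into the base, and
  the linear term is absorbed by \<open>m < 2 ^ m\<close>.\<close>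

lemma f_min_le_exp_d_min: "f_min A R n \<le> (2 * (K + 3) * B ^ (2 * K) * B ^ 4) ^ (d_min A R n + n)"
proof (rule f_min_le)
  fix w assume w: "w \<in> trivial_words" "length w = n"
  let ?d = "d_min A R n" and ?Z = "B ^ (2 * K)" and ?Y = "B ^ 4"
  define m where "m = ?d + n"
  show "rewritable A R ((2 * (K + 3) * ?Z * ?Y) ^ (?d + n)) w []"
  proof (cases "n = 0")
    case True
    then show ?thesis using w by (simp add: rewritable_refl)
  next
    case False
    obtain k where "fills A R {x. length x \<le> ?d} k w" using fills_d_min w by blast
    then have rw: "rewritable A R ((2 * ?d + K) + (B ^ (2 * ?d + K))\<^sup>2 + length w) w []"
      by (rule rewritable_exponential[OF A R, rotated]) (use length_le_K in auto)
    have m: "m \<ge> 1" "?d \<le> m" using False by (auto simp: m_def)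
    have "(B ^ (2 * ?d + K))\<^sup>2 = ?Z * ?Y ^ ?d"
      by (simp only: power_mult[symmetric] power_add[symmetric]) (simp add: algebra_simps)
    also have "\<dots> \<le> ?Z * ?Y ^ m" using m by (intro mult_left_mono power_increasing) auto
    finally have 1: "(B ^ (2 * ?d + K))\<^sup>2 \<le> ?Z * ?Y ^ m" .
    have "m < 2 ^ m" by (rule less_exp)
    moreover have "K * 1 \<le> K * 2 ^ m" by (rule mult_le_mono2) simp
    moreover have "(K + 2) * 2 ^ m = K * 2 ^ m + 2 * 2 ^ m" by (simp add: algebra_simps)
    ultimately have "2 * m + K \<le> (K + 2) * 2 ^ m" by linarith
    also have "\<dots> \<le> (K + 2) * 2 ^ m * (?Z * ?Y ^ m)" by simp
    finally have 2: "2 * m + K \<le> (K + 2) * 2 ^ m * (?Z * ?Y ^ m)" .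
    have "(2 * ?d + K) + (B ^ (2 * ?d + K))\<^sup>2 + length w \<le> (2 * m + K) + ?Z * ?Y ^ m"
      using 1 w by (simp add: m_def)
    also have "\<dots> \<le> (K + 2) * 2 ^ m * (?Z * ?Y ^ m) + 2 ^ m * (?Z * ?Y ^ m)" using 2 by (intro add_mono) auto
    also have "\<dots> = ((K + 3) * ?Z) * (2 * ?Y) ^ m" by (simp add: algebra_simps power_mult_distrib)
    also have "\<dots> \<le> ((K + 3) * ?Z) ^ m * (2 * ?Y) ^ m"
      using self_le_power[of "(K + 3) * ?Z" m] m by (intro mult_right_mono) auto
    also have "\<dots> = (((K + 3) * ?Z) * (2 * ?Y)) ^ m" by (rule power_mult_distrib[symmetric])
    also have "\<dots> = (2 * (K + 3) * ?Z * ?Y) ^ m" by (simp only: ac_simps)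
    finally show ?thesis using rw rewritable_mono unfolding m_def by blast
  qed
qed

text \<open>The exponent is kept at least 1 because an exponent 0 would allow only one face. For the
  relators \<open>a\<close> and \<open>b\<close> no conjugators are needed, yet a diagram of the
  word \<open>ab\<close> has two faces with different labels.\<close>

lemma p_min_le_exp_d_min: "p_min A R n \<le> (B ^ (K + 1) * (N + 1)) ^ max 1 (d_min A R n)"
proof (rule p_min_le)
  fix w assume w: "w \<in> trivial_words" "length w = n"
  let ?d = "d_min A R n"
  define m where "m = max 1 ?d"
  obtain k where "fills A R {x. length x \<le> ?d} k w" using fills_d_min w by blast
  from van_kampen_of_fills[OF A R Nil length_le_K this] obtain X :: "(nat, nat, 'a) two_complex"
    where X: "van_kampen A R w X" "folded_area X \<le> B ^ (?d + K) * N" unfolding N_def by blast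
  have m: "1 \<le> m" "?d \<le> m" by (auto simp: m_def)
  have "K * 1 \<le> K * m" using m by (intro mult_le_mono2)
  moreover have "(K + 1) * m = K * m + m" by simp
  ultimately have "?d + K \<le> (K + 1) * m" using m(2) by linarith
  then have "B ^ (?d + K) \<le> (B ^ (K + 1)) ^ m"
    unfolding power_mult[symmetric] by (intro power_increasing) auto
  moreover have "N \<le> (N + 1) ^ m" using self_le_power[of "N + 1" m] m by simp
  ultimately have "B ^ (?d + K) * N \<le> (B ^ (K + 1) * (N + 1)) ^ m"
    unfolding power_mult_distrib by (rule mult_le_mono)
  then show "\<exists>X :: (nat, nat, 'a) two_complex. van_kampen A R w X \<and>
      folded_area X \<le> (B ^ (K + 1) * (N + 1)) ^ max 1 ?d"
    using X unfolding m_def by (meson order.trans)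
qed

end

section \<open>Real constants for the five parts\<close>

theorem theorem2p15:
  fixes A :: "'a set" and R :: "'a word set"
  assumes "finite A" and "finite R" and "R \<subseteq> words A" and "[] \<notin> R"
  shows
    "(\<exists>c::real. c > 1 \<and> (\<forall>n.
        real (d_min A R n) \<le> 1 / 2 * real (f_min A R n) \<and>
        1 / 2 * real (f_min A R n) \<le> c * (real (P_min A R n) + real n) \<and>
        p_min A R n \<le> P_min A R n)) \<and>
     (\<exists>c::real. c > 1 \<and> (\<forall>n. real (P_min A R n) \<le> real n * c powr (c ^ d_min A R n))) \<and>
     (\<exists>c::real. c > 1 \<and> (\<forall>n. real (P_min A R n) \<le> c ^ f_min A R n)) \<and>
     (\<exists>c::real. c > 1 \<and> (\<forall>n. real (f_min A R n) \<le> c ^ (d_min A R n + n))) \<and>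
     (\<exists>c::real. c > 1 \<and> (\<forall>n. real (p_min A R n) \<le> c ^ max 1 (d_min A R n)))"
proof -
  interpret finite_presentation A R by unfold_locales (fact assms)+
  \<comment> \<open>The added \<open>2\<close> makes the base exceed 1 in every case; for instance
    \<open>B\<^sup>2\<close> equals 1 when the alphabet is empty.\<close>
  have exp: "real x \<le> real (b + 2) ^ k" if "x \<le> b ^ k" for x b k :: nat
  proof -
    have "x \<le> (b + 2) ^ k" using that power_mono[of b "b + 2" k] by simp
    then show ?thesis by (metis of_nat_le_iff of_nat_power)
  qed
  have 1: "real (d_min A R n) \<le> 1 / 2 * real (f_min A R n)"
    "1 / 2 * real (f_min A R n) \<le> real (3 * K + 2) * (real (P_min A R n) + real n)" for n
  proof -
    have "2 * d_min A R n \<le> f_min A R n" using d_min_le_f_min[of n] by linarith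
    then show "real (d_min A R n) \<le> 1 / 2 * real (f_min A R n)" by linarith
    \<comment> \<open>With \<open>3 * K + 2\<close> instead of \<open>3 * K + 1\<close> the constant
      exceeds 1 also when \<open>K = 0\<close>.\<close>
    have "f_min A R n \<le> (3 * K + 2) * (P_min A R n + n)"
      using f_min_le_P_min[of n] by simp
    then have "real (f_min A R n) \<le> real ((3 * K + 2) * (P_min A R n + n))" by (rule of_nat_mono)
    moreover have "real ((3 * K + 2) * (P_min A R n + n)) = real (3 * K + 2) * (real (P_min A R n) + real n)"
      by (simp only: of_nat_mult of_nat_add)
    ultimately show "1 / 2 * real (f_min A R n) \<le> real (3 * K + 2) * (real (P_min A R n) + real n)" by linarith
  qed
  define Z Y where "Z = B ^ (2 * K)" and "Y = B ^ 4"
  have Y: "Y \<ge> 1" by (simp add: Y_def)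
  \<comment> \<open>One constant has to serve at both levels: as the lower base it must dominate
    \<open>4 ^ (Z + 1)\<close>, where the additional factor 4 absorbs the factor 2 of the bound, and
    as the base in the exponent it must dominate \<open>Y\<close>.\<close>
  define c where "c = 4 ^ (Z + 1) * Y"
  have c: "c \<ge> 4 ^ (Z + 1)" "c \<ge> Y" using Y by (simp_all add: c_def)
  have c1: "c > 1"
  proof -
    have "1 < (4 :: nat) ^ (Z + 1)" by (rule one_less_power) auto
    then show ?thesis using c by linarith
  qed
  have 2: "real (P_min A R n) \<le> real n * real c powr (real c ^ d_min A R n)" for n
  proof -
    let ?d = "d_min A R n"
    have "Y ^ ?d \<ge> 1" using Y by simp
    then have "(2 :: nat) \<le> 4 ^ (Y ^ ?d)"
      using power_increasing[of 1 "Y ^ ?d" "4 :: nat"] by simp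
    then have "2 * 4 ^ (Z * Y ^ ?d) \<le> (4 :: nat) ^ (Y ^ ?d) * 4 ^ (Z * Y ^ ?d)" by (rule mult_right_mono) simp
    also have "\<dots> = (4 ^ (Z + 1)) ^ (Y ^ ?d)"
      unfolding power_mult[symmetric] power_add[symmetric] by (simp add: algebra_simps)
    also have "\<dots> \<le> c ^ (Y ^ ?d)" using c by (intro power_mono) auto
    also have "\<dots> \<le> c ^ (c ^ ?d)" using c c1 by (intro power_increasing power_mono) auto
    finally have "n * (2 * 4 ^ (Z * Y ^ ?d)) \<le> n * c ^ (c ^ ?d)" by (rule mult_left_mono) simp
    moreover have "P_min A R n \<le> n * (2 * 4 ^ (Z * Y ^ ?d))"
      using P_min_double_exponential[of n] unfolding Z_def Y_def by (simp only: ac_simps)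
    ultimately have "P_min A R n \<le> n * c ^ (c ^ ?d)" by (rule order.trans[rotated])
    then have "real (P_min A R n) \<le> real (n * c ^ (c ^ ?d))" by (rule of_nat_mono)
    also have "\<dots> = real n * real c powr (real c ^ ?d)"
      using c1 powr_realpow[of "real c" "c ^ ?d"] by simp
    finally show ?thesis .
  qed
  have 3: "real (P_min A R n) \<le> real (B\<^sup>2 + 2) ^ f_min A R n" for n
    by (rule exp[OF P_min_le_exp_f_min])
  have 4: "real (f_min A R n) \<le> real (2 * (K + 3) * B ^ (2 * K) * B ^ 4 + 2) ^ (d_min A R n + n)" for n
    by (rule exp[OF f_min_le_exp_d_min])
  have 5: "real (p_min A R n) \<le> real (B ^ (K + 1) * (N + 1) + 2) ^ max 1 (d_min A R n)" for n
    by (rule exp[OF p_min_le_exp_d_min])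
  have gt1: "real (x + 2) > 1" for x :: nat by simp
  show ?thesis
  proof (intro conjI)
    show "\<exists>c::real. c > 1 \<and> (\<forall>n. real (d_min A R n) \<le> 1 / 2 * real (f_min A R n) \<and>
        1 / 2 * real (f_min A R n) \<le> c * (real (P_min A R n) + real n) \<and> p_min A R n \<le> P_min A R n)"
      using 1 p_min_le_P_min by (intro exI[of _ "real (3 * K + 2)"] conjI allI) auto
    show "\<exists>c::real. c > 1 \<and> (\<forall>n. real (P_min A R n) \<le> real n * c powr (c ^ d_min A R n))"
      using 2 c1 by (intro exI[of _ "real c"]) auto
    show "\<exists>c::real. c > 1 \<and> (\<forall>n. real (P_min A R n) \<le> c ^ f_min A R n)"
      using 3 by (intro exI[of _ "real (B\<^sup>2 + 2)"] conjI allI gt1) auto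
    show "\<exists>c::real. c > 1 \<and> (\<forall>n. real (f_min A R n) \<le> c ^ (d_min A R n + n))"
      using 4 by (intro exI[of _ "real (2 * (K + 3) * B ^ (2 * K) * B ^ 4 + 2)"] conjI allI gt1) auto
    show "\<exists>c::real. c > 1 \<and> (\<forall>n. real (p_min A R n) \<le> c ^ max 1 (d_min A R n))"
      using 5 by (intro exI[of _ "real (B ^ (K + 1) * (N + 1) + 2)"] conjI allI gt1) auto
  qed
qed

end
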